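(* Let $\mathcal{C}$ be a finite tensor category over a field $k$. Then the coends $$\int^{X\in\mathcal{C}}F(X^* )\boxtimes X\quad\text{and}\quad\int^{X\in\mathcal{C}}F(X^* )\otimes X$$ exist for every $k$-linear left exact functor $F:\mathcal{C}\to\mathcal{C}$.
   Context: A finite abelian category over a field $k$ is a $k$-linear abelian category equivalent to the category of finite-dimensional right modules over a finite-dimensional $k$-algebra. A finite tensor category over $k$ is a rigid monoidal category whose underlying category is a non-zero finite abelian category over $k$ and whose tensor product is $k$-linear in each variable; the unit object need not be simple. $X^*$ is the left dual of $X$. $\boxtimes$ is Deligne's tensor product of $k$-linear abelian categories. The first coend is that of the functor $\mathcal{C}^{\mathrm{op}}\times\mathcal{C}\to\mathcal{C}\boxtimes\mathcal{C}$, $(X,Y)\mapsto F(X^* )\boxtimes Y$; the second is that of the functor $\mathcal{C}^{\mathrm{op}}\times\mathcal{C}\to\mathcal{C}$, $(X,Y)\mapsto F(X^* )\otimes Y$. *)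

theory Defs
  imports "Jordan_Normal_Form.Matrix" "HOL-Library.FuncSet"
begin

section \<open>Categories\<close>

record ('o, 'm) cat =
  Obj :: "'o set"
  Arr :: "'m set"
  Dom :: "'m \<Rightarrow> 'o"
  Cod :: "'m \<Rightarrow> 'o"
  Idn :: "'o \<Rightarrow> 'm"
  Comp :: "'m \<Rightarrow> 'm \<Rightarrow> 'm"  (infixr \<open>\<cdot>\<index>\<close> 70)

definition homs :: "('o, 'm, 'z) cat_scheme \<Rightarrow> 'o \<Rightarrow> 'o \<Rightarrow> 'm set" where
  "homs C X Y = {f \<in> Arr C. Dom C f = X \<and> Cod C f = Y}"

locale category =
  fixes C :: "('o, 'm, 'z) cat_scheme" (structure)
  assumes Dom_Obj: "f \<in> Arr C \<Longrightarrow> Dom C f \<in> Obj C"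
    and Cod_Obj: "f \<in> Arr C \<Longrightarrow> Cod C f \<in> Obj C"
    and Idn_hom: "X \<in> Obj C \<Longrightarrow> Idn C X \<in> homs C X X"
    and Comp_hom: "f \<in> homs C X Y \<Longrightarrow> g \<in> homs C Y Z \<Longrightarrow> g \<cdot> f \<in> homs C X Z"
    and Comp_Idn: "f \<in> homs C X Y \<Longrightarrow> f \<cdot> Idn C X = f"
    and Idn_Comp: "f \<in> homs C X Y \<Longrightarrow> Idn C Y \<cdot> f = f"
    and Comp_assoc: "f \<in> homs C W X \<Longrightarrow> g \<in> homs C X Y \<Longrightarrow> h \<in> homs C Y Z \<Longrightarrow>
      (h \<cdot> g) \<cdot> f = h \<cdot> (g \<cdot> f)"

definition inverse_arrs :: "('o, 'm, 'z) cat_scheme \<Rightarrow> 'm \<Rightarrow> 'm \<Rightarrow> bool" where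
  "inverse_arrs C f g \<longleftrightarrow> f \<in> Arr C \<and> g \<in> homs C (Cod C f) (Dom C f) \<and>
     g \<cdot>\<^bsub>C\<^esub> f = Idn C (Dom C f) \<and> f \<cdot>\<^bsub>C\<^esub> g = Idn C (Cod C f)"

definition is_iso :: "('o, 'm, 'z) cat_scheme \<Rightarrow> 'm \<Rightarrow> bool" where
  "is_iso C f \<longleftrightarrow> (\<exists>g. inverse_arrs C f g)"

definition inv_arr :: "('o, 'm, 'z) cat_scheme \<Rightarrow> 'm \<Rightarrow> 'm" where
  "inv_arr C f = (THE g. inverse_arrs C f g)"

definition is_mono :: "('o, 'm, 'z) cat_scheme \<Rightarrow> 'm \<Rightarrow> bool" where
  "is_mono C f \<longleftrightarrow> f \<in> Arr C \<and>
     (\<forall>W. \<forall>g \<in> homs C W (Dom C f). \<forall>h \<in> homs C W (Dom C f). f \<cdot>\<^bsub>C\<^esub> g = f \<cdot>\<^bsub>C\<^esub> h \<longrightarrow> g = h)"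

definition is_epi :: "('o, 'm, 'z) cat_scheme \<Rightarrow> 'm \<Rightarrow> bool" where
  "is_epi C f \<longleftrightarrow> f \<in> Arr C \<and>
     (\<forall>W. \<forall>g \<in> homs C (Cod C f) W. \<forall>h \<in> homs C (Cod C f) W. g \<cdot>\<^bsub>C\<^esub> f = h \<cdot>\<^bsub>C\<^esub> f \<longrightarrow> g = h)"

definition zero_object :: "('o, 'm, 'z) cat_scheme \<Rightarrow> 'o \<Rightarrow> bool" where
  "zero_object C Z \<longleftrightarrow> Z \<in> Obj C \<and>
     (\<forall>X \<in> Obj C. (\<exists>!f. f \<in> homs C X Z) \<and> (\<exists>!f. f \<in> homs C Z X))"

definition op_cat :: "('o, 'm, 'z) cat_scheme \<Rightarrow> ('o, 'm) cat" where
  "op_cat C = \<lparr> Obj = Obj C, Arr = Arr C, Dom = Cod C, Cod = Dom C, Idn = Idn C,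
     Comp = (\<lambda>g f. f \<cdot>\<^bsub>C\<^esub> g) \<rparr>"

definition prod_cat ::
  "('o, 'm, 'y) cat_scheme \<Rightarrow> ('p, 'n, 'z) cat_scheme \<Rightarrow> ('o \<times> 'p, 'm \<times> 'n) cat" where
  "prod_cat C D = \<lparr> Obj = Obj C \<times> Obj D, Arr = Arr C \<times> Arr D,
     Dom = map_prod (Dom C) (Dom D), Cod = map_prod (Cod C) (Cod D),
     Idn = map_prod (Idn C) (Idn D),
     Comp = (\<lambda>(g, g') (f, f'). (g \<cdot>\<^bsub>C\<^esub> f, g' \<cdot>\<^bsub>D\<^esub> f')) \<rparr>"


section \<open>Functors and natural transformations\<close>

record ('o, 'm, 'p, 'n) fctr =
  fob :: "'o \<Rightarrow> 'p"
  far :: "'m \<Rightarrow> 'n"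

definition is_functor ::
  "('o, 'm, 'y) cat_scheme \<Rightarrow> ('p, 'n, 'z) cat_scheme \<Rightarrow> ('o, 'm, 'p, 'n) fctr \<Rightarrow> bool" where
  "is_functor C D F \<longleftrightarrow>
     (\<forall>X \<in> Obj C. fob F X \<in> Obj D) \<and>
     (\<forall>X Y. \<forall>f \<in> homs C X Y. far F f \<in> homs D (fob F X) (fob F Y)) \<and>
     (\<forall>X \<in> Obj C. far F (Idn C X) = Idn D (fob F X)) \<and>
     (\<forall>X Y Z. \<forall>f \<in> homs C X Y. \<forall>g \<in> homs C Y Z. far F (g \<cdot>\<^bsub>C\<^esub> f) = far F g \<cdot>\<^bsub>D\<^esub> far F f)"

definition id_fctr :: "('o, 'm, 'o, 'm) fctr" where
  "id_fctr = \<lparr> fob = (\<lambda>X. X), far = (\<lambda>f. f) \<rparr>"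

definition comp_fctr ::
  "('p, 'n, 'q, 'r) fctr \<Rightarrow> ('o, 'm, 'p, 'n) fctr \<Rightarrow> ('o, 'm, 'q, 'r) fctr" where
  "comp_fctr G F = \<lparr> fob = (\<lambda>X. fob G (fob F X)), far = (\<lambda>f. far G (far F f)) \<rparr>"

definition nat_trans ::
  "('o, 'm, 'y) cat_scheme \<Rightarrow> ('p, 'n, 'z) cat_scheme \<Rightarrow>
   ('o, 'm, 'p, 'n) fctr \<Rightarrow> ('o, 'm, 'p, 'n) fctr \<Rightarrow> ('o \<Rightarrow> 'n) \<Rightarrow> bool" where
  "nat_trans C D F G \<alpha> \<longleftrightarrow> is_functor C D F \<and> is_functor C D G \<and>
     (\<forall>X \<in> Obj C. \<alpha> X \<in> homs D (fob F X) (fob G X)) \<and>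
     (\<forall>X Y. \<forall>f \<in> homs C X Y. \<alpha> Y \<cdot>\<^bsub>D\<^esub> far F f = far G f \<cdot>\<^bsub>D\<^esub> \<alpha> X)"

definition nat_iso ::
  "('o, 'm, 'y) cat_scheme \<Rightarrow> ('p, 'n, 'z) cat_scheme \<Rightarrow>
   ('o, 'm, 'p, 'n) fctr \<Rightarrow> ('o, 'm, 'p, 'n) fctr \<Rightarrow> ('o \<Rightarrow> 'n) \<Rightarrow> bool" where
  "nat_iso C D F G \<alpha> \<longleftrightarrow> nat_trans C D F G \<alpha> \<and> (\<forall>X \<in> Obj C. is_iso D (\<alpha> X))"

definition is_equivalence ::
  "('o, 'm, 'y) cat_scheme \<Rightarrow> ('p, 'n, 'z) cat_scheme \<Rightarrow> ('o, 'm, 'p, 'n) fctr \<Rightarrow> bool" where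
  "is_equivalence C D F \<longleftrightarrow> is_functor C D F \<and>
     (\<exists>G. is_functor D C G \<and> (\<exists>\<eta>. nat_iso C C id_fctr (comp_fctr G F) \<eta>) \<and>
          (\<exists>\<epsilon>. nat_iso D D (comp_fctr F G) id_fctr \<epsilon>))"

text \<open>The full subcategory, on a set \<open>S\<close> of functors, of the category of functors from \<open>C\<close>
  to \<open>D\<close>. Components are required to be extensional, so that equality of arrows is equality of
  natural transformations.\<close>

definition functor_cat ::
  "('o, 'm, 'y) cat_scheme \<Rightarrow> ('p, 'n, 'z) cat_scheme \<Rightarrow> ('o, 'm, 'p, 'n) fctr set \<Rightarrow>
   (('o, 'm, 'p, 'n) fctr,
    ('o, 'm, 'p, 'n) fctr \<times> ('o \<Rightarrow> 'n) \<times> ('o, 'm, 'p, 'n) fctr) cat" where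
  "functor_cat C D S = \<lparr> Obj = S,
     Arr = {(F, \<alpha>, G). F \<in> S \<and> G \<in> S \<and> nat_trans C D F G \<alpha> \<and> \<alpha> \<in> extensional (Obj C)},
     Dom = (\<lambda>(F, \<alpha>, G). F), Cod = (\<lambda>(F, \<alpha>, G). G),
     Idn = (\<lambda>F. (F, (\<lambda>X \<in> Obj C. Idn D (fob F X)), F)),
     Comp = (\<lambda>(G', \<beta>, H) (F, \<alpha>, G). (F, (\<lambda>X \<in> Obj C. \<beta> X \<cdot>\<^bsub>D\<^esub> \<alpha> X), H)) \<rparr>"

text \<open>Precomposition with \<open>B\<close> as a functor between functor categories; \<open>A\<close> is the source of
  \<open>B\<close>.\<close>

definition precomp_fctr ::
  "('a, 'b, 'y) cat_scheme \<Rightarrow> ('a, 'b, 'o, 'm) fctr \<Rightarrow>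
   (('o, 'm, 'p, 'n) fctr, ('o, 'm, 'p, 'n) fctr \<times> ('o \<Rightarrow> 'n) \<times> ('o, 'm, 'p, 'n) fctr,
    ('a, 'b, 'p, 'n) fctr, ('a, 'b, 'p, 'n) fctr \<times> ('a \<Rightarrow> 'n) \<times> ('a, 'b, 'p, 'n) fctr) fctr" where
  "precomp_fctr A B = \<lparr> fob = (\<lambda>G. comp_fctr G B),
     far = (\<lambda>(G, \<alpha>, H). (comp_fctr G B, (\<lambda>X \<in> Obj A. \<alpha> (fob B X)), comp_fctr H B)) \<rparr>"


section \<open>Linear and abelian categories over a field\<close>

record ('o, 'm, 'k) lincat = "('o, 'm) cat" +
  zero_arr :: "'o \<Rightarrow> 'o \<Rightarrow> 'm"
  add_arr :: "'m \<Rightarrow> 'm \<Rightarrow> 'm"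
  scale_arr :: "'k \<Rightarrow> 'm \<Rightarrow> 'm"

locale linear_category = category C for C :: "('o, 'm, 'k :: field, 'z) lincat_scheme" (structure) +
  assumes zero_hom: "X \<in> Obj C \<Longrightarrow> Y \<in> Obj C \<Longrightarrow> zero_arr C X Y \<in> homs C X Y"
    and add_hom: "f \<in> homs C X Y \<Longrightarrow> g \<in> homs C X Y \<Longrightarrow> add_arr C f g \<in> homs C X Y"
    and scale_hom: "f \<in> homs C X Y \<Longrightarrow> scale_arr C c f \<in> homs C X Y"
    and add_assoc: "f \<in> homs C X Y \<Longrightarrow> g \<in> homs C X Y \<Longrightarrow> h \<in> homs C X Y \<Longrightarrow>
      add_arr C (add_arr C f g) h = add_arr C f (add_arr C g h)"
    and add_commute: "f \<in> homs C X Y \<Longrightarrow> g \<in> homs C X Y \<Longrightarrow> add_arr C f g = add_arr C g f"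
    and add_zero: "f \<in> homs C X Y \<Longrightarrow> add_arr C f (zero_arr C X Y) = f"
    and add_inverse: "f \<in> homs C X Y \<Longrightarrow> \<exists>g \<in> homs C X Y. add_arr C f g = zero_arr C X Y"
    and scale_add_arr: "f \<in> homs C X Y \<Longrightarrow> g \<in> homs C X Y \<Longrightarrow>
      scale_arr C c (add_arr C f g) = add_arr C (scale_arr C c f) (scale_arr C c g)"
    and scale_add_scalar: "f \<in> homs C X Y \<Longrightarrow>
      scale_arr C (c + d) f = add_arr C (scale_arr C c f) (scale_arr C d f)"
    and scale_scale: "f \<in> homs C X Y \<Longrightarrow> scale_arr C (c * d) f = scale_arr C c (scale_arr C d f)"
    and scale_one: "f \<in> homs C X Y \<Longrightarrow> scale_arr C 1 f = f"
    and Comp_add_right: "f \<in> homs C X Y \<Longrightarrow> f' \<in> homs C X Y \<Longrightarrow> g \<in> homs C Y Z \<Longrightarrow>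
      g \<cdot> add_arr C f f' = add_arr C (g \<cdot> f) (g \<cdot> f')"
    and Comp_add_left: "f \<in> homs C X Y \<Longrightarrow> g \<in> homs C Y Z \<Longrightarrow> g' \<in> homs C Y Z \<Longrightarrow>
      add_arr C g g' \<cdot> f = add_arr C (g \<cdot> f) (g' \<cdot> f)"
    and Comp_scale_right: "f \<in> homs C X Y \<Longrightarrow> g \<in> homs C Y Z \<Longrightarrow>
      g \<cdot> scale_arr C c f = scale_arr C c (g \<cdot> f)"
    and Comp_scale_left: "f \<in> homs C X Y \<Longrightarrow> g \<in> homs C Y Z \<Longrightarrow>
      scale_arr C c g \<cdot> f = scale_arr C c (g \<cdot> f)"

definition is_kernel :: "('o, 'm, 'k, 'z) lincat_scheme \<Rightarrow> 'm \<Rightarrow> 'm \<Rightarrow> bool" where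
  "is_kernel C i f \<longleftrightarrow> i \<in> Arr C \<and> f \<in> Arr C \<and> Cod C i = Dom C f \<and>
     f \<cdot>\<^bsub>C\<^esub> i = zero_arr C (Dom C i) (Cod C f) \<and>
     (\<forall>W. \<forall>g \<in> homs C W (Dom C f). f \<cdot>\<^bsub>C\<^esub> g = zero_arr C W (Cod C f) \<longrightarrow>
        (\<exists>!h. h \<in> homs C W (Dom C i) \<and> i \<cdot>\<^bsub>C\<^esub> h = g))"

definition is_cokernel :: "('o, 'm, 'k, 'z) lincat_scheme \<Rightarrow> 'm \<Rightarrow> 'm \<Rightarrow> bool" where
  "is_cokernel C q f \<longleftrightarrow> q \<in> Arr C \<and> f \<in> Arr C \<and> Dom C q = Cod C f \<and>
     q \<cdot>\<^bsub>C\<^esub> f = zero_arr C (Dom C f) (Cod C q) \<and>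
     (\<forall>W. \<forall>g \<in> homs C (Cod C f) W. g \<cdot>\<^bsub>C\<^esub> f = zero_arr C (Dom C f) W \<longrightarrow>
        (\<exists>!h. h \<in> homs C (Cod C q) W \<and> h \<cdot>\<^bsub>C\<^esub> q = g))"

definition is_biproduct ::
  "('o, 'm, 'k, 'z) lincat_scheme \<Rightarrow> 'o \<Rightarrow> 'o \<Rightarrow> 'o \<Rightarrow> 'm \<Rightarrow> 'm \<Rightarrow> 'm \<Rightarrow> 'm \<Rightarrow> bool" where
  "is_biproduct C X Y S i j p q \<longleftrightarrow>
     i \<in> homs C X S \<and> j \<in> homs C Y S \<and> p \<in> homs C S X \<and> q \<in> homs C S Y \<and>
     p \<cdot>\<^bsub>C\<^esub> i = Idn C X \<and> q \<cdot>\<^bsub>C\<^esub> j = Idn C Y \<and>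
     p \<cdot>\<^bsub>C\<^esub> j = zero_arr C Y X \<and> q \<cdot>\<^bsub>C\<^esub> i = zero_arr C X Y \<and>
     add_arr C (i \<cdot>\<^bsub>C\<^esub> p) (j \<cdot>\<^bsub>C\<^esub> q) = Idn C S"

locale abelian_category =
  linear_category C for C :: "('o, 'm, 'k :: field, 'z) lincat_scheme" (structure) +
  assumes has_zero_object: "\<exists>Z. zero_object C Z"
    and has_biproducts: "X \<in> Obj C \<Longrightarrow> Y \<in> Obj C \<Longrightarrow> \<exists>S i j p q. is_biproduct C X Y S i j p q"
    and has_kernels: "f \<in> Arr C \<Longrightarrow> \<exists>i. is_kernel C i f"
    and has_cokernels: "f \<in> Arr C \<Longrightarrow> \<exists>q. is_cokernel C q f"
    and mono_normal: "is_mono C f \<Longrightarrow> \<exists>g. is_kernel C f g"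
    and epi_normal: "is_epi C f \<Longrightarrow> \<exists>g. is_cokernel C f g"

definition linear_functor ::
  "('o, 'm, 'k, 'y) lincat_scheme \<Rightarrow> ('p, 'n, 'k, 'z) lincat_scheme \<Rightarrow>
   ('o, 'm, 'p, 'n) fctr \<Rightarrow> bool" where
  "linear_functor C D F \<longleftrightarrow> is_functor C D F \<and>
     (\<forall>X Y. \<forall>f \<in> homs C X Y. \<forall>g \<in> homs C X Y.
        far F (add_arr C f g) = add_arr D (far F f) (far F g)) \<and>
     (\<forall>X Y c. \<forall>f \<in> homs C X Y. far F (scale_arr C c f) = scale_arr D c (far F f))"

text \<open>That \<open>i\<close> is a kernel of \<open>f\<close> says precisely that \<open>0 \<rightarrow> X \<rightarrow> Y \<rightarrow> Z\<close>, with maps \<open>i\<close> and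
  \<open>f\<close>, is exact; dually for cokernels.\<close>

definition left_exact ::
  "('o, 'm, 'k, 'y) lincat_scheme \<Rightarrow> ('p, 'n, 'k, 'z) lincat_scheme \<Rightarrow>
   ('o, 'm, 'p, 'n) fctr \<Rightarrow> bool" where
  "left_exact C D F \<longleftrightarrow> linear_functor C D F \<and>
     (\<forall>i f. is_kernel C i f \<longrightarrow> is_kernel D (far F i) (far F f))"

definition right_exact ::
  "('o, 'm, 'k, 'y) lincat_scheme \<Rightarrow> ('p, 'n, 'k, 'z) lincat_scheme \<Rightarrow>
   ('o, 'm, 'p, 'n) fctr \<Rightarrow> bool" where
  "right_exact C D F \<longleftrightarrow> linear_functor C D F \<and>
     (\<forall>q f. is_cokernel C q f \<longrightarrow> is_cokernel D (far F q) (far F f))"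

definition fix_left ::
  "('o, 'm, 'y) cat_scheme \<Rightarrow> ('o \<times> 'p, 'm \<times> 'n, 'q, 'r) fctr \<Rightarrow> 'o \<Rightarrow> ('p, 'n, 'q, 'r) fctr" where
  "fix_left C B X = \<lparr> fob = (\<lambda>Y. fob B (X, Y)), far = (\<lambda>g. far B (Idn C X, g)) \<rparr>"

definition fix_right ::
  "('p, 'n, 'y) cat_scheme \<Rightarrow> ('o \<times> 'p, 'm \<times> 'n, 'q, 'r) fctr \<Rightarrow> 'p \<Rightarrow> ('o, 'm, 'q, 'r) fctr" where
  "fix_right D B Y = \<lparr> fob = (\<lambda>X. fob B (X, Y)), far = (\<lambda>f. far B (f, Idn D Y)) \<rparr>"

definition bilinear_functor ::
  "('o, 'm, 'k, 'x) lincat_scheme \<Rightarrow> ('p, 'n, 'k, 'y) lincat_scheme \<Rightarrow>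
   ('q, 'r, 'k, 'z) lincat_scheme \<Rightarrow> ('o \<times> 'p, 'm \<times> 'n, 'q, 'r) fctr \<Rightarrow> bool" where
  "bilinear_functor C D E B \<longleftrightarrow> is_functor (prod_cat C D) E B \<and>
     (\<forall>X \<in> Obj C. linear_functor D E (fix_left C B X)) \<and>
     (\<forall>Y \<in> Obj D. linear_functor C E (fix_right D B Y))"

definition right_exact_bifunctor ::
  "('o, 'm, 'k, 'x) lincat_scheme \<Rightarrow> ('p, 'n, 'k, 'y) lincat_scheme \<Rightarrow>
   ('q, 'r, 'k, 'z) lincat_scheme \<Rightarrow> ('o \<times> 'p, 'm \<times> 'n, 'q, 'r) fctr \<Rightarrow> bool" where
  "right_exact_bifunctor C D E B \<longleftrightarrow> bilinear_functor C D E B \<and>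
     (\<forall>X \<in> Obj C. right_exact D E (fix_left C B X)) \<and>
     (\<forall>Y \<in> Obj D. right_exact C E (fix_right D B Y))"


section \<open>Finite-dimensional modules and finite abelian categories\<close>

text \<open>Finite-dimensional algebras and modules are coordinatised: the underlying vector spaces are
  the spaces \<open>carrier_vec n\<close>. Every finite-dimensional algebra, and every finite-dimensional module
  over it, is isomorphic to one of this form, so \<open>mod_cat A\<close> is (up to equivalence) the category of
  all finite-dimensional right \<open>A\<close>-modules.\<close>

record 'k fdalg =
  adim :: nat
  amul :: "'k vec \<Rightarrow> 'k vec \<Rightarrow> 'k vec"
  aone :: "'k vec"

record 'k rmod =
  mdim :: nat
  mact :: "'k vec \<Rightarrow> 'k vec \<Rightarrow> 'k vec"

definition bilinear_map ::
  "nat \<Rightarrow> nat \<Rightarrow> nat \<Rightarrow> ('k :: field vec \<Rightarrow> 'k vec \<Rightarrow> 'k vec) \<Rightarrow> bool" where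
  "bilinear_map l m n b \<longleftrightarrow>
     (\<forall>v \<in> carrier_vec l. \<forall>w \<in> carrier_vec m. b v w \<in> carrier_vec n) \<and>
     (\<forall>v \<in> carrier_vec l. \<forall>v' \<in> carrier_vec l. \<forall>w \<in> carrier_vec m. b (v + v') w = b v w + b v' w) \<and>
     (\<forall>v \<in> carrier_vec l. \<forall>w \<in> carrier_vec m. \<forall>w' \<in> carrier_vec m. b v (w + w') = b v w + b v w') \<and>
     (\<forall>c. \<forall>v \<in> carrier_vec l. \<forall>w \<in> carrier_vec m.
        b (c \<cdot>\<^sub>v v) w = c \<cdot>\<^sub>v b v w \<and> b v (c \<cdot>\<^sub>v w) = c \<cdot>\<^sub>v b v w)"

definition fd_algebra :: "'k :: field fdalg \<Rightarrow> bool" where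
  "fd_algebra A \<longleftrightarrow> bilinear_map (adim A) (adim A) (adim A) (amul A) \<and>
     aone A \<in> carrier_vec (adim A) \<and>
     (\<forall>a \<in> carrier_vec (adim A). amul A (aone A) a = a \<and> amul A a (aone A) = a) \<and>
     (\<forall>a \<in> carrier_vec (adim A). \<forall>b \<in> carrier_vec (adim A). \<forall>c \<in> carrier_vec (adim A).
        amul A (amul A a b) c = amul A a (amul A b c))"

definition right_module :: "'k :: field fdalg \<Rightarrow> 'k rmod \<Rightarrow> bool" where
  "right_module A M \<longleftrightarrow> bilinear_map (mdim M) (adim A) (mdim M) (mact M) \<and>
     (\<forall>v \<in> carrier_vec (mdim M). mact M v (aone A) = v) \<and>
     (\<forall>v \<in> carrier_vec (mdim M). \<forall>a \<in> carrier_vec (adim A). \<forall>b \<in> carrier_vec (adim A).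
        mact M (mact M v a) b = mact M v (amul A a b))"

definition rmod_hom :: "'k :: field fdalg \<Rightarrow> 'k rmod \<Rightarrow> 'k rmod \<Rightarrow> 'k mat \<Rightarrow> bool" where
  "rmod_hom A M N T \<longleftrightarrow> T \<in> carrier_mat (mdim N) (mdim M) \<and>
     (\<forall>v \<in> carrier_vec (mdim M). \<forall>a \<in> carrier_vec (adim A).
        T *\<^sub>v (mact M v a) = mact N (T *\<^sub>v v) a)"

definition mod_cat ::
  "'k :: field fdalg \<Rightarrow> ('k rmod, 'k rmod \<times> 'k mat \<times> 'k rmod, 'k) lincat" where
  "mod_cat A = \<lparr> Obj = {M. right_module A M},
     Arr = {(M, T, N). right_module A M \<and> right_module A N \<and> rmod_hom A M N T},
     Dom = (\<lambda>(M, T, N). M), Cod = (\<lambda>(M, T, N). N),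
     Idn = (\<lambda>M. (M, 1\<^sub>m (mdim M), M)),
     Comp = (\<lambda>(M', S, N') (M, T, N). (M, S * T, N')),
     zero_arr = (\<lambda>M N. (M, 0\<^sub>m (mdim N) (mdim M), N)),
     add_arr = (\<lambda>(M, S, N) (M', T, N'). (M, S + T, N)),
     scale_arr = (\<lambda>c (M, T, N). (M, c \<cdot>\<^sub>m T, N)) \<rparr>"

definition finite_abelian_category :: "('o, 'm, 'k :: field, 'z) lincat_scheme \<Rightarrow> bool" where
  "finite_abelian_category C \<longleftrightarrow> abelian_category C \<and>
     (\<exists>A \<Phi>. fd_algebra A \<and> linear_functor C (mod_cat A) \<Phi> \<and> is_equivalence C (mod_cat A) \<Phi>)"


section \<open>Finite tensor categories\<close>

record ('o, 'm, 'k) moncat = "('o, 'm, 'k) lincat" +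
  Tens :: "('o \<times> 'o, 'm \<times> 'm, 'o, 'm) fctr"
  Unit :: 'o
  Assoc :: "'o \<Rightarrow> 'o \<Rightarrow> 'o \<Rightarrow> 'm"
  Lunit :: "'o \<Rightarrow> 'm"
  Runit :: "'o \<Rightarrow> 'm"

abbreviation tob :: "('o, 'm, 'k, 'z) moncat_scheme \<Rightarrow> 'o \<Rightarrow> 'o \<Rightarrow> 'o" where
  "tob C X Y \<equiv> fob (Tens C) (X, Y)"

abbreviation tar :: "('o, 'm, 'k, 'z) moncat_scheme \<Rightarrow> 'm \<Rightarrow> 'm \<Rightarrow> 'm" where
  "tar C f g \<equiv> far (Tens C) (f, g)"

locale monoidal_category = category C for C :: "('o, 'm, 'k, 'z) moncat_scheme" (structure) +
  assumes Tens_functor: "is_functor (prod_cat C C) C (Tens C)"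
    and Unit_Obj: "Unit C \<in> Obj C"
    and Assoc_hom: "X \<in> Obj C \<Longrightarrow> Y \<in> Obj C \<Longrightarrow> Z \<in> Obj C \<Longrightarrow>
      Assoc C X Y Z \<in> homs C (tob C (tob C X Y) Z) (tob C X (tob C Y Z))"
    and Assoc_iso: "X \<in> Obj C \<Longrightarrow> Y \<in> Obj C \<Longrightarrow> Z \<in> Obj C \<Longrightarrow> is_iso C (Assoc C X Y Z)"
    and Assoc_natural: "f \<in> homs C X X' \<Longrightarrow> g \<in> homs C Y Y' \<Longrightarrow> h \<in> homs C Z Z' \<Longrightarrow>
      Assoc C X' Y' Z' \<cdot> tar C (tar C f g) h = tar C f (tar C g h) \<cdot> Assoc C X Y Z"
    and Lunit_hom: "X \<in> Obj C \<Longrightarrow> Lunit C X \<in> homs C (tob C (Unit C) X) X"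
    and Lunit_iso: "X \<in> Obj C \<Longrightarrow> is_iso C (Lunit C X)"
    and Lunit_natural: "f \<in> homs C X X' \<Longrightarrow>
      Lunit C X' \<cdot> tar C (Idn C (Unit C)) f = f \<cdot> Lunit C X"
    and Runit_hom: "X \<in> Obj C \<Longrightarrow> Runit C X \<in> homs C (tob C X (Unit C)) X"
    and Runit_iso: "X \<in> Obj C \<Longrightarrow> is_iso C (Runit C X)"
    and Runit_natural: "f \<in> homs C X X' \<Longrightarrow>
      Runit C X' \<cdot> tar C f (Idn C (Unit C)) = f \<cdot> Runit C X"
    and pentagon: "W \<in> Obj C \<Longrightarrow> X \<in> Obj C \<Longrightarrow> Y \<in> Obj C \<Longrightarrow> Z \<in> Obj C \<Longrightarrow>
      tar C (Idn C W) (Assoc C X Y Z) \<cdot> Assoc C W (tob C X Y) Z \<cdot> tar C (Assoc C W X Y) (Idn C Z)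
        = Assoc C W X (tob C Y Z) \<cdot> Assoc C (tob C W X) Y Z"
    and triangle: "X \<in> Obj C \<Longrightarrow> Y \<in> Obj C \<Longrightarrow>
      tar C (Idn C X) (Lunit C Y) \<cdot> Assoc C X (Unit C) Y = tar C (Runit C X) (Idn C Y)"

text \<open>\<open>is_left_dual C X X' e c\<close>: \<open>X'\<close> is a left dual of \<open>X\<close>, with evaluation
  \<open>e : X' \<otimes> X \<rightarrow> 1\<close> and coevaluation \<open>c : 1 \<rightarrow> X \<otimes> X'\<close>.\<close>

definition is_left_dual ::
  "('o, 'm, 'k, 'z) moncat_scheme \<Rightarrow> 'o \<Rightarrow> 'o \<Rightarrow> 'm \<Rightarrow> 'm \<Rightarrow> bool" where
  "is_left_dual C X X' e c \<longleftrightarrow> X \<in> Obj C \<and> X' \<in> Obj C \<and>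
     e \<in> homs C (tob C X' X) (Unit C) \<and> c \<in> homs C (Unit C) (tob C X X') \<and>
     Runit C X \<cdot>\<^bsub>C\<^esub> tar C (Idn C X) e \<cdot>\<^bsub>C\<^esub> Assoc C X X' X \<cdot>\<^bsub>C\<^esub>
       tar C c (Idn C X) \<cdot>\<^bsub>C\<^esub> inv_arr C (Lunit C X) = Idn C X \<and>
     Lunit C X' \<cdot>\<^bsub>C\<^esub> tar C e (Idn C X') \<cdot>\<^bsub>C\<^esub> inv_arr C (Assoc C X' X X') \<cdot>\<^bsub>C\<^esub>
       tar C (Idn C X') c \<cdot>\<^bsub>C\<^esub> inv_arr C (Runit C X') = Idn C X'"

text \<open>A right dual of \<open>X\<close> is an object of which \<open>X\<close> is a left dual.\<close>

definition rigid :: "('o, 'm, 'k, 'z) moncat_scheme \<Rightarrow> bool" where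
  "rigid C \<longleftrightarrow> (\<forall>X \<in> Obj C. (\<exists>X' e c. is_left_dual C X X' e c) \<and>
                         (\<exists>X' e c. is_left_dual C X' X e c))"

definition finite_tensor_category :: "('o, 'm, 'k :: field, 'z) moncat_scheme \<Rightarrow> bool" where
  "finite_tensor_category C \<longleftrightarrow> finite_abelian_category C \<and> (\<exists>X \<in> Obj C. \<not> zero_object C X) \<and>
     monoidal_category C \<and> rigid C \<and> bilinear_functor C C C (Tens C)"

text \<open>A choice of a left dual for every object, which turns \<open>X \<mapsto> X\<^sup>*\<close> into a contravariant
  functor.\<close>

record ('o, 'm) duality =
  Dual :: "'o \<Rightarrow> 'o"
  Ev :: "'o \<Rightarrow> 'm"
  Coev :: "'o \<Rightarrow> 'm"

definition left_duality :: "('o, 'm, 'k, 'z) moncat_scheme \<Rightarrow> ('o, 'm) duality \<Rightarrow> bool" where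
  "left_duality C \<delta> \<longleftrightarrow> (\<forall>X \<in> Obj C. is_left_dual C X (Dual \<delta> X) (Ev \<delta> X) (Coev \<delta> X))"

text \<open>For \<open>f : X \<rightarrow> Y\<close>, the arrow \<open>f\<^sup>* : Y\<^sup>* \<rightarrow> X\<^sup>*\<close> is the composite
  \<open>Y\<^sup>* \<rightarrow> Y\<^sup>* \<otimes> 1 \<rightarrow> Y\<^sup>* \<otimes> (X \<otimes> X\<^sup>*) \<rightarrow> Y\<^sup>* \<otimes> (Y \<otimes> X\<^sup>*) \<rightarrow> (Y\<^sup>* \<otimes> Y) \<otimes> X\<^sup>* \<rightarrow> 1 \<otimes> X\<^sup>* \<rightarrow> X\<^sup>*\<close>.\<close>

definition dual_arr :: "('o, 'm, 'k, 'z) moncat_scheme \<Rightarrow> ('o, 'm) duality \<Rightarrow> 'm \<Rightarrow> 'm" where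
  "dual_arr C \<delta> f = (let X = Dom C f; Y = Cod C f; X' = Dual \<delta> X; Y' = Dual \<delta> Y in
     Lunit C X' \<cdot>\<^bsub>C\<^esub> tar C (Ev \<delta> Y) (Idn C X') \<cdot>\<^bsub>C\<^esub> inv_arr C (Assoc C Y' Y X') \<cdot>\<^bsub>C\<^esub>
     tar C (Idn C Y') (tar C f (Idn C X')) \<cdot>\<^bsub>C\<^esub> tar C (Idn C Y') (Coev \<delta> X) \<cdot>\<^bsub>C\<^esub>
     inv_arr C (Runit C Y'))"


section \<open>Deligne's tensor product\<close>

text \<open>\<open>box : C \<times> D \<rightarrow> P\<close> is universal with respect to \<open>E\<close>: composition with \<open>box\<close> is an equivalence
  from the linear right exact functors \<open>P \<rightarrow> E\<close> to the bilinear functors \<open>C \<times> D \<rightarrow> E\<close> that are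
  right exact in each variable.\<close>

definition deligne_universal ::
  "('o, 'm, 'k, 'w) lincat_scheme \<Rightarrow> ('p, 'n, 'k, 'x) lincat_scheme \<Rightarrow>
   ('q, 'r, 'k, 'y) lincat_scheme \<Rightarrow> ('o \<times> 'p, 'm \<times> 'n, 'q, 'r) fctr \<Rightarrow>
   ('s, 't, 'k, 'z) lincat_scheme \<Rightarrow> bool" where
  "deligne_universal C D P box E \<longleftrightarrow>
     is_equivalence (functor_cat P E {G. right_exact P E G})
       (functor_cat (prod_cat C D) E {T. right_exact_bifunctor C D E T})
       (precomp_fctr (prod_cat C D) box)"

text \<open>The test categories \<open>E\<close> have to range over a fixed pair of types. Those chosen here have room
  for a copy of \<open>P\<close> and for a copy of the category of finite-dimensional modules over any
  finite-dimensional algebra. If \<open>C\<close> and \<open>D\<close> are the categories of finite-dimensional right modules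
  over \<open>A\<close> and \<open>B\<close>, the usual uniqueness argument against these two test categories shows that
  \<open>P\<close> is equivalent to the category of finite-dimensional right modules over \<open>A \<otimes> B\<close>, compatibly
  with \<open>box\<close>. So for finite abelian \<open>C\<close> and \<open>D\<close> this is universality among all linear abelian
  categories.\<close>

definition deligne_product ::
  "('o, 'm, 'k :: field, 'x) lincat_scheme \<Rightarrow> ('p, 'n, 'k, 'y) lincat_scheme \<Rightarrow>
   ('q, 'r, 'k) lincat \<Rightarrow> ('o \<times> 'p, 'm \<times> 'n, 'q, 'r) fctr \<Rightarrow> bool" where
  "deligne_product C D P box \<longleftrightarrow> abelian_category P \<and> right_exact_bifunctor C D P box \<and>
     (\<forall>E :: ('q + 'k rmod, 'r + 'k rmod \<times> 'k mat \<times> 'k rmod, 'k) lincat.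
        abelian_category E \<longrightarrow> deligne_universal C D P box E)"


section \<open>Coends\<close>

text \<open>An arrow \<open>f : X \<rightarrow> Y\<close> of \<open>C\<close> is an arrow \<open>Y \<rightarrow> X\<close> of \<open>op_cat C\<close>, so both composites below
  start at \<open>S(Y, X)\<close>.\<close>

definition is_cowedge ::
  "('o, 'm, 'y) cat_scheme \<Rightarrow> ('p, 'n, 'z) cat_scheme \<Rightarrow> ('o \<times> 'o, 'm \<times> 'm, 'p, 'n) fctr \<Rightarrow>
   'p \<Rightarrow> ('o \<Rightarrow> 'n) \<Rightarrow> bool" where
  "is_cowedge C D S K \<iota> \<longleftrightarrow> K \<in> Obj D \<and>
     (\<forall>X \<in> Obj C. \<iota> X \<in> homs D (fob S (X, X)) K) \<and>
     (\<forall>X Y. \<forall>f \<in> homs C X Y.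
        \<iota> X \<cdot>\<^bsub>D\<^esub> far S (f, Idn C X) = \<iota> Y \<cdot>\<^bsub>D\<^esub> far S (Idn C Y, f))"

definition is_coend ::
  "('o, 'm, 'y) cat_scheme \<Rightarrow> ('p, 'n, 'z) cat_scheme \<Rightarrow> ('o \<times> 'o, 'm \<times> 'm, 'p, 'n) fctr \<Rightarrow>
   'p \<Rightarrow> ('o \<Rightarrow> 'n) \<Rightarrow> bool" where
  "is_coend C D S K \<iota> \<longleftrightarrow> is_functor (prod_cat (op_cat C) C) D S \<and> is_cowedge C D S K \<iota> \<and>
     (\<forall>K' \<kappa>. is_cowedge C D S K' \<kappa> \<longrightarrow>
        (\<exists>!h. h \<in> homs D K K' \<and> (\<forall>X \<in> Obj C. h \<cdot>\<^bsub>D\<^esub> \<iota> X = \<kappa> X)))"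

definition coend_exists ::
  "('o, 'm, 'y) cat_scheme \<Rightarrow> ('p, 'n, 'z) cat_scheme \<Rightarrow> ('o \<times> 'o, 'm \<times> 'm, 'p, 'n) fctr \<Rightarrow>
   bool" where
  "coend_exists C D S \<longleftrightarrow> (\<exists>K \<iota>. is_coend C D S K \<iota>)"

text \<open>For a functor \<open>B\<close> on \<open>C \<times> C\<close>, the functor \<open>(X, Y) \<mapsto> B(F(X\<^sup>*), Y)\<close> on the product of the
  opposite of \<open>C\<close> with \<open>C\<close>.\<close>

definition dual_twist ::
  "('o, 'm, 'k, 'z) moncat_scheme \<Rightarrow> ('o, 'm) duality \<Rightarrow> ('o, 'm, 'o, 'm) fctr \<Rightarrow>
   ('o \<times> 'o, 'm \<times> 'm, 'p, 'n) fctr \<Rightarrow> ('o \<times> 'o, 'm \<times> 'm, 'p, 'n) fctr" where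
  "dual_twist C \<delta> F B =
     \<lparr> fob = (\<lambda>(X, Y). fob B (fob F (Dual \<delta> X), Y)),
       far = (\<lambda>(f, g). far B (far F (dual_arr C \<delta> f), g)) \<rparr>"

end

theory Submission
  imports Defs
begin

text \<open>
  Write \<open>S(X, Y)\<close> for either integrand. It is bilinear, and right exact in \<open>Y\<close>: for the
  tensor product of the category this is because \<open>X \<otimes> -\<close> has a right adjoint, given by a right dual of \<open>X\<close>. This is
  enough to reduce the coend to the endomorphisms of one object. Let \<open>G\<close> correspond to the regular
  module, so that \<open>Hom(G, X)\<close> is finite-dimensional and \<open>Hom(G, -)\<close> is faithful. Let
  \<open>\<kappa> : S(G, G) \<rightarrow> K\<close> be the common cokernel of the finitely many differences \<open>S(e, G) - S(G, e)\<close>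
  for \<open>e\<close> in a spanning set of \<open>End(G)\<close>. A finite sum \<open>P\<close> of copies of \<open>G\<close> covers \<open>X\<close> by some
  \<open>p : P \<rightarrow> X\<close>, and right exactness makes \<open>S(X, p)\<close> a cokernel; hence there is exactly one
  \<open>\<iota>\<^sub>X : S(X, X) \<rightarrow> K\<close> with \<open>\<iota>\<^sub>X S(X, a) = \<kappa> S(a, G)\<close> for all \<open>a : G \<rightarrow> X\<close>, and these arrows
  form the universal cowedge.
\<close>

section \<open>Arrows, functors and equivalences\<close>

text \<open>An abelian category has finite colimits only, so a coend indexed by all objects must be
  cut down to finitely many relations. This works because the cowedge equation at an endomorphism of
  \<open>G\<close> is linear in that endomorphism.

  The construction at \<open>X\<close> is dictated by variance. The first variable passes through
  duality and \<open>F\<close>, where right exactness is not at hand, so the presentation of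
  \<open>X\<close> is inserted in the second: \<open>S(X, p)\<close> is a cokernel from
  \<open>S(X, P)\<close> to \<open>S(X, X)\<close>. An arrow out of \<open>S(X, P)\<close> is still
  available, because contravariance turns the same \<open>p\<close> into \<open>S(p, P)\<close>,
  from \<open>S(X, P)\<close> to \<open>S(P, P)\<close>, and on a sum of copies of \<open>G\<close>
  the arrow to \<open>K\<close> is assembled summand by summand.

  That \<open>S\<close> is a linear functor in the first place is not immediate either, the dual of
  an arrow being a long composite of structure maps. It is handled by the adjunction of a dual pair:
  transposition characterises the dual arrow by its effect on coevaluations. The same adjunction
  supplies right exactness of the tensor product.\<close>

context category
begin

lemma homs_iff: "f \<in> homs C X Y \<longleftrightarrow> f \<in> Arr C \<and> Dom C f = X \<and> Cod C f = Y"
  by (simp add: homs_def)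

lemma Comp_Arr [simp]:
  assumes "f \<in> Arr C" "g \<in> Arr C" "Cod C f = Dom C g"
  shows "g \<cdot> f \<in> Arr C" "Dom C (g \<cdot> f) = Dom C f" "Cod C (g \<cdot> f) = Cod C g"
  using Comp_hom[of f "Dom C f" "Cod C f" g "Cod C g"] assms by (auto simp: homs_iff)

lemma Idn_Arr [simp]:
  assumes "X \<in> Obj C"
  shows "Idn C X \<in> Arr C" "Dom C (Idn C X) = X" "Cod C (Idn C X) = X"
  using Idn_hom[OF assms] by (auto simp: homs_iff)

lemma Comp_Idn_Arr [simp]: "f \<in> Arr C \<Longrightarrow> Dom C f = X \<Longrightarrow> f \<cdot> Idn C X = f"
  using Comp_Idn[of f X "Cod C f"] by (auto simp: homs_iff)

lemma Idn_Comp_Arr [simp]: "f \<in> Arr C \<Longrightarrow> Cod C f = Y \<Longrightarrow> Idn C Y \<cdot> f = f"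
  using Idn_Comp[of f "Dom C f" Y] by (auto simp: homs_iff)

lemma Comp_assoc_Arr [simp]:
  assumes "f \<in> Arr C" "g \<in> Arr C" "h \<in> Arr C" "Cod C f = Dom C g" "Cod C g = Dom C h"
  shows "(h \<cdot> g) \<cdot> f = h \<cdot> g \<cdot> f"
  using Comp_assoc[of f "Dom C f" "Cod C f" g "Cod C g" h "Cod C h"] assms by (auto simp: homs_iff)

declare Dom_Obj [simp] Cod_Obj [simp]

lemma homs_Obj: "f \<in> homs C X Y \<Longrightarrow> X \<in> Obj C \<and> Y \<in> Obj C"
  by (auto simp: homs_iff)

text \<open>Guarantees that the definite description in \<open>inv_arr\<close> denotes.\<close>

lemma inverse_arrs_unique:
  assumes "inverse_arrs C f g" "inverse_arrs C f h"
  shows "g = h"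
proof -
  have "g = g \<cdot> f \<cdot> h"
    using assms by (simp add: inverse_arrs_def homs_iff)
  also have "\<dots> = (g \<cdot> f) \<cdot> h"
    using assms by (intro Comp_assoc_Arr[symmetric]) (auto simp: inverse_arrs_def homs_iff)
  also have "\<dots> = h"
    using assms by (simp add: inverse_arrs_def homs_iff)
  finally show ?thesis .
qed

lemma inv_arr_inverse: "is_iso C f \<Longrightarrow> inverse_arrs C f (inv_arr C f)"
  unfolding is_iso_def inv_arr_def by (rule theI') (blast intro: inverse_arrs_unique)

lemma inv_arr_simps [simp]:
  assumes "is_iso C f"
  shows "inv_arr C f \<in> Arr C" "Dom C (inv_arr C f) = Cod C f" "Cod C (inv_arr C f) = Dom C f"
    "inv_arr C f \<cdot> f = Idn C (Dom C f)" "f \<cdot> inv_arr C f = Idn C (Cod C f)"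
  using inv_arr_inverse[OF assms] by (auto simp: inverse_arrs_def homs_iff)

lemma is_iso_Arr: "is_iso C f \<Longrightarrow> f \<in> Arr C"
  using inv_arr_inverse by (auto simp: inverse_arrs_def)

lemma inv_arr_Comp [simp]:
  assumes "is_iso C f" "g \<in> Arr C" "Cod C g = Dom C f"
  shows "inv_arr C f \<cdot> f \<cdot> g = g"
proof -
  have "inv_arr C f \<cdot> f \<cdot> g = (inv_arr C f \<cdot> f) \<cdot> g"
    using assms is_iso_Arr by (intro Comp_assoc_Arr[symmetric]) auto
  then show ?thesis using assms by simp
qed

lemma Comp_inv_arr [simp]:
  assumes "is_iso C f" "g \<in> Arr C" "Cod C g = Cod C f"
  shows "f \<cdot> inv_arr C f \<cdot> g = g"
proof -
  have "f \<cdot> inv_arr C f \<cdot> g = (f \<cdot> inv_arr C f) \<cdot> g"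
    using assms is_iso_Arr by (intro Comp_assoc_Arr[symmetric]) auto
  then show ?thesis using assms by simp
qed

lemma iso_cancel_left:
  assumes "is_iso C f" "g \<in> homs C X (Dom C f)" "h \<in> homs C X (Dom C f)" "f \<cdot> g = f \<cdot> h"
  shows "g = h"
proof -
  have "inv_arr C f \<cdot> f \<cdot> g = g" "inv_arr C f \<cdot> f \<cdot> h = h"
    using assms(1-3) by (auto simp: homs_iff)
  then show ?thesis using assms(4) by metis
qed

lemma iso_cancel_right:
  assumes "is_iso C f" "g \<in> homs C (Cod C f) X" "h \<in> homs C (Cod C f) X" "g \<cdot> f = h \<cdot> f"
  shows "g = h"
proof -
  have "g = (g \<cdot> f) \<cdot> inv_arr C f" "h = (h \<cdot> f) \<cdot> inv_arr C f"
    using assms(1-3) is_iso_Arr by (auto simp: homs_iff)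
  then show ?thesis using assms(4) by metis
qed

lemma inv_arr_is_iso: "is_iso C f \<Longrightarrow> is_iso C (inv_arr C f)"
  by (auto simp: is_iso_def[of C "inv_arr C f"] inverse_arrs_def homs_iff is_iso_Arr intro!: exI[of _ f])

end

lemma functor_Arr:
  assumes "is_functor C D F" "f \<in> Arr C"
  shows "far F f \<in> Arr D" "Dom D (far F f) = fob F (Dom C f)" "Cod D (far F f) = fob F (Cod C f)"
  using assms by (auto simp: is_functor_def homs_def)

lemma functor_Obj: "is_functor C D F \<Longrightarrow> X \<in> Obj C \<Longrightarrow> fob F X \<in> Obj D"
  by (simp add: is_functor_def)

lemma functor_hom: "is_functor C D F \<Longrightarrow> f \<in> homs C X Y \<Longrightarrow> far F f \<in> homs D (fob F X) (fob F Y)"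
  by (simp add: is_functor_def)

lemma functor_Idn: "is_functor C D F \<Longrightarrow> X \<in> Obj C \<Longrightarrow> far F (Idn C X) = Idn D (fob F X)"
  by (simp add: is_functor_def)

lemma functor_Comp:
  assumes "is_functor C D F" "f \<in> Arr C" "g \<in> Arr C" "Cod C f = Dom C g"
  shows "far F (g \<cdot>\<^bsub>C\<^esub> f) = far F g \<cdot>\<^bsub>D\<^esub> far F f"
  using assms by (auto simp: is_functor_def homs_def)

section \<open>Equivalences are faithful, full and essentially surjective\<close>

text \<open>Naturality gives \<open>\<eta> Y \<cdot> f = H (F f) \<cdot> \<eta> X\<close>, so
  \<open>F f\<close> determines \<open>f\<close> once the isomorphism \<open>\<eta> Y\<close> is
  cancelled.\<close>

lemma nat_iso_from_id_faithful:
  assumes C: "category C" and \<eta>: "nat_iso C C id_fctr (comp_fctr H F) \<eta>"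
    and f: "f \<in> homs C X Y" and g: "g \<in> homs C X Y" and eq: "far F f = far F g"
  shows "f = g"
proof -
  interpret category C by fact
  have Y: "Y \<in> Obj C" using f homs_Obj by blast
  have "\<eta> Y \<cdot>\<^bsub>C\<^esub> f = \<eta> Y \<cdot>\<^bsub>C\<^esub> g"
    using \<eta> f g eq by (auto simp: nat_iso_def nat_trans_def id_fctr_def comp_fctr_def)
  moreover have "is_iso C (\<eta> Y)" "Dom C (\<eta> Y) = Y"
    using \<eta> Y by (auto simp: nat_iso_def nat_trans_def id_fctr_def homs_iff)
  ultimately show ?thesis using iso_cancel_left[of "\<eta> Y" f X g] f g by simp
qed

text \<open>The mirror image, by cancelling \<open>\<epsilon> X\<close> on the right. Applied to a
  counit it shows that the quasi-inverse is faithful, which is what fullness requires.\<close>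

lemma nat_iso_to_id_faithful:
  assumes C: "category C" and \<epsilon>: "nat_iso C C (comp_fctr H F) id_fctr \<epsilon>"
    and f: "f \<in> homs C X Y" and g: "g \<in> homs C X Y" and eq: "far F f = far F g"
  shows "f = g"
proof -
  interpret category C by fact
  have X: "X \<in> Obj C" using f homs_Obj by blast
  have "f \<cdot>\<^bsub>C\<^esub> \<epsilon> X = \<epsilon> Y \<cdot>\<^bsub>C\<^esub> far H (far F f)" "g \<cdot>\<^bsub>C\<^esub> \<epsilon> X = \<epsilon> Y \<cdot>\<^bsub>C\<^esub> far H (far F g)"
    using \<epsilon> f g by (simp_all add: nat_iso_def nat_trans_def id_fctr_def comp_fctr_def)
  moreover have "is_iso C (\<epsilon> X)" "Cod C (\<epsilon> X) = X"
    using \<epsilon> X by (auto simp: nat_iso_def nat_trans_def id_fctr_def homs_iff)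
  ultimately show ?thesis using iso_cancel_right[of "\<epsilon> X" f Y g] f g eq by simp
qed

lemma equivalence_faithful:
  assumes "category C" "is_equivalence C D F" "f \<in> homs C X Y" "g \<in> homs C X Y" "far F f = far F g"
  shows "f = g"
proof -
  obtain H \<eta> where "nat_iso C C id_fctr (comp_fctr H F) \<eta>"
    using assms(2) by (auto simp: is_equivalence_def)
  then show ?thesis using nat_iso_from_id_faithful[OF assms(1) _ assms(3-5)] by blast
qed

text \<open>Conjugating \<open>H h\<close> by the unit gives an \<open>f\<close> with
  \<open>H (F f) = H h\<close>, and \<open>H\<close> is faithful by the counit. Unit and counit are
  not assumed to satisfy triangle identities, so \<open>F f = h\<close> is reached through
  faithfulness of \<open>H\<close>.\<close>

lemma equivalence_full:
  assumes C: "category C" and D: "category D" and F: "is_equivalence C D F"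
    and X: "X \<in> Obj C" and Y: "Y \<in> Obj C" and h: "h \<in> homs D (fob F X) (fob F Y)"
  shows "\<exists>f \<in> homs C X Y. far F f = h"
proof -
  interpret C: category C by fact
  obtain H \<eta> \<epsilon> where FF: "is_functor C D F" and H: "is_functor D C H"
    and \<eta>: "nat_iso C C id_fctr (comp_fctr H F) \<eta>" and \<epsilon>: "nat_iso D D (comp_fctr F H) id_fctr \<epsilon>"
    using F by (auto simp: is_equivalence_def)
  have iso: "is_iso C (\<eta> Z)" "\<eta> Z \<in> Arr C" "Dom C (\<eta> Z) = Z" "Cod C (\<eta> Z) = fob H (fob F Z)"
    if "Z \<in> Obj C" for Z
    using \<eta> that by (auto simp: nat_iso_def nat_trans_def id_fctr_def comp_fctr_def C.homs_iff)
  have Hh: "far H h \<in> homs C (fob H (fob F X)) (fob H (fob F Y))"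
    using functor_hom[OF H h] .
  define f where "f = inv_arr C (\<eta> Y) \<cdot>\<^bsub>C\<^esub> far H h \<cdot>\<^bsub>C\<^esub> \<eta> X"
  have f: "f \<in> homs C X Y"
    using iso[OF X] iso[OF Y] Hh by (auto simp: f_def C.homs_iff)
  have Ff: "far F f \<in> homs D (fob F X) (fob F Y)"
    using functor_hom[OF FF f] .
  have HFf: "far H (far F f) \<in> homs C (fob H (fob F X)) (fob H (fob F Y))"
    using functor_hom[OF H Ff] .
  have "far H (far F f) \<cdot>\<^bsub>C\<^esub> \<eta> X = \<eta> Y \<cdot>\<^bsub>C\<^esub> f"
    using \<eta> f by (simp add: nat_iso_def nat_trans_def id_fctr_def comp_fctr_def)
  also have "\<dots> = far H h \<cdot>\<^bsub>C\<^esub> \<eta> X"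
    unfolding f_def using iso[OF X] iso[OF Y] Hh
    by (intro C.Comp_inv_arr) (auto simp: C.homs_iff)
  finally have "far H (far F f) = far H h"
    using C.iso_cancel_right[of "\<eta> X"] iso[OF X] HFf Hh by (auto simp: C.homs_iff)
  then have "far F f = h"
    using nat_iso_to_id_faithful[OF D \<epsilon> Ff h] by blast
  with f show ?thesis by blast
qed

lemma equivalence_essentially_surjective:
  assumes D: "category D" and F: "is_equivalence C D F" and Z: "Z \<in> Obj D"
  shows "\<exists>X \<in> Obj C. \<exists>e \<in> homs D Z (fob F X). is_iso D e"
proof -
  interpret category D by fact
  obtain H \<epsilon> where H: "is_functor D C H" and \<epsilon>: "nat_iso D D (comp_fctr F H) id_fctr \<epsilon>"
    using F by (auto simp: is_equivalence_def)
  have iso: "is_iso D (\<epsilon> Z)" "\<epsilon> Z \<in> homs D (fob F (fob H Z)) Z"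
    using \<epsilon> Z by (auto simp: nat_iso_def nat_trans_def id_fctr_def comp_fctr_def)
  have "inv_arr D (\<epsilon> Z) \<in> homs D Z (fob F (fob H Z))"
    using iso by (auto simp: homs_iff)
  then show ?thesis
    using functor_Obj[OF H Z] inv_arr_is_iso[OF iso(1)] by blast
qed


section \<open>Linear categories\<close>

context linear_category
begin

lemma zero_Arr [simp]:
  assumes "X \<in> Obj C" "Y \<in> Obj C"
  shows "zero_arr C X Y \<in> Arr C" "Dom C (zero_arr C X Y) = X" "Cod C (zero_arr C X Y) = Y"
  using zero_hom[OF assms] by (auto simp: homs_iff)

lemma add_cancel:
  assumes "f \<in> homs C X Y" "g \<in> homs C X Y" "h \<in> homs C X Y" "add_arr C f h = add_arr C g h"
  shows "f = g"
proof -
  obtain k where k: "k \<in> homs C X Y" "add_arr C h k = zero_arr C X Y"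
    using add_inverse assms(3) by blast
  have "f = add_arr C (add_arr C f h) k"
    using assms(1-3) k by (simp add: add_assoc[of _ X Y] add_zero)
  also have "\<dots> = add_arr C (add_arr C g h) k"
    using assms(4) by simp
  also have "\<dots> = g"
    using assms(1-3) k by (simp add: add_assoc[of _ X Y] add_zero)
  finally show ?thesis .
qed

lemma add_self_zero:
  assumes "f \<in> homs C X Y" "add_arr C f f = f"
  shows "f = zero_arr C X Y"
proof (rule add_cancel)
  have XY: "X \<in> Obj C" "Y \<in> Obj C" using assms homs_Obj by blast+
  show "zero_arr C X Y \<in> homs C X Y" using XY by (rule zero_hom)
  show "add_arr C f f = add_arr C (zero_arr C X Y) f"
    using assms XY by (simp add: add_commute[of "zero_arr C X Y" X Y] zero_hom add_zero)
qed (use assms in auto)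

lemma scale_zero: "f \<in> homs C X Y \<Longrightarrow> scale_arr C 0 f = zero_arr C X Y"
  using scale_add_scalar[of f X Y 0 0] by (intro add_self_zero) (auto simp: scale_hom)

lemma Comp_zero_right:
  assumes "g \<in> homs C Y Z" "X \<in> Obj C"
  shows "g \<cdot> zero_arr C X Y = zero_arr C X Z"
proof (rule add_self_zero)
  have z: "zero_arr C X Y \<in> homs C X Y"
    using assms homs_Obj by (blast intro: zero_hom)
  show "g \<cdot> zero_arr C X Y \<in> homs C X Z"
    using z assms by (blast intro: Comp_hom)
  show "add_arr C (g \<cdot> zero_arr C X Y) (g \<cdot> zero_arr C X Y) = g \<cdot> zero_arr C X Y"
    using z assms by (simp add: Comp_add_right[OF z z, symmetric] add_zero)
qed

lemma Comp_zero_left: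
  assumes "f \<in> homs C X Y" "Z \<in> Obj C"
  shows "zero_arr C Y Z \<cdot> f = zero_arr C X Z"
proof (rule add_self_zero)
  have z: "zero_arr C Y Z \<in> homs C Y Z"
    using assms homs_Obj by (blast intro: zero_hom)
  show "zero_arr C Y Z \<cdot> f \<in> homs C X Z"
    using z assms by (blast intro: Comp_hom)
  show "add_arr C (zero_arr C Y Z \<cdot> f) (zero_arr C Y Z \<cdot> f) = zero_arr C Y Z \<cdot> f"
    using z assms by (simp add: Comp_add_left[OF assms(1) z z, symmetric] add_zero)
qed

definition diff_arr :: "'m \<Rightarrow> 'm \<Rightarrow> 'm" where
  "diff_arr f g = add_arr C f (scale_arr C (- 1) g)"

lemma diff_hom: "f \<in> homs C X Y \<Longrightarrow> g \<in> homs C X Y \<Longrightarrow> diff_arr f g \<in> homs C X Y"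
  by (simp add: diff_arr_def add_hom scale_hom)

lemma add_scale_minus:
  assumes "g \<in> homs C X Y"
  shows "add_arr C g (scale_arr C (- 1) g) = zero_arr C X Y"
proof -
  have "add_arr C (scale_arr C 1 g) (scale_arr C (- 1) g) = zero_arr C X Y"
    using scale_add_scalar[OF assms, of 1 "- 1"] scale_zero[OF assms] by simp
  then show ?thesis using scale_one[OF assms] by simp
qed

lemma diff_eq_zero_iff:
  assumes f: "f \<in> homs C X Y" and g: "g \<in> homs C X Y"
  shows "diff_arr f g = zero_arr C X Y \<longleftrightarrow> f = g"
proof
  assume "diff_arr f g = zero_arr C X Y"
  then have "add_arr C f (scale_arr C (- 1) g) = add_arr C g (scale_arr C (- 1) g)"
    by (simp add: diff_arr_def add_scale_minus[OF g])
  then show "f = g" using add_cancel f g scale_hom by blast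
qed (simp add: diff_arr_def add_scale_minus[OF g])

lemma Comp_diff_right:
  assumes "f \<in> homs C X Y" "f' \<in> homs C X Y" "g \<in> homs C Y Z"
  shows "g \<cdot> diff_arr f f' = diff_arr (g \<cdot> f) (g \<cdot> f')"
  using assms by (simp add: diff_arr_def Comp_add_right[of _ X Y _ _ Z] scale_hom Comp_scale_right[of _ X Y _ Z])

text \<open>The common composite kills \<open>g\<close>, so its factorisation through the cokernel
  is unique.\<close>

lemma epi_eqI:
  assumes "is_cokernel C q g" "h \<in> homs C (Cod C q) Z" "k \<in> homs C (Cod C q) Z" "h \<cdot> q = k \<cdot> q"
  shows "h = k"
proof -
  have q: "q \<in> Arr C" "g \<in> Arr C" "Dom C q = Cod C g" "q \<cdot> g = zero_arr C (Dom C g) (Cod C q)"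
    using assms(1) by (auto simp: is_cokernel_def)
  have "(h \<cdot> q) \<cdot> g = h \<cdot> q \<cdot> g" using q assms(2) by (auto simp: homs_iff)
  also have "\<dots> = zero_arr C (Dom C g) Z"
    using q assms(2) by (simp add: Comp_zero_right)
  finally have "(h \<cdot> q) \<cdot> g = zero_arr C (Dom C g) Z" .
  moreover have "h \<cdot> q \<in> homs C (Cod C g) Z" using q assms(2) by (auto simp: homs_iff)
  ultimately have "\<exists>!m. m \<in> homs C (Cod C q) Z \<and> m \<cdot> q = h \<cdot> q"
    using assms(1) by (auto simp: is_cokernel_def)
  then show ?thesis using assms(2-4) by metis
qed

end

section \<open>Finite generators and their transport along linear equivalences\<close>

text \<open>Hom-sets are plain sets with partial operations, so linear combinations are encoded as a
  closure. A property that is linear in the arrow then passes from \<open>A\<close> to its span by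
  induction.\<close>

inductive_set arr_span :: "('o, 'm, 'k :: field, 'z) lincat_scheme \<Rightarrow> 'o \<Rightarrow> 'o \<Rightarrow> 'm set \<Rightarrow> 'm set"
  for C X Y A where
    base: "f \<in> A \<Longrightarrow> f \<in> arr_span C X Y A"
  | zero: "zero_arr C X Y \<in> arr_span C X Y A"
  | add: "f \<in> arr_span C X Y A \<Longrightarrow> g \<in> arr_span C X Y A \<Longrightarrow> add_arr C f g \<in> arr_span C X Y A"
  | scale: "f \<in> arr_span C X Y A \<Longrightarrow> scale_arr C c f \<in> arr_span C X Y A"

lemma (in linear_category) arr_span_homs:
  assumes "A \<subseteq> homs C X Y" "X \<in> Obj C" "Y \<in> Obj C" "f \<in> arr_span C X Y A"
  shows "f \<in> homs C X Y"
  using assms(4) by induction (use assms in \<open>auto simp: zero_hom add_hom scale_hom\<close>)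

text \<open>The last conjunct says that \<open>Hom(G, -)\<close> is faithful. It makes an arrow
  through which all arrows from \<open>G\<close> factor an epimorphism.\<close>

definition finite_generator :: "('o, 'm, 'k :: field, 'z) lincat_scheme \<Rightarrow> 'o \<Rightarrow> bool" where
  "finite_generator C G \<longleftrightarrow> G \<in> Obj C \<and>
     (\<forall>X \<in> Obj C. \<exists>A. finite A \<and> A \<subseteq> homs C G X \<and> homs C G X \<subseteq> arr_span C G X A) \<and>
     (\<forall>X Y. \<forall>f \<in> homs C X Y. \<forall>g \<in> homs C X Y. (\<forall>a \<in> homs C G X. f \<cdot>\<^bsub>C\<^esub> a = g \<cdot>\<^bsub>C\<^esub> a) \<longrightarrow> f = g)"

lemma linear_functor_add:
  assumes "linear_functor C D F" "f \<in> homs C X Y" "g \<in> homs C X Y"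
  shows "far F (add_arr C f g) = add_arr D (far F f) (far F g)"
  using assms unfolding linear_functor_def by blast

lemma linear_functor_scale:
  assumes "linear_functor C D F" "f \<in> homs C X Y"
  shows "far F (scale_arr C c f) = scale_arr D c (far F f)"
  using assms unfolding linear_functor_def by blast

text \<open>With an isomorphism \<open>e\<close> from \<open>G'\<close> to \<open>F G\<close>, the
  map sending \<open>f\<close> to \<open>F f \<cdot> e\<close> is a linear bijection from
  \<open>Hom(G, X)\<close> to \<open>Hom(G', F X)\<close> compatible with composition in
  \<open>X\<close>. Both defining conditions travel along it.\<close>

lemma finite_generator_reflect:
  assumes C: "linear_category C" and D: "linear_category D" and F: "linear_functor C D F"
    and eqv: "is_equivalence C D F" and G': "finite_generator D G'"
  shows "\<exists>G. finite_generator C G"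
proof -
  interpret C: linear_category C by fact
  interpret D: linear_category D by fact
  have FF: "is_functor C D F" using F by (simp add: linear_functor_def)
  have "G' \<in> Obj D" using G' by (simp add: finite_generator_def)
  then obtain G e where G: "G \<in> Obj C" and e: "e \<in> homs D G' (fob F G)" and iso: "is_iso D e"
    using equivalence_essentially_surjective[OF D.category_axioms eqv] by blast
  have e': "e \<in> Arr D" "Dom D e = G'" "Cod D e = fob F G" using e by (auto simp: D.homs_iff)
  have hom: "far F f \<cdot>\<^bsub>D\<^esub> e \<in> homs D G' (fob F X)" if "f \<in> homs C G X" for f X
    using functor_hom[OF FF that] e by (blast intro: D.Comp_hom)
  have inj: "f = g" if "f \<in> homs C G X" "g \<in> homs C G X" "far F f \<cdot>\<^bsub>D\<^esub> e = far F g \<cdot>\<^bsub>D\<^esub> e" for f g X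
  proof (rule equivalence_faithful[OF C.category_axioms eqv that(1,2)])
    show "far F f = far F g"
      using D.iso_cancel_right[OF iso, of _ "fob F X"] functor_hom[OF FF that(1)] functor_hom[OF FF that(2)]
        that(3) e' by auto
  qed
  have surj: "\<exists>f \<in> homs C G X. far F f \<cdot>\<^bsub>D\<^esub> e = b" if X: "X \<in> Obj C" and b: "b \<in> homs D G' (fob F X)" for b X
  proof -
    have "b \<cdot>\<^bsub>D\<^esub> inv_arr D e \<in> homs D (fob F G) (fob F X)"
      using b e' iso by (auto simp: D.homs_iff)
    then obtain f where f: "f \<in> homs C G X" "far F f = b \<cdot>\<^bsub>D\<^esub> inv_arr D e"
      using equivalence_full[OF C.category_axioms D.category_axioms eqv G X] by blast
    have "far F f \<cdot>\<^bsub>D\<^esub> e = b" using b e' iso f(2) by (auto simp: D.homs_iff)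
    with f show ?thesis by blast
  qed
  show ?thesis
  proof (intro exI[of _ G], unfold finite_generator_def, intro conjI ballI allI impI)
    fix X assume X: "X \<in> Obj C"
    have FX: "fob F X \<in> Obj D" using functor_Obj[OF FF X] .
    obtain B where B: "finite B" "B \<subseteq> homs D G' (fob F X)"
      "homs D G' (fob F X) \<subseteq> arr_span D G' (fob F X) B"
      using G' FX unfolding finite_generator_def by blast
    have "\<forall>b \<in> B. \<exists>f. f \<in> homs C G X \<and> far F f \<cdot>\<^bsub>D\<^esub> e = b"
      using surj[OF X] B(2) by blast
    then obtain s where s: "\<And>b. b \<in> B \<Longrightarrow> s b \<in> homs C G X \<and> far F (s b) \<cdot>\<^bsub>D\<^esub> e = b"
      by metis
    have sub: "s ` B \<subseteq> homs C G X" using s by blast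
    \<comment> \<open>A linear combination of arrows of \<open>B\<close> lifts to the same
      combination of their chosen preimages.\<close>
    have *: "\<exists>f \<in> arr_span C G X (s ` B). far F f \<cdot>\<^bsub>D\<^esub> e = b" if "b \<in> arr_span D G' (fob F X) B" for b
      using that
    proof induction
      case (base b)
      then show ?case using s by (intro bexI[of _ "s b"] arr_span.base) simp_all
    next
      case zero
      have z: "zero_arr C G X \<in> homs C G X" using C.zero_hom[OF G X] .
      \<comment> \<open>Linearity of a functor mentions sums and scalar multiples only; zero arrows
        are preserved because they are the multiples by 0.\<close>
      have "far F (zero_arr C G X) = zero_arr D (fob F G) (fob F X)"
        using linear_functor_scale[OF F z, of 0] C.scale_zero[OF z] D.scale_zero[OF functor_hom[OF FF z]]
        by simp
      then show ?case
        using D.Comp_zero_left[OF e FX] by (intro bexI[of _ "zero_arr C G X"] arr_span.zero) simp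
    next
      case (add b b')
      then obtain f f' where f: "f \<in> arr_span C G X (s ` B)" "far F f \<cdot>\<^bsub>D\<^esub> e = b"
        and f': "f' \<in> arr_span C G X (s ` B)" "far F f' \<cdot>\<^bsub>D\<^esub> e = b'" by blast
      have ff: "f \<in> homs C G X" "f' \<in> homs C G X"
        using C.arr_span_homs[OF sub G X] f f' by blast+
      have "far F (add_arr C f f') \<cdot>\<^bsub>D\<^esub> e = add_arr D b b'"
        using linear_functor_add[OF F ff] D.Comp_add_left[OF e functor_hom[OF FF ff(1)] functor_hom[OF FF ff(2)]]
          f(2) f'(2) by simp
      then show ?case using f(1) f'(1) by (intro bexI[of _ "add_arr C f f'"] arr_span.add)
    next
      case (scale b c)
      then obtain f where f: "f \<in> arr_span C G X (s ` B)" "far F f \<cdot>\<^bsub>D\<^esub> e = b" by blast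
      have ff: "f \<in> homs C G X"
        using C.arr_span_homs[OF sub G X] f by blast
      have "far F (scale_arr C c f) \<cdot>\<^bsub>D\<^esub> e = scale_arr D c b"
        using linear_functor_scale[OF F ff] D.Comp_scale_left[OF e functor_hom[OF FF ff]] f(2) by simp
      then show ?case using f(1) by (intro bexI[of _ "scale_arr C c f"] arr_span.scale)
    qed
    have "homs C G X \<subseteq> arr_span C G X (s ` B)"
    proof
      fix g assume g: "g \<in> homs C G X"
      then obtain f where f: "f \<in> arr_span C G X (s ` B)" "far F f \<cdot>\<^bsub>D\<^esub> e = far F g \<cdot>\<^bsub>D\<^esub> e"
        using * hom B(3) by blast
      then have "f = g" using inj C.arr_span_homs[OF sub G X] g by blast
      with f show "g \<in> arr_span C G X (s ` B)" by simp
    qed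
    then show "\<exists>A. finite A \<and> A \<subseteq> homs C G X \<and> homs C G X \<subseteq> arr_span C G X A"
      using sub B(1) by blast
  next
    fix X Y f g
    assume f: "f \<in> homs C X Y" and g: "g \<in> homs C X Y"
      and eq: "\<forall>a \<in> homs C G X. f \<cdot>\<^bsub>C\<^esub> a = g \<cdot>\<^bsub>C\<^esub> a"
    have X: "X \<in> Obj C" using f C.homs_Obj by blast
    have "far F f \<cdot>\<^bsub>D\<^esub> b = far F g \<cdot>\<^bsub>D\<^esub> b" if b: "b \<in> homs D G' (fob F X)" for b
    proof -
      obtain a where a: "a \<in> homs C G X" "far F a \<cdot>\<^bsub>D\<^esub> e = b" using surj[OF X b] by blast
      have *: "far F h \<cdot>\<^bsub>D\<^esub> b = far F (h \<cdot>\<^bsub>C\<^esub> a) \<cdot>\<^bsub>D\<^esub> e" if "h \<in> homs C X Y" for h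
      proof -
        have "far F (h \<cdot>\<^bsub>C\<^esub> a) = far F h \<cdot>\<^bsub>D\<^esub> far F a"
          using a that by (intro functor_Comp[OF FF]) (auto simp: C.homs_iff)
        then show ?thesis
          using D.Comp_assoc[OF e functor_hom[OF FF a(1)] functor_hom[OF FF that]] a(2) by simp
      qed
      show ?thesis using *[OF f] *[OF g] eq a(1) by simp
    qed
    then have "far F f = far F g"
      using G' functor_hom[OF FF f] functor_hom[OF FF g] unfolding finite_generator_def by blast
    then show "f = g" using equivalence_faithful[OF C.category_axioms eqv f g] by blast
  qed (rule G)
qed


section \<open>The regular module as a generator\<close>

text \<open>Truncate \<open>v\<close> to its first \<open>k\<close> coordinates: raising
  \<open>k\<close> by one adds a multiple of one unit vector.\<close>

lemma carrier_vec_span_induct [consumes 1, case_names zero unit add smult]: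
  fixes v :: "'k :: field vec"
  assumes v: "v \<in> carrier_vec n"
    and zero: "P (0\<^sub>v n)"
    and unit: "\<And>i. i < n \<Longrightarrow> P (unit_vec n i)"
    and add: "\<And>v w. v \<in> carrier_vec n \<Longrightarrow> w \<in> carrier_vec n \<Longrightarrow> P v \<Longrightarrow> P w \<Longrightarrow> P (v + w)"
    and smult: "\<And>c v. v \<in> carrier_vec n \<Longrightarrow> P v \<Longrightarrow> P (c \<cdot>\<^sub>v v)"
  shows "P v"
proof -
  have "P (vec n (\<lambda>i. if i < k then v $ i else 0))" if "k \<le> n" for k
    using that
  proof (induction k)
    case 0
    have "vec n (\<lambda>i. if i < 0 then v $ i else 0) = 0\<^sub>v n" by auto
    then show ?case using zero by simp
  next
    case (Suc k)
    have "vec n (\<lambda>i. if i < Suc k then v $ i else 0) =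
        vec n (\<lambda>i. if i < k then v $ i else 0) + v $ k \<cdot>\<^sub>v unit_vec n k"
      using Suc.prems by (auto simp: less_Suc_eq)
    moreover have "P (v $ k \<cdot>\<^sub>v unit_vec n k)"
      using Suc.prems by (intro smult unit) auto
    ultimately show ?case using Suc by (auto intro!: add)
  qed
  from this[of n] have "P (vec n (\<lambda>i. if i < n then v $ i else 0))" by simp
  moreover have "vec n (\<lambda>i. if i < n then v $ i else 0) = v" using v by auto
  ultimately show ?thesis by simp
qed

lemma mat_eq_mult_vecI:
  fixes T :: "'k :: field mat"
  assumes "T \<in> carrier_mat m n" "T' \<in> carrier_mat m n"
    and "\<And>v. v \<in> carrier_vec n \<Longrightarrow> T *\<^sub>v v = T' *\<^sub>v v"
  shows "T = T'"
proof (rule eq_matI)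
  fix i j
  assume "i < dim_row T'" "j < dim_col T'"
  then have ij: "i < m" "j < n" using assms by auto
  have "(T *\<^sub>v unit_vec n j) $ i = (T' *\<^sub>v unit_vec n j) $ i"
    using assms(3) by simp
  then show "T $$ (i, j) = T' $$ (i, j)"
    using assms(1,2) ij by simp
qed (use assms in auto)

section \<open>The linear category of finite-dimensional modules\<close>

lemma mat_cat_simps [simp]:
  "Obj (mod_cat A) = {M. right_module A M}"
  "Dom (mod_cat A) (M, T, N) = M"
  "Cod (mod_cat A) (M, T, N) = N"
  "Idn (mod_cat A) M = (M, 1\<^sub>m (mdim M), M)"
  "(M', S, N') \<cdot>\<^bsub>mod_cat A\<^esub> (M, T, N) = (M, S * T, N')"
  "zero_arr (mod_cat A) M N = (M, 0\<^sub>m (mdim N) (mdim M), N)"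
  "add_arr (mod_cat A) (M, S, N) (M', T, N') = (M, S + T, N)"
  "scale_arr (mod_cat A) c (M, T, N) = (M, c \<cdot>\<^sub>m T, N)"
  by (simp_all add: mod_cat_def)

lemma homs_mod_cat:
  "f \<in> homs (mod_cat A) M N \<longleftrightarrow>
     (\<exists>T. f = (M, T, N) \<and> right_module A M \<and> right_module A N \<and> rmod_hom A M N T)"
  by (auto simp: homs_def mod_cat_def)

lemma Arr_mod_cat:
  "f \<in> Arr (mod_cat A) \<longleftrightarrow>
     (\<exists>M T N. f = (M, T, N) \<and> right_module A M \<and> right_module A N \<and> rmod_hom A M N T)"
  by (auto simp: mod_cat_def)

lemma rmod_hom_carrier: "rmod_hom A M N T \<Longrightarrow> T \<in> carrier_mat (mdim N) (mdim M)"
  by (simp add: rmod_hom_def)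

lemma mact_carrier [simp]:
  "right_module A M \<Longrightarrow> v \<in> carrier_vec (mdim M) \<Longrightarrow> a \<in> carrier_vec (adim A) \<Longrightarrow>
    mact M v a \<in> carrier_vec (mdim M)"
  by (simp add: right_module_def bilinear_map_def)

lemma mact_linear:
  assumes "right_module A M" "v \<in> carrier_vec (mdim M)" "a \<in> carrier_vec (adim A)"
  shows "w \<in> carrier_vec (mdim M) \<Longrightarrow> mact M (v + w) a = mact M v a + mact M w a"
    and "b \<in> carrier_vec (adim A) \<Longrightarrow> mact M v (a + b) = mact M v a + mact M v b"
    and "mact M (c \<cdot>\<^sub>v v) a = c \<cdot>\<^sub>v mact M v a"
    and "mact M v (c \<cdot>\<^sub>v a) = c \<cdot>\<^sub>v mact M v a"
  using assms unfolding right_module_def bilinear_map_def by blast+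

lemma smult_zero_vec: "v \<in> carrier_vec n \<Longrightarrow> (0 :: 'k :: field) \<cdot>\<^sub>v v = 0\<^sub>v n"
  by auto

lemma mact_zero_left:
  assumes "right_module A M" "a \<in> carrier_vec (adim A)"
  shows "mact M (0\<^sub>v (mdim M)) a = 0\<^sub>v (mdim M)"
  using mact_linear(3)[OF assms(1) zero_carrier_vec assms(2), of 0] assms
  by (simp add: smult_zero_vec[of _ "mdim M"])

lemma mact_zero_right:
  assumes "right_module A M" "v \<in> carrier_vec (mdim M)"
  shows "mact M v (0\<^sub>v (adim A)) = 0\<^sub>v (mdim M)"
  using mact_linear(4)[OF assms zero_carrier_vec, of 0] assms
  by (simp add: smult_zero_vec[of _ "mdim M"] smult_zero_vec[of _ "adim A"])

lemma smult_mat_mult_vec: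
  fixes T :: "'k :: field mat"
  assumes "T \<in> carrier_mat m n" "v \<in> carrier_vec n"
  shows "(c \<cdot>\<^sub>m T) *\<^sub>v v = c \<cdot>\<^sub>v (T *\<^sub>v v)"
  using assms by (auto simp: scalar_prod_def sum_distrib_left ac_simps)

lemma rmod_hom_zero:
  fixes A :: "'k :: field fdalg"
  assumes "right_module A M" "right_module A N"
  shows "rmod_hom A M N (0\<^sub>m (mdim N) (mdim M))"
proof -
  have "0\<^sub>m (mdim N) (mdim M) *\<^sub>v v = 0\<^sub>v (mdim N)" if "v \<in> carrier_vec (mdim M)" for v :: "'k vec"
    using that by auto
  then show ?thesis using assms by (auto simp: rmod_hom_def mact_zero_left)
qed

lemma rmod_hom_add:
  assumes "right_module A M" "right_module A N" "rmod_hom A M N S" "rmod_hom A M N T"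
  shows "rmod_hom A M N (S + T)"
  using assms
  by (auto simp: rmod_hom_def add_mult_distrib_mat_vec[of _ "mdim N" "mdim M"] mact_linear
      mult_mat_vec_carrier[of _ "mdim N" "mdim M"])

lemma rmod_hom_scale:
  assumes "right_module A M" "right_module A N" "rmod_hom A M N S"
  shows "rmod_hom A M N (c \<cdot>\<^sub>m S)"
  using assms
  by (auto simp: rmod_hom_def smult_mat_mult_vec[of _ "mdim N" "mdim M"] mact_linear
      mult_mat_vec_carrier[of _ "mdim N" "mdim M"])

lemma rmod_hom_mult:
  assumes "right_module A L" "rmod_hom A L M T" "rmod_hom A M N S"
  shows "rmod_hom A L N (S * T)"
  using assms
  by (auto simp: rmod_hom_def assoc_mult_mat_vec[of S "mdim N" "mdim M" T "mdim L"]
      mult_mat_vec_carrier[of T "mdim M" "mdim L"])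

lemma category_mod_cat: "category (mod_cat A)"
proof
  fix f M N assume "f \<in> homs (mod_cat A) M N"
  then show "f \<cdot>\<^bsub>mod_cat A\<^esub> Idn (mod_cat A) M = f" "Idn (mod_cat A) N \<cdot>\<^bsub>mod_cat A\<^esub> f = f"
    by (auto simp: homs_mod_cat dest!: rmod_hom_carrier)
next
  fix f g h K L M N
  assume "f \<in> homs (mod_cat A) K L" "g \<in> homs (mod_cat A) L M" "h \<in> homs (mod_cat A) M N"
  then show "(h \<cdot>\<^bsub>mod_cat A\<^esub> g) \<cdot>\<^bsub>mod_cat A\<^esub> f = h \<cdot>\<^bsub>mod_cat A\<^esub> (g \<cdot>\<^bsub>mod_cat A\<^esub> f)"
    by (auto simp: homs_mod_cat dest!: rmod_hom_carrier intro!: assoc_mult_mat)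
qed (auto simp: Arr_mod_cat homs_mod_cat rmod_hom_mult, auto simp: rmod_hom_def)

lemma linear_category_mod_cat: "linear_category (mod_cat (A :: 'k :: field fdalg))"
proof -
  interpret category "mod_cat A" by (rule category_mod_cat)
  have inv: "\<exists>g\<in>homs (mod_cat A) M N. add_arr (mod_cat A) f g = zero_arr (mod_cat A) M N"
    if f: "f \<in> homs (mod_cat A) M N" for f M N
  proof -
    obtain T where T: "f = (M, T, N)" "right_module A M" "right_module A N" "rmod_hom A M N T"
      using f by (auto simp: homs_mod_cat)
    have "T + - 1 \<cdot>\<^sub>m T = 0\<^sub>m (mdim N) (mdim M)" using rmod_hom_carrier[OF T(4)] by auto
    then show ?thesis using T
      by (intro bexI[of _ "(M, - 1 \<cdot>\<^sub>m T, N)"]) (auto simp: homs_mod_cat rmod_hom_scale)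
  qed
  show ?thesis
  proof
    fix f M N assume "f \<in> homs (mod_cat A) M N"
    then show "\<exists>g\<in>homs (mod_cat A) M N. add_arr (mod_cat A) f g = zero_arr (mod_cat A) M N"
      by (rule inv)
  next
    fix f M N and c :: 'k assume "f \<in> homs (mod_cat A) M N"
    then show "scale_arr (mod_cat A) c f \<in> homs (mod_cat A) M N"
      by (auto simp: homs_mod_cat rmod_hom_scale)
  next
    fix f g M N
    assume "f \<in> homs (mod_cat A) M N" "g \<in> homs (mod_cat A) M N"
    then show "add_arr (mod_cat A) f g \<in> homs (mod_cat A) M N"
      by (auto simp: homs_mod_cat rmod_hom_add)
  next
    fix f g M N
    assume "f \<in> homs (mod_cat A) M N" "g \<in> homs (mod_cat A) M N"
    then show "add_arr (mod_cat A) f g = add_arr (mod_cat A) g f"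
      by (auto simp: homs_mod_cat dest!: rmod_hom_carrier intro!: comm_add_mat)
  next
    fix f f' g L M N
    assume "f \<in> homs (mod_cat A) L M" "f' \<in> homs (mod_cat A) L M" "g \<in> homs (mod_cat A) M N"
    then show "g \<cdot>\<^bsub>mod_cat A\<^esub> add_arr (mod_cat A) f f' =
        add_arr (mod_cat A) (g \<cdot>\<^bsub>mod_cat A\<^esub> f) (g \<cdot>\<^bsub>mod_cat A\<^esub> f')"
      by (auto simp: homs_mod_cat dest!: rmod_hom_carrier intro!: mult_add_distrib_mat)
  next
    fix f g g' L M N
    assume "f \<in> homs (mod_cat A) L M" "g \<in> homs (mod_cat A) M N" "g' \<in> homs (mod_cat A) M N"
    then show "add_arr (mod_cat A) g g' \<cdot>\<^bsub>mod_cat A\<^esub> f =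
        add_arr (mod_cat A) (g \<cdot>\<^bsub>mod_cat A\<^esub> f) (g' \<cdot>\<^bsub>mod_cat A\<^esub> f)"
      by (auto simp: homs_mod_cat dest!: rmod_hom_carrier intro!: add_mult_distrib_mat)
  next
    fix f g L M N and c :: 'k
    assume "f \<in> homs (mod_cat A) L M" "g \<in> homs (mod_cat A) M N"
    then show "g \<cdot>\<^bsub>mod_cat A\<^esub> scale_arr (mod_cat A) c f = scale_arr (mod_cat A) c (g \<cdot>\<^bsub>mod_cat A\<^esub> f)"
      "scale_arr (mod_cat A) c g \<cdot>\<^bsub>mod_cat A\<^esub> f = scale_arr (mod_cat A) c (g \<cdot>\<^bsub>mod_cat A\<^esub> f)"
      by (auto simp: homs_mod_cat dest!: rmod_hom_carrier intro!: mult_smult_distrib mult_smult_assoc_mat)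
  qed (auto simp: homs_mod_cat rmod_hom_zero dest!: rmod_hom_carrier
      intro!: eq_matI simp: algebra_simps)
qed

section \<open>Maps out of the regular module\<close>

definition regular_module :: "'k fdalg \<Rightarrow> 'k rmod" where
  "regular_module A = \<lparr>mdim = adim A, mact = amul A\<rparr>"

lemma regular_module_simps [simp]:
  "mdim (regular_module A) = adim A" "mact (regular_module A) = amul A"
  by (simp_all add: regular_module_def)

lemma right_module_regular: "fd_algebra A \<Longrightarrow> right_module A (regular_module A)"
  by (simp add: fd_algebra_def right_module_def)

text \<open>The matrix of the module map \<open>a \<mapsto> v a\<close> from the regular module to \<open>M\<close>.\<close>

definition orbit_mat :: "'k :: field fdalg \<Rightarrow> 'k rmod \<Rightarrow> 'k vec \<Rightarrow> 'k mat" where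
  "orbit_mat A M v = mat (mdim M) (adim A) (\<lambda>(i, j). mact M v (unit_vec (adim A) j) $ i)"

lemma orbit_mat_carrier [simp]: "orbit_mat A M v \<in> carrier_mat (mdim M) (adim A)"
  by (simp add: orbit_mat_def)

text \<open>Both sides are linear in \<open>a\<close>, and they agree on unit vectors because these
  pick out the columns.\<close>

lemma orbit_mat_mult_vec:
  fixes A :: "'k :: field fdalg"
  assumes M: "right_module A M" and v: "v \<in> carrier_vec (mdim M)" and a: "a \<in> carrier_vec (adim A)"
  shows "orbit_mat A M v *\<^sub>v a = mact M v a"
  using a
proof (induction rule: carrier_vec_span_induct)
  case zero
  have "orbit_mat A M v *\<^sub>v 0\<^sub>v (adim A) = 0\<^sub>v (mdim M)"
    by (auto simp: orbit_mat_def)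
  then show ?case using mact_zero_right[OF M v] by simp
next
  case (unit i)
  then show ?case
    using mact_carrier[OF M v, of "unit_vec (adim A) i"] by (auto simp: orbit_mat_def)
next
  case (add a b)
  then show ?case
    using mult_add_distrib_mat_vec[of "orbit_mat A M v" "mdim M" "adim A" a b] mact_linear(2)[OF M v]
    by simp
next
  case (smult c a)
  then show ?case
    using mult_mat_vec[of "orbit_mat A M v" "mdim M" "adim A" a c] mact_linear(4)[OF M v] by simp
qed

text \<open>Compatibility with the action is the associativity law \<open>(v a) b = v (a b)\<close>
  of the module.\<close>

lemma orbit_mat_hom:
  fixes A :: "'k :: field fdalg"
  assumes A: "fd_algebra A" and M: "right_module A M" and v: "v \<in> carrier_vec (mdim M)"
  shows "(regular_module A, orbit_mat A M v, M) \<in> homs (mod_cat A) (regular_module A) M"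
proof -
  have "orbit_mat A M v *\<^sub>v amul A a b = mact M (orbit_mat A M v *\<^sub>v a) b"
    if "a \<in> carrier_vec (adim A)" "b \<in> carrier_vec (adim A)" for a b
  proof -
    have "amul A a b \<in> carrier_vec (adim A)"
      using mact_carrier[OF right_module_regular[OF A]] that by simp
    then show ?thesis
      using that M v by (simp add: orbit_mat_mult_vec right_module_def)
  qed
  then show ?thesis
    using M right_module_regular[OF A] by (simp add: homs_mod_cat rmod_hom_def)
qed

text \<open>A module map out of the algebra is determined by the image of 1, since
  \<open>a = 1 a\<close>.\<close>

lemma rmod_hom_regular_eq:
  fixes A :: "'k :: field fdalg"
  assumes A: "fd_algebra A" and M: "right_module A M" and T: "rmod_hom A (regular_module A) M T"
  shows "T = orbit_mat A M (T *\<^sub>v aone A)"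
proof (rule mat_eq_mult_vecI[of _ "mdim M" "adim A"])
  show T': "T \<in> carrier_mat (mdim M) (adim A)" using rmod_hom_carrier[OF T] by simp
  have one: "aone A \<in> carrier_vec (adim A)" using A by (simp add: fd_algebra_def)
  fix a :: "'k vec" assume a: "a \<in> carrier_vec (adim A)"
  have "T *\<^sub>v a = T *\<^sub>v amul A (aone A) a"
    using A a by (simp add: fd_algebra_def)
  also have "\<dots> = mact M (T *\<^sub>v aone A) a"
    using T a one by (simp add: rmod_hom_def)
  also have "\<dots> = orbit_mat A M (T *\<^sub>v aone A) *\<^sub>v a"
    using orbit_mat_mult_vec[OF M mult_mat_vec_carrier[OF T' one] a] by simp
  finally show "T *\<^sub>v a = orbit_mat A M (T *\<^sub>v aone A) *\<^sub>v a" .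
qed simp

text \<open>The orbit matrix depends linearly on \<open>v\<close>, so the coordinate vectors of
  \<open>M\<close> yield a spanning set.\<close>

lemma orbit_mat_in_span:
  fixes A :: "'k :: field fdalg"
  assumes M: "right_module A M" and v: "v \<in> carrier_vec (mdim M)"
  shows "(regular_module A, orbit_mat A M v, M) \<in> arr_span (mod_cat A) (regular_module A) M
    ((\<lambda>i. (regular_module A, orbit_mat A M (unit_vec (mdim M) i), M)) ` {..<mdim M})"
    (is "_ \<in> ?span")
  using v
proof (induction rule: carrier_vec_span_induct)
  case zero
  have "orbit_mat A M (0\<^sub>v (mdim M)) = 0\<^sub>m (mdim M) (adim A)"
    by (rule eq_matI) (simp_all add: orbit_mat_def mact_zero_left[OF M])
  then show ?case
    using arr_span.zero[of "mod_cat A" "regular_module A" M] by simp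
next
  case (unit i)
  then show ?case by (intro arr_span.base) auto
next
  case (add v w)
  have "orbit_mat A M (v + w) = orbit_mat A M v + orbit_mat A M w"
    using carrier_vecD[OF mact_carrier[OF M add.hyps(2) unit_vec_carrier]]
    by (intro eq_matI) (simp_all add: orbit_mat_def mact_linear(1)[OF M add.hyps(1) unit_vec_carrier add.hyps(2)])
  then show ?case
    using arr_span.add[OF add.IH] by simp
next
  case (smult c v)
  have "orbit_mat A M (c \<cdot>\<^sub>v v) = c \<cdot>\<^sub>m orbit_mat A M v"
    using carrier_vecD[OF mact_carrier[OF M smult.hyps unit_vec_carrier]]
    by (intro eq_matI) (simp_all add: orbit_mat_def mact_linear(3)[OF M smult.hyps unit_vec_carrier])
  then show ?case
    using arr_span.scale[OF smult.IH, of c] by simp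
qed

text \<open>Evaluation at 1 identifies \<open>Hom(A, M)\<close> with \<open>M\<close>. This gives
  finite-dimensionality, and it gives faithfulness because each \<open>v\<close> in \<open>M\<close>
  is a value of some map from \<open>A\<close>.\<close>

lemma regular_module_generator:
  fixes A :: "'k :: field fdalg"
  assumes A: "fd_algebra A"
  shows "finite_generator (mod_cat A) (regular_module A)"
  unfolding finite_generator_def
proof (intro conjI ballI allI impI)
  show "regular_module A \<in> Obj (mod_cat A)" using right_module_regular[OF A] by simp
next
  fix M assume "M \<in> Obj (mod_cat A)"
  then have M: "right_module A M" by simp
  let ?B = "(\<lambda>i. (regular_module A, orbit_mat A M (unit_vec (mdim M) i), M)) ` {..<mdim M}"
  have "homs (mod_cat A) (regular_module A) M \<subseteq> arr_span (mod_cat A) (regular_module A) M ?B"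
  proof
    fix f assume "f \<in> homs (mod_cat A) (regular_module A) M"
    then obtain T where f: "f = (regular_module A, T, M)" and T: "rmod_hom A (regular_module A) M T"
      by (auto simp: homs_mod_cat)
    have "T *\<^sub>v aone A \<in> carrier_vec (mdim M)"
      using A rmod_hom_carrier[OF T] by (intro mult_mat_vec_carrier[of _ _ "adim A"]) (auto simp: fd_algebra_def)
    then show "f \<in> arr_span (mod_cat A) (regular_module A) M ?B"
      using orbit_mat_in_span[OF M] rmod_hom_regular_eq[OF A M T] f by metis
  qed
  moreover have "?B \<subseteq> homs (mod_cat A) (regular_module A) M"
    using orbit_mat_hom[OF A M] by auto
  ultimately show "\<exists>B. finite B \<and> B \<subseteq> homs (mod_cat A) (regular_module A) M \<and>
      homs (mod_cat A) (regular_module A) M \<subseteq> arr_span (mod_cat A) (regular_module A) M B"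
    by (intro exI[of _ ?B]) simp
next
  fix M N f g
  assume f: "f \<in> homs (mod_cat A) M N" and g: "g \<in> homs (mod_cat A) M N"
    and eq: "\<forall>a \<in> homs (mod_cat A) (regular_module A) M. f \<cdot>\<^bsub>mod_cat A\<^esub> a = g \<cdot>\<^bsub>mod_cat A\<^esub> a"
  obtain S where S: "f = (M, S, N)" "rmod_hom A M N S" and M: "right_module A M"
    using f by (auto simp: homs_mod_cat)
  obtain T where T: "g = (M, T, N)" "rmod_hom A M N T"
    using g by (auto simp: homs_mod_cat)
  have one: "aone A \<in> carrier_vec (adim A)" using A by (simp add: fd_algebra_def)
  have "S = T"
  proof (rule mat_eq_mult_vecI[OF rmod_hom_carrier[OF S(2)] rmod_hom_carrier[OF T(2)]])
    fix v :: "'k vec" assume v: "v \<in> carrier_vec (mdim M)"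
    have ST: "S * orbit_mat A M v = T * orbit_mat A M v"
      using bspec[OF eq orbit_mat_hom[OF A M v]] S(1) T(1) by simp
    \<comment> \<open>As \<open>v = v 1\<close>, composing with the orbit map of \<open>v\<close>
      and evaluating at 1 recovers the value at \<open>v\<close>.\<close>
    have *: "R *\<^sub>v v = (R * orbit_mat A M v) *\<^sub>v aone A" if R: "rmod_hom A M N R" for R
    proof -
      have "(R * orbit_mat A M v) *\<^sub>v aone A = R *\<^sub>v mact M v (aone A)"
        using assoc_mult_mat_vec[OF rmod_hom_carrier[OF R] orbit_mat_carrier one]
          orbit_mat_mult_vec[OF M v one] by simp
      then show ?thesis using M v by (simp add: right_module_def)
    qed
    show "S *\<^sub>v v = T *\<^sub>v v" using *[OF S(2)] *[OF T(2)] ST by simp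
  qed
  then show "f = g" using S T by simp
qed

lemma finite_abelian_generator:
  assumes "finite_abelian_category C"
  shows "\<exists>G. finite_generator C G"
proof -
  obtain A \<Phi> where "abelian_category C" and A: "fd_algebra A" and \<Phi>: "linear_functor C (mod_cat A) \<Phi>"
    "is_equivalence C (mod_cat A) \<Phi>"
    using assms by (auto simp: finite_abelian_category_def)
  then have "linear_category C" by (simp add: abelian_category_def)
  then show ?thesis
    using finite_generator_reflect[OF _ linear_category_mod_cat \<Phi> regular_module_generator[OF A]] by blast
qed


section \<open>Coends over a category with a finite generator\<close>

text \<open>Finite sums are built from binary biproducts, the form in which an abelian category
  supplies them, and statements about them are proved by induction on the splitting.\<close>

inductive sum_of :: "('o, 'm, 'k, 'z) lincat_scheme \<Rightarrow> 'o \<Rightarrow> 'o \<Rightarrow> bool" for C G where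
  self: "sum_of C G G"
| biproduct: "sum_of C G P \<Longrightarrow> sum_of C G Q \<Longrightarrow> is_biproduct C P Q R i j p q \<Longrightarrow> sum_of C G R"

lemma (in abelian_category) finite_lift:
  assumes G: "G \<in> Obj C" and X: "X \<in> Obj C" and A: "finite A" "A \<subseteq> homs C G X"
  shows "\<exists>P p. sum_of C G P \<and> p \<in> homs C P X \<and> (\<forall>a \<in> A. \<exists>b \<in> homs C G P. p \<cdot> b = a)"
  using A
proof (induction A)
  case empty
  \<comment> \<open>The empty sum is not a case of \<open>sum_of\<close>; with nothing to lift, the
    zero arrow from \<open>G\<close> itself serves.\<close>
  show ?case
    using zero_hom[OF G X] sum_of.self by (intro exI[of _ G] exI[of _ "zero_arr C G X"]) simp
next
  case (insert a A)
  then obtain P p where P: "sum_of C G P" and p: "p \<in> homs C P X"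
    and lift: "\<And>a. a \<in> A \<Longrightarrow> \<exists>b \<in> homs C G P. p \<cdot> b = a" by blast
  have a: "a \<in> homs C G X" using insert.prems by blast
  have PO: "P \<in> Obj C" using p homs_Obj by blast
  obtain R i j s t where bi: "is_biproduct C P G R i j s t" using has_biproducts[OF PO G] by blast
  have ij: "i \<in> homs C P R" "j \<in> homs C G R" "s \<in> homs C R P" "t \<in> homs C R G"
    "s \<cdot> i = Idn C P" "t \<cdot> j = Idn C G" "s \<cdot> j = zero_arr C G P" "t \<cdot> i = zero_arr C P G"
    using bi by (auto simp: is_biproduct_def)
  \<comment> \<open>The arrow out of the biproduct of \<open>P\<close> and \<open>G\<close> that
    restricts to \<open>p\<close> and to \<open>a\<close>.\<close>
  define r where "r = add_arr C (p \<cdot> s) (a \<cdot> t)"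
  have ps: "p \<cdot> s \<in> homs C R X" "a \<cdot> t \<in> homs C R X"
    using ij p a by (blast intro: Comp_hom)+
  then have r: "r \<in> homs C R X" by (simp add: r_def add_hom)
  have "r \<cdot> i = add_arr C ((p \<cdot> s) \<cdot> i) ((a \<cdot> t) \<cdot> i)"
    unfolding r_def using Comp_add_left[OF ij(1) ps] .
  also have "\<dots> = add_arr C (p \<cdot> s \<cdot> i) (a \<cdot> t \<cdot> i)"
    using ij p a by (simp add: Comp_assoc[OF ij(1) ij(3) p] Comp_assoc[OF ij(1) ij(4) a])
  also have "\<dots> = p"
    using ij p Comp_zero_right[OF a PO] by (simp add: add_zero Comp_Idn)
  finally have ri: "r \<cdot> i = p" .
  have "r \<cdot> j = add_arr C ((p \<cdot> s) \<cdot> j) ((a \<cdot> t) \<cdot> j)"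
    unfolding r_def using Comp_add_left[OF ij(2) ps] .
  also have "\<dots> = add_arr C (p \<cdot> s \<cdot> j) (a \<cdot> t \<cdot> j)"
    using ij p a by (simp add: Comp_assoc[OF ij(2) ij(3) p] Comp_assoc[OF ij(2) ij(4) a])
  also have "\<dots> = add_arr C (zero_arr C G X) a"
    using ij Comp_zero_right[OF p G] Comp_Idn[OF a] by simp
  also have "\<dots> = a"
    using add_commute[OF zero_hom[OF G X] a] add_zero[OF a] by simp
  finally have rj: "r \<cdot> j = a" .
  have "\<exists>b \<in> homs C G R. r \<cdot> b = a'" if "a' \<in> insert a A" for a'
  proof (cases "a' = a")
    case True
    then show ?thesis using rj ij(2) by blast
  next
    case False
    then obtain b where b: "b \<in> homs C G P" "p \<cdot> b = a'" using lift \<open>a' \<in> insert a A\<close> by blast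
    have "r \<cdot> i \<cdot> b = a'" using Comp_assoc[OF b(1) ij(1) r] ri b(2) by simp
    then show ?thesis using Comp_hom[OF b(1) ij(1)] by blast
  qed
  moreover have "sum_of C G R" using P sum_of.self bi by (rule sum_of.biproduct)
  ultimately show ?case using r by blast
qed

text \<open>Arrows that lift through \<open>p\<close> are closed under linear combinations, so it is
  enough to lift a finite spanning set. Faithfulness of \<open>Hom(G, -)\<close> then makes
  \<open>p\<close> an epimorphism, hence a cokernel. The lifting property is kept in the conclusion
  because components of the coend are prescribed on all arrows from \<open>G\<close>.\<close>

lemma (in abelian_category) sum_of_cover:
  assumes G: "finite_generator C G" and X: "X \<in> Obj C"
  obtains P p g where "sum_of C G P" "p \<in> homs C P X"
    "\<forall>a \<in> homs C G X. \<exists>b \<in> homs C G P. p \<cdot> b = a" "is_cokernel C p g"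
proof -
  have GO: "G \<in> Obj C" using G by (simp add: finite_generator_def)
  obtain A where A: "finite A" "A \<subseteq> homs C G X" "homs C G X \<subseteq> arr_span C G X A"
    using G X unfolding finite_generator_def by blast
  obtain P p where P: "sum_of C G P" and p: "p \<in> homs C P X"
    and lift: "\<And>a. a \<in> A \<Longrightarrow> \<exists>b \<in> homs C G P. p \<cdot> b = a"
    using finite_lift[OF GO X A(1,2)] by blast
  have PO: "P \<in> Obj C" using p homs_Obj by blast
  have all: "\<exists>b \<in> homs C G P. p \<cdot> b = a" if "a \<in> homs C G X" for a
  proof -
    have "a \<in> arr_span C G X A" using A(3) that by blast
    then show ?thesis
    proof induction
      case zero
      show ?case using Comp_zero_right[OF p GO] zero_hom[OF GO PO] by blast
    next
      case (add a a')
      then show ?case using Comp_add_right[of _ G P _ p X] p add_hom by metis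
    next
      case (scale a c)
      then show ?case using Comp_scale_right[of _ G P p X] p scale_hom by metis
    qed (rule lift)
  qed
  have "is_epi C p"
    unfolding is_epi_def
  proof (intro conjI allI ballI impI)
    show pA: "p \<in> Arr C" using p by (simp add: homs_iff)
    fix W g h assume "g \<in> homs C (Cod C p) W" "h \<in> homs C (Cod C p) W" and eq: "g \<cdot> p = h \<cdot> p"
    then have gh: "g \<in> homs C X W" "h \<in> homs C X W" using p by (auto simp: homs_iff)
    have "g \<cdot> a = h \<cdot> a" if a: "a \<in> homs C G X" for a
    proof -
      obtain b where b: "b \<in> homs C G P" "p \<cdot> b = a" using all[OF a] by blast
      show ?thesis
        using Comp_assoc[OF b(1) p gh(1)] Comp_assoc[OF b(1) p gh(2)] eq b(2) by simp
    qed
    then show "g = h" using G gh unfolding finite_generator_def by blast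
  qed
  then obtain g where "is_cokernel C p g" using epi_normal by blast
  with P p show ?thesis using all by (intro that) blast+
qed

section \<open>Bilinear integrands that are right exact in the covariant variable\<close>

text \<open>The common features of the two integrands, so that the coend is constructed once for
  both. Linearity is stated with an identity in the other slot, which together with functoriality
  expresses bilinearity.\<close>

locale linear_profunctor =
  C: abelian_category C + D: abelian_category D
  for C :: "('o, 'm, 'k :: field, 'y) lincat_scheme" and D :: "('p, 'n, 'k, 'z) lincat_scheme" +
  fixes S :: "('o \<times> 'o, 'm \<times> 'm, 'p, 'n) fctr"
  assumes S_functor: "is_functor (prod_cat (op_cat C) C) D S"
    and S_add_left: "f \<in> homs C X X' \<Longrightarrow> f' \<in> homs C X X' \<Longrightarrow> Y \<in> Obj C \<Longrightarrow>
      far S (add_arr C f f', Idn C Y) = add_arr D (far S (f, Idn C Y)) (far S (f', Idn C Y))"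
    and S_scale_left: "f \<in> homs C X X' \<Longrightarrow> Y \<in> Obj C \<Longrightarrow>
      far S (scale_arr C c f, Idn C Y) = scale_arr D c (far S (f, Idn C Y))"
    and S_add_right: "f \<in> homs C X X' \<Longrightarrow> f' \<in> homs C X X' \<Longrightarrow> Y \<in> Obj C \<Longrightarrow>
      far S (Idn C Y, add_arr C f f') = add_arr D (far S (Idn C Y, f)) (far S (Idn C Y, f'))"
    and S_scale_right: "f \<in> homs C X X' \<Longrightarrow> Y \<in> Obj C \<Longrightarrow>
      far S (Idn C Y, scale_arr C c f) = scale_arr D c (far S (Idn C Y, f))"
    and S_cokernel: "is_cokernel C q g \<Longrightarrow> Y \<in> Obj C \<Longrightarrow>
      is_cokernel D (far S (Idn C Y, q)) (far S (Idn C Y, g))"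
begin

abbreviation so :: "'o \<Rightarrow> 'o \<Rightarrow> 'p" where "so X Y \<equiv> fob S (X, Y)"
abbreviation sf :: "'m \<Rightarrow> 'm \<Rightarrow> 'n" where "sf f g \<equiv> far S (f, g)"
abbreviation compC (infixr "\<circ>\<^sub>C" 70) where "g \<circ>\<^sub>C f \<equiv> g \<cdot>\<^bsub>C\<^esub> f"
abbreviation compD (infixr "\<circ>\<^sub>D" 70) where "g \<circ>\<^sub>D f \<equiv> g \<cdot>\<^bsub>D\<^esub> f"

lemma so_Obj [simp]: "X \<in> Obj C \<Longrightarrow> Y \<in> Obj C \<Longrightarrow> so X Y \<in> Obj D"
  using functor_Obj[OF S_functor, of "(X, Y)"] by (simp add: prod_cat_def op_cat_def)

lemma sf_Arr [simp]:
  assumes "f \<in> Arr C" "g \<in> Arr C"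
  shows "sf f g \<in> Arr D" "Dom D (sf f g) = so (Cod C f) (Dom C g)"
    "Cod D (sf f g) = so (Dom C f) (Cod C g)"
  using functor_Arr[OF S_functor, of "(f, g)"] assms by (simp_all add: prod_cat_def op_cat_def)

lemma sf_hom: "f \<in> homs C X' X \<Longrightarrow> g \<in> homs C Y Y' \<Longrightarrow> sf f g \<in> homs D (so X Y) (so X' Y')"
  by (simp add: C.homs_iff D.homs_iff)

lemma sf_Idn [simp]: "X \<in> Obj C \<Longrightarrow> Y \<in> Obj C \<Longrightarrow> sf (Idn C X) (Idn C Y) = Idn D (so X Y)"
  using functor_Idn[OF S_functor, of "(X, Y)"] by (simp add: prod_cat_def op_cat_def)

lemma sf_Comp [simp]:
  assumes "f \<in> Arr C" "g \<in> Arr C" "f' \<in> Arr C" "g' \<in> Arr C" "Cod C f' = Dom C f" "Cod C g = Dom C g'"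
  shows "sf f' g' \<circ>\<^sub>D sf f g = sf (f \<circ>\<^sub>C f') (g' \<circ>\<^sub>C g)"
  using functor_Comp[OF S_functor, of "(f, g)" "(f', g')"] assms by (simp add: prod_cat_def op_cat_def)

lemma sf_zero_left:
  assumes "X \<in> Obj C" "X' \<in> Obj C" "Y \<in> Obj C"
  shows "sf (zero_arr C X X') (Idn C Y) = zero_arr D (so X' Y) (so X Y)"
proof -
  have z: "zero_arr C X X' \<in> homs C X X'" using assms by (simp add: C.zero_hom)
  then have "sf (zero_arr C X X') (Idn C Y) \<in> homs D (so X' Y) (so X Y)"
    using assms(3) by (intro sf_hom C.Idn_hom)
  then show ?thesis
    using S_scale_left[OF z assms(3), of 0] C.scale_zero[OF z] D.scale_zero by metis
qed

lemma sf_zero_right: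
  assumes "X \<in> Obj C" "X' \<in> Obj C" "Y \<in> Obj C"
  shows "sf (Idn C Y) (zero_arr C X X') = zero_arr D (so Y X) (so Y X')"
proof -
  have z: "zero_arr C X X' \<in> homs C X X'" using assms by (simp add: C.zero_hom)
  then have "sf (Idn C Y) (zero_arr C X X') \<in> homs D (so Y X) (so Y X')"
    using assms(3) by (intro sf_hom C.Idn_hom)
  then show ?thesis
    using S_scale_right[OF z assms(3), of 0] C.scale_zero[OF z] D.scale_zero by metis
qed

text \<open>The cowedge equation at the single endomorphism \<open>e\<close> of
  \<open>G\<close>.\<close>

definition balances :: "'o \<Rightarrow> 'n \<Rightarrow> 'm \<Rightarrow> bool" where
  "balances G \<kappa> e \<longleftrightarrow> \<kappa> \<circ>\<^sub>D sf e (Idn C G) = \<kappa> \<circ>\<^sub>D sf (Idn C G) e"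

text \<open>Each new endomorphism is imposed by composing with one further cokernel, and the
  universal properties compose: factor first through the old \<open>\<kappa>\<close>, then through
  the cokernel.\<close>

lemma universal_balanced:
  assumes G: "G \<in> Obj C" and A: "finite A" "A \<subseteq> homs C G G"
  shows "\<exists>K \<kappa>. \<kappa> \<in> homs D (so G G) K \<and> (\<forall>e \<in> A. balances G \<kappa> e) \<and>
    (\<forall>K'. \<forall>\<kappa>' \<in> homs D (so G G) K'. (\<forall>e \<in> A. balances G \<kappa>' e) \<longrightarrow>
      (\<exists>!h. h \<in> homs D K K' \<and> h \<circ>\<^sub>D \<kappa> = \<kappa>'))"
  using A
proof (induction A)
  case empty
  show ?case
    using G by (intro exI[of _ "so G G"] exI[of _ "Idn D (so G G)"]) (auto simp: D.homs_iff)
next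
  case (insert a A)
  have "A \<subseteq> homs C G G" using insert.prems by simp
  from insert.IH[OF this] obtain K \<kappa> where \<kappa>1: "\<kappa> \<in> homs D (so G G) K"
    and \<kappa>2: "\<forall>e \<in> A. balances G \<kappa> e"
    and ex: "\<forall>K'. \<forall>\<kappa>' \<in> homs D (so G G) K'. (\<forall>e \<in> A. balances G \<kappa>' e) \<longrightarrow>
      (\<exists>!h. h \<in> homs D K K' \<and> h \<circ>\<^sub>D \<kappa> = \<kappa>')"
    by (elim exE conjE) (rule that)
  have \<kappa>: "\<kappa> \<in> homs D (so G G) K" "\<And>e. e \<in> A \<Longrightarrow> balances G \<kappa> e"
    using \<kappa>1 \<kappa>2 by simp_all
  have univ: "\<exists>!h. h \<in> homs D K K' \<and> h \<circ>\<^sub>D \<kappa> = \<kappa>'"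
    if "\<kappa>' \<in> homs D (so G G) K'" "\<forall>e \<in> A. balances G \<kappa>' e" for K' \<kappa>'
    by (rule ex[rule_format, OF that(1)]) (use that(2) in blast)
  have hom: "sf e (Idn C G) \<in> homs D (so G G) (so G G)" "sf (Idn C G) e \<in> homs D (so G G) (so G G)"
    if "e \<in> insert a A" for e
    using insert.prems that G by (auto intro!: sf_hom C.Idn_hom)
  define u where "u = \<kappa> \<circ>\<^sub>D sf a (Idn C G)"
  define v where "v = \<kappa> \<circ>\<^sub>D sf (Idn C G) a"
  have uv: "u \<in> homs D (so G G) K" "v \<in> homs D (so G G) K"
    unfolding u_def v_def using hom[of a] \<kappa>(1) by (auto intro: D.Comp_hom)
  have d: "D.diff_arr u v \<in> homs D (so G G) K" using uv by (rule D.diff_hom)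
  obtain q where q: "is_cokernel D q (D.diff_arr u v)" using D.has_cokernels d by (auto simp: D.homs_iff)
  define Q where "Q = Cod D q"
  have qh: "q \<in> homs D K Q" and q0: "q \<circ>\<^sub>D D.diff_arr u v = zero_arr D (so G G) Q"
    and quniv: "\<And>W g. g \<in> homs D K W \<Longrightarrow> g \<circ>\<^sub>D D.diff_arr u v = zero_arr D (so G G) W \<Longrightarrow>
      \<exists>!h. h \<in> homs D Q W \<and> h \<circ>\<^sub>D q = g"
    using q d by (auto simp: is_cokernel_def D.homs_iff Q_def)
  have comp: "(g \<circ>\<^sub>D \<kappa>) \<circ>\<^sub>D s = g \<circ>\<^sub>D \<kappa> \<circ>\<^sub>D s" if "g \<in> homs D K W" "s \<in> homs D (so G G) (so G G)" for g s W
    using D.Comp_assoc[OF that(2) \<kappa>(1) that(1)] .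
  \<comment> \<open>Turns the new balance equation into the vanishing condition that the cokernel of
    \<open>u - v\<close> represents.\<close>
  have bal_iff: "balances G (g \<circ>\<^sub>D \<kappa>) a \<longleftrightarrow> g \<circ>\<^sub>D D.diff_arr u v = zero_arr D (so G G) W"
    if g: "g \<in> homs D K W" for g W
  proof -
    have gu: "g \<circ>\<^sub>D u \<in> homs D (so G G) W" "g \<circ>\<^sub>D v \<in> homs D (so G G) W"
      using g uv by (auto intro: D.Comp_hom)
    show ?thesis
      using comp[OF g hom(1), of a] comp[OF g hom(2), of a] D.diff_eq_zero_iff[OF gu]
        D.Comp_diff_right[OF uv g] by (simp add: balances_def u_def v_def)
  qed
  have bal: "balances G (g \<circ>\<^sub>D \<kappa>) e" if "g \<in> homs D K W" "e \<in> A" for g e W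
    using comp[OF that(1) hom(1), of e] comp[OF that(1) hom(2), of e] \<kappa>(2) that(2)
    by (simp add: balances_def)
  show ?case
  proof (intro exI[of _ Q] exI[of _ "q \<circ>\<^sub>D \<kappa>"] conjI ballI allI impI)
    show "q \<circ>\<^sub>D \<kappa> \<in> homs D (so G G) Q" using \<kappa>(1) qh by (rule D.Comp_hom)
  next
    fix e assume "e \<in> insert a A"
    then show "balances G (q \<circ>\<^sub>D \<kappa>) e" using bal_iff[OF qh] q0 bal[OF qh] by blast
  next
    fix K' \<kappa>' assume \<kappa>': "\<kappa>' \<in> homs D (so G G) K'" and b: "\<forall>e \<in> insert a A. balances G \<kappa>' e"
    obtain h where h: "h \<in> homs D K K'" "h \<circ>\<^sub>D \<kappa> = \<kappa>'"
      and h_unique: "\<And>h'. h' \<in> homs D K K' \<Longrightarrow> h' \<circ>\<^sub>D \<kappa> = \<kappa>' \<Longrightarrow> h' = h"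
      using univ[OF \<kappa>'] b by (metis insertCI)
    have "h \<circ>\<^sub>D D.diff_arr u v = zero_arr D (so G G) K'" using bal_iff[OF h(1)] h(2) b by blast
    then obtain m where m: "m \<in> homs D Q K'" "m \<circ>\<^sub>D q = h"
      and m_unique: "\<And>m'. m' \<in> homs D Q K' \<Longrightarrow> m' \<circ>\<^sub>D q = h \<Longrightarrow> m' = m"
      using quniv[OF h(1)] by blast
    show "\<exists>!m. m \<in> homs D Q K' \<and> m \<circ>\<^sub>D q \<circ>\<^sub>D \<kappa> = \<kappa>'"
    proof (intro ex1I[of _ m] conjI)
      show "m \<circ>\<^sub>D q \<circ>\<^sub>D \<kappa> = \<kappa>'" using D.Comp_assoc[OF \<kappa>(1) qh m(1)] m(2) h(2) by simp
    next
      fix m' assume m': "m' \<in> homs D Q K' \<and> m' \<circ>\<^sub>D q \<circ>\<^sub>D \<kappa> = \<kappa>'"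
      then have "m' \<circ>\<^sub>D q = h"
        using h_unique D.Comp_assoc[OF \<kappa>(1) qh] D.Comp_hom[OF qh] by metis
      then show "m' = m" using m_unique m' by blast
    qed (rule m(1))
  qed
qed

section \<open>Arrows from the generator detect arrows out of the integrand\<close>

text \<open>On a biproduct the identity is \<open>i p + j q\<close>, so additivity of
  \<open>S(X, -)\<close> recovers an arrow out of \<open>S(X, R)\<close> from its restrictions along
  \<open>S(X, i)\<close> and \<open>S(X, j)\<close>. These restrictions fall under the induction
  hypotheses.\<close>

lemma jointly_epi_sum_of:
  assumes P: "sum_of C G P" and G: "G \<in> Obj C" and X: "X \<in> Obj C"
    and u: "u \<in> homs D (so X P) K" and v: "v \<in> homs D (so X P) K"
    and eq: "\<And>b. b \<in> homs C G P \<Longrightarrow> u \<circ>\<^sub>D sf (Idn C X) b = v \<circ>\<^sub>D sf (Idn C X) b"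
  shows "u = v"
  using P u v eq
proof (induction arbitrary: u v)
  case self
  have "u \<circ>\<^sub>D sf (Idn C X) (Idn C G) = v \<circ>\<^sub>D sf (Idn C X) (Idn C G)"
    using self.prems(3) C.Idn_hom[OF G] by blast
  then show ?case using self.prems(1,2) G X by (simp add: D.homs_iff)
next
  case (biproduct P Q R i j p q)
  have ij: "i \<in> homs C P R" "j \<in> homs C Q R" "p \<in> homs C R P" "q \<in> homs C R Q"
    "add_arr C (i \<circ>\<^sub>C p) (j \<circ>\<^sub>C q) = Idn C R"
    using biproduct.hyps by (auto simp: is_biproduct_def)
  have R: "R \<in> Obj C" using ij C.homs_Obj by blast
  \<comment> \<open>The induction hypothesis for a summand \<open>T\<close> is itself a premise
    here, so that one argument covers both \<open>P\<close> and \<open>Q\<close>.\<close>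
  have ih: "u \<circ>\<^sub>D sf (Idn C X) k = v \<circ>\<^sub>D sf (Idn C X) k"
    if k: "k \<in> homs C T R" and IH: "\<And>u v. u \<in> homs D (so X T) K \<Longrightarrow> v \<in> homs D (so X T) K \<Longrightarrow>
      (\<And>b. b \<in> homs C G T \<Longrightarrow> u \<circ>\<^sub>D sf (Idn C X) b = v \<circ>\<^sub>D sf (Idn C X) b) \<Longrightarrow> u = v" for k T
  proof (rule IH)
    show "u \<circ>\<^sub>D sf (Idn C X) k \<in> homs D (so X T) K" "v \<circ>\<^sub>D sf (Idn C X) k \<in> homs D (so X T) K"
      using biproduct.prems(1,2) k X by (auto simp: C.homs_iff D.homs_iff)
    fix b assume b: "b \<in> homs C G T"
    then have "u \<circ>\<^sub>D sf (Idn C X) (k \<circ>\<^sub>C b) = v \<circ>\<^sub>D sf (Idn C X) (k \<circ>\<^sub>C b)"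
      using biproduct.prems(3) k C.Comp_hom by blast
    then show "(u \<circ>\<^sub>D sf (Idn C X) k) \<circ>\<^sub>D sf (Idn C X) b = (v \<circ>\<^sub>D sf (Idn C X) k) \<circ>\<^sub>D sf (Idn C X) b"
      using biproduct.prems(1,2) k b X by (simp add: C.homs_iff D.homs_iff)
  qed
  have step: "u \<circ>\<^sub>D sf (Idn C X) (k \<circ>\<^sub>C l) = v \<circ>\<^sub>D sf (Idn C X) (k \<circ>\<^sub>C l)"
    if eq: "u \<circ>\<^sub>D sf (Idn C X) k = v \<circ>\<^sub>D sf (Idn C X) k"
      and kl: "k \<in> homs C T R" "l \<in> homs C R T" for k l T
  proof -
    have "w \<circ>\<^sub>D sf (Idn C X) (k \<circ>\<^sub>C l) = (w \<circ>\<^sub>D sf (Idn C X) k) \<circ>\<^sub>D sf (Idn C X) l"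
      if "w \<in> homs D (so X R) K" for w
      using that kl X by (simp add: C.homs_iff D.homs_iff)
    then show ?thesis using eq biproduct.prems(1,2) by simp
  qed
  have expand: "w = add_arr D (w \<circ>\<^sub>D sf (Idn C X) (i \<circ>\<^sub>C p)) (w \<circ>\<^sub>D sf (Idn C X) (j \<circ>\<^sub>C q))"
    if w: "w \<in> homs D (so X R) K" for w
  proof -
    have ip: "i \<circ>\<^sub>C p \<in> homs C R R" "j \<circ>\<^sub>C q \<in> homs C R R" using ij C.Comp_hom by blast+
    have "w = w \<circ>\<^sub>D sf (Idn C X) (add_arr C (i \<circ>\<^sub>C p) (j \<circ>\<^sub>C q))"
      using ij(5) w X R by (simp add: D.homs_iff)
    also have "\<dots> = w \<circ>\<^sub>D add_arr D (sf (Idn C X) (i \<circ>\<^sub>C p)) (sf (Idn C X) (j \<circ>\<^sub>C q))"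
      using S_add_right[OF ip X] by simp
    also have "\<dots> = add_arr D (w \<circ>\<^sub>D sf (Idn C X) (i \<circ>\<^sub>C p)) (w \<circ>\<^sub>D sf (Idn C X) (j \<circ>\<^sub>C q))"
      using w ip X by (intro D.Comp_add_right) (auto intro!: sf_hom C.Idn_hom)
    finally show ?thesis .
  qed
  have "u = add_arr D (u \<circ>\<^sub>D sf (Idn C X) (i \<circ>\<^sub>C p)) (u \<circ>\<^sub>D sf (Idn C X) (j \<circ>\<^sub>C q))"
    by (rule expand[OF biproduct.prems(1)])
  also have "\<dots> = add_arr D (v \<circ>\<^sub>D sf (Idn C X) (i \<circ>\<^sub>C p)) (v \<circ>\<^sub>D sf (Idn C X) (j \<circ>\<^sub>C q))"
    by (simp only: step[OF ih[OF ij(1) biproduct.IH(1)] ij(1,3)] step[OF ih[OF ij(2) biproduct.IH(2)] ij(2,4)])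
  also have "\<dots> = v" by (rule expand[OF biproduct.prems(2), symmetric])
  finally show ?case .
qed

text \<open>A cover \<open>p\<close> of \<open>W\<close> gives a cokernel \<open>S(X, p)\<close>,
  which is epic, and this reduces the question to a sum of copies of \<open>G\<close>. The
  construction of components and the proofs about them test equality of arrows in this way.\<close>

lemma jointly_epi:
  assumes G: "finite_generator C G" and X: "X \<in> Obj C" and W: "W \<in> Obj C"
    and u: "u \<in> homs D (so X W) K" and v: "v \<in> homs D (so X W) K"
    and eq: "\<And>b. b \<in> homs C G W \<Longrightarrow> u \<circ>\<^sub>D sf (Idn C X) b = v \<circ>\<^sub>D sf (Idn C X) b"
  shows "u = v"
proof -
  obtain P p g where P: "sum_of C G P" and p: "p \<in> homs C P W"
    and "\<forall>a \<in> homs C G W. \<exists>b \<in> homs C G P. p \<circ>\<^sub>C b = a" and g: "is_cokernel C p g"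
    by (rule C.sum_of_cover[OF G W])
  have GO: "G \<in> Obj C" using G by (simp add: finite_generator_def)
  have "u \<circ>\<^sub>D sf (Idn C X) p = v \<circ>\<^sub>D sf (Idn C X) p"
  proof (rule jointly_epi_sum_of[OF P GO X])
    show "u \<circ>\<^sub>D sf (Idn C X) p \<in> homs D (so X P) K" "v \<circ>\<^sub>D sf (Idn C X) p \<in> homs D (so X P) K"
      using u v p X by (auto simp: C.homs_iff D.homs_iff)
    fix b assume b: "b \<in> homs C G P"
    then show "(u \<circ>\<^sub>D sf (Idn C X) p) \<circ>\<^sub>D sf (Idn C X) b = (v \<circ>\<^sub>D sf (Idn C X) p) \<circ>\<^sub>D sf (Idn C X) b"
      using eq[OF C.Comp_hom[OF b p]] u v p X by (simp add: C.homs_iff D.homs_iff)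
  qed
  then show ?thesis
    using D.epi_eqI[OF S_cokernel[OF g X]] u v p X by (simp add: C.homs_iff)
qed


text \<open>The component at \<open>X\<close> of the coend is characterised by its restrictions along the arrows
  \<open>a : G \<rightarrow> X\<close>, where dinaturality forces the value \<open>\<kappa> S(a, G)\<close>.\<close>

definition component :: "'o \<Rightarrow> 'n \<Rightarrow> 'p \<Rightarrow> 'o \<Rightarrow> 'n \<Rightarrow> bool" where
  "component G \<kappa> K X k \<longleftrightarrow> k \<in> homs D (so X X) K \<and>
     (\<forall>a \<in> homs C G X. k \<circ>\<^sub>D sf (Idn C X) a = \<kappa> \<circ>\<^sub>D sf a (Idn C G))"

text \<open>At \<open>G\<close> the component is \<open>\<kappa>\<close>, by balance. On a biproduct
  it is \<open>k S(i, p) + l S(j, q)\<close>: on an arrow \<open>b\<close> from \<open>G\<close> the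
  two terms give \<open>\<kappa> S(i p b, G)\<close> and \<open>\<kappa> S(j q b, G)\<close>, and
  \<open>i p b + j q b = b\<close>.\<close>

lemma component_sum_of:
  assumes P: "sum_of C G P" and G: "G \<in> Obj C" and \<kappa>: "\<kappa> \<in> homs D (so G G) K"
    and bal: "\<And>e. e \<in> homs C G G \<Longrightarrow> balances G \<kappa> e"
  shows "\<exists>k. component G \<kappa> K P k"
  using P
proof induction
  case self
  show ?case using \<kappa> bal by (intro exI[of _ \<kappa>]) (auto simp: component_def balances_def)
next
  case (biproduct P Q R i j p q)
  have ij: "i \<in> homs C P R" "j \<in> homs C Q R" "p \<in> homs C R P" "q \<in> homs C R Q"
    "add_arr C (i \<circ>\<^sub>C p) (j \<circ>\<^sub>C q) = Idn C R"
    using biproduct.hyps by (auto simp: is_biproduct_def)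
  obtain k l where k: "component G \<kappa> K P k" and l: "component G \<kappa> K Q l"
    using biproduct.IH by blast
  \<comment> \<open>The contribution of one summand, stated for a general \<open>T\<close> so that
    it applies to both.\<close>
  have part: "(m \<circ>\<^sub>D sf i' p') \<circ>\<^sub>D sf (Idn C R) b = \<kappa> \<circ>\<^sub>D sf (i' \<circ>\<^sub>C p' \<circ>\<^sub>C b) (Idn C G)"
    if m: "component G \<kappa> K T m" and T: "i' \<in> homs C T R" "p' \<in> homs C R T" and b: "b \<in> homs C G R"
    for m i' p' b T
  proof -
    have mh: "m \<in> homs D (so T T) K" using m by (simp add: component_def)
    have "(m \<circ>\<^sub>D sf i' p') \<circ>\<^sub>D sf (Idn C R) b = (m \<circ>\<^sub>D sf (Idn C T) (p' \<circ>\<^sub>C b)) \<circ>\<^sub>D sf i' (Idn C G)"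
      using mh T b by (auto simp: C.homs_iff D.homs_iff)
    also have "m \<circ>\<^sub>D sf (Idn C T) (p' \<circ>\<^sub>C b) = \<kappa> \<circ>\<^sub>D sf (p' \<circ>\<^sub>C b) (Idn C G)"
      using m C.Comp_hom[OF b T(2)] by (auto simp: component_def)
    also have "(\<kappa> \<circ>\<^sub>D sf (p' \<circ>\<^sub>C b) (Idn C G)) \<circ>\<^sub>D sf i' (Idn C G) = \<kappa> \<circ>\<^sub>D sf (i' \<circ>\<^sub>C p' \<circ>\<^sub>C b) (Idn C G)"
      using \<kappa> T b G by (auto simp: C.homs_iff D.homs_iff)
    finally show ?thesis .
  qed
  have kl: "k \<circ>\<^sub>D sf i p \<in> homs D (so R R) K" "l \<circ>\<^sub>D sf j q \<in> homs D (so R R) K"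
    using k l D.Comp_hom[OF sf_hom[OF ij(1,3)]] D.Comp_hom[OF sf_hom[OF ij(2,4)]]
    by (simp_all add: component_def)
  have "add_arr D (k \<circ>\<^sub>D sf i p) (l \<circ>\<^sub>D sf j q) \<circ>\<^sub>D sf (Idn C R) b = \<kappa> \<circ>\<^sub>D sf b (Idn C G)"
    if b: "b \<in> homs C G R" for b
  proof -
    have R: "R \<in> Obj C" using b C.homs_Obj by blast
    have ip: "i \<circ>\<^sub>C p \<circ>\<^sub>C b \<in> homs C G R" "j \<circ>\<^sub>C q \<circ>\<^sub>C b \<in> homs C G R"
      using ij b by (blast intro: C.Comp_hom)+
    have ip': "i \<circ>\<^sub>C p \<in> homs C R R" "j \<circ>\<^sub>C q \<in> homs C R R"
      using ij by (blast intro: C.Comp_hom)+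
    have "add_arr C (i \<circ>\<^sub>C p \<circ>\<^sub>C b) (j \<circ>\<^sub>C q \<circ>\<^sub>C b) = add_arr C ((i \<circ>\<^sub>C p) \<circ>\<^sub>C b) ((j \<circ>\<^sub>C q) \<circ>\<^sub>C b)"
      using ij b by (simp add: C.homs_iff)
    also have "\<dots> = b"
      using C.Comp_add_left[OF b ip'] ij(5) C.Idn_Comp[OF b] by simp
    finally have sum: "add_arr C (i \<circ>\<^sub>C p \<circ>\<^sub>C b) (j \<circ>\<^sub>C q \<circ>\<^sub>C b) = b" .
    have s: "sf (Idn C R) b \<in> homs D (so R G) (so R R)" using b R by (intro sf_hom C.Idn_hom)
    have "add_arr D (k \<circ>\<^sub>D sf i p) (l \<circ>\<^sub>D sf j q) \<circ>\<^sub>D sf (Idn C R) b =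
        add_arr D (\<kappa> \<circ>\<^sub>D sf (i \<circ>\<^sub>C p \<circ>\<^sub>C b) (Idn C G)) (\<kappa> \<circ>\<^sub>D sf (j \<circ>\<^sub>C q \<circ>\<^sub>C b) (Idn C G))"
      using D.Comp_add_left[OF s kl] part[OF k ij(1,3) b] part[OF l ij(2,4) b] by simp
    also have "\<dots> = \<kappa> \<circ>\<^sub>D add_arr D (sf (i \<circ>\<^sub>C p \<circ>\<^sub>C b) (Idn C G)) (sf (j \<circ>\<^sub>C q \<circ>\<^sub>C b) (Idn C G))"
      by (rule D.Comp_add_right[OF sf_hom[OF ip(1) C.Idn_hom[OF G]] sf_hom[OF ip(2) C.Idn_hom[OF G]] \<kappa>, symmetric])
    also have "\<dots> = \<kappa> \<circ>\<^sub>D sf b (Idn C G)"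
      using S_add_left[OF ip G] sum by simp
    finally show ?thesis .
  qed
  then show ?case using D.add_hom[OF kl] by (auto simp: component_def)
qed

text \<open>An arrow out of \<open>S(X, P)\<close> is obtained from the known component at the cover
  \<open>P\<close>, and it descends along the cokernel \<open>S(X, p)\<close>. Every arrow from
  \<open>G\<close> to \<open>X\<close> lifts to \<open>P\<close>, so the prescribed values on
  \<open>S(X, a)\<close> follow.\<close>

lemma component_exists:
  assumes G: "finite_generator C G" and \<kappa>: "\<kappa> \<in> homs D (so G G) K"
    and bal: "\<And>e. e \<in> homs C G G \<Longrightarrow> balances G \<kappa> e" and X: "X \<in> Obj C"
  shows "\<exists>k. component G \<kappa> K X k"
proof -
  have GO: "G \<in> Obj C" using G by (simp add: finite_generator_def)
  obtain P p g where P: "sum_of C G P" and p: "p \<in> homs C P X"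
    and lift: "\<forall>a \<in> homs C G X. \<exists>b \<in> homs C G P. p \<circ>\<^sub>C b = a" and g: "is_cokernel C p g"
    by (rule C.sum_of_cover[OF G X])
  have PO: "P \<in> Obj C" using p C.homs_Obj by blast
  obtain k where k: "component G \<kappa> K P k"
    using component_sum_of[OF P GO \<kappa> bal] by blast
  have kh: "k \<in> homs D (so P P) K" using k by (simp add: component_def)
  \<comment> \<open>The passage from \<open>S(X, P)\<close> to \<open>S(P, P)\<close> uses
    \<open>p\<close> in the contravariant slot.\<close>
  define \<phi> where "\<phi> = k \<circ>\<^sub>D sf p (Idn C P)"
  have \<phi>: "\<phi> \<in> homs D (so X P) K"
    unfolding \<phi>_def using kh p PO by (blast intro: D.Comp_hom sf_hom C.Idn_hom)
  have \<phi>_eq: "\<phi> \<circ>\<^sub>D sf (Idn C X) b = \<kappa> \<circ>\<^sub>D sf (p \<circ>\<^sub>C b) (Idn C G)" if b: "b \<in> homs C G P" for b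
  proof -
    have "\<phi> \<circ>\<^sub>D sf (Idn C X) b = (k \<circ>\<^sub>D sf (Idn C P) b) \<circ>\<^sub>D sf p (Idn C G)"
      unfolding \<phi>_def using kh p b by (auto simp: C.homs_iff D.homs_iff)
    also have "k \<circ>\<^sub>D sf (Idn C P) b = \<kappa> \<circ>\<^sub>D sf b (Idn C G)"
      using k b by (simp add: component_def)
    also have "(\<kappa> \<circ>\<^sub>D sf b (Idn C G)) \<circ>\<^sub>D sf p (Idn C G) = \<kappa> \<circ>\<^sub>D sf (p \<circ>\<^sub>C b) (Idn C G)"
      using \<kappa> p b GO by (auto simp: C.homs_iff D.homs_iff)
    finally show ?thesis .
  qed
  define W where "W = Dom C g"
  have gh: "g \<in> homs C W P" "p \<circ>\<^sub>C g = zero_arr C W X"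
    using g p by (auto simp: is_cokernel_def C.homs_iff W_def)
  have WO: "W \<in> Obj C" using gh C.homs_Obj by blast
  \<comment> \<open>Here \<open>W\<close> is an arbitrary object, not a sum of copies of
    \<open>G\<close>, which is why joint detection was proved for all objects. On \<open>b\<close>
    from \<open>G\<close> to \<open>W\<close> the value is \<open>\<kappa> S(p g b, G)\<close>, and
    \<open>p g = 0\<close>.\<close>
  have kill: "\<phi> \<circ>\<^sub>D sf (Idn C X) g = zero_arr D (so X W) K"
  proof (rule jointly_epi[OF G X WO])
    show "\<phi> \<circ>\<^sub>D sf (Idn C X) g \<in> homs D (so X W) K"
      using \<phi> gh X by (blast intro: D.Comp_hom sf_hom C.Idn_hom)
    have KO: "K \<in> Obj D" using \<kappa> D.homs_Obj by blast
    then show "zero_arr D (so X W) K \<in> homs D (so X W) K" using X WO by (simp add: D.zero_hom)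
    fix b assume b: "b \<in> homs C G W"
    have "(\<phi> \<circ>\<^sub>D sf (Idn C X) g) \<circ>\<^sub>D sf (Idn C X) b = \<phi> \<circ>\<^sub>D sf (Idn C X) (g \<circ>\<^sub>C b)"
      using \<phi> gh(1) b X by (auto simp: C.homs_iff D.homs_iff)
    also have "\<dots> = \<kappa> \<circ>\<^sub>D sf (p \<circ>\<^sub>C g \<circ>\<^sub>C b) (Idn C G)"
      using \<phi>_eq C.Comp_hom[OF b gh(1)] by blast
    also have "p \<circ>\<^sub>C g \<circ>\<^sub>C b = zero_arr C G X"
      using C.Comp_assoc[OF b gh(1) p] gh(2) C.Comp_zero_left[OF b X] by simp
    also have "\<kappa> \<circ>\<^sub>D sf (zero_arr C G X) (Idn C G) = zero_arr D (so X G) K"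
      using sf_zero_left[OF GO X GO] D.Comp_zero_right[OF \<kappa>] X GO by simp
    also have "\<dots> = zero_arr D (so X W) K \<circ>\<^sub>D sf (Idn C X) b"
      using D.Comp_zero_left[OF sf_hom[OF C.Idn_hom[OF X] b] KO] by simp
    finally show "(\<phi> \<circ>\<^sub>D sf (Idn C X) g) \<circ>\<^sub>D sf (Idn C X) b = zero_arr D (so X W) K \<circ>\<^sub>D sf (Idn C X) b" .
  qed
  have "\<exists>!h. h \<in> homs D (so X X) K \<and> h \<circ>\<^sub>D sf (Idn C X) p = \<phi>"
    using S_cokernel[OF g X] \<phi> kill p gh(1) X
    by (auto simp: is_cokernel_def C.homs_iff)
  then obtain h where h: "h \<in> homs D (so X X) K" "h \<circ>\<^sub>D sf (Idn C X) p = \<phi>" by blast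
  have "h \<circ>\<^sub>D sf (Idn C X) a = \<kappa> \<circ>\<^sub>D sf a (Idn C G)" if a: "a \<in> homs C G X" for a
  proof -
    obtain b where b: "b \<in> homs C G P" "p \<circ>\<^sub>C b = a" using lift a by blast
    have "h \<circ>\<^sub>D sf (Idn C X) (p \<circ>\<^sub>C b) = (h \<circ>\<^sub>D sf (Idn C X) p) \<circ>\<^sub>D sf (Idn C X) b"
      using h(1) p b(1) X by (auto simp: C.homs_iff D.homs_iff)
    then show ?thesis using h(2) \<phi>_eq[OF b(1)] b(2) by simp
  qed
  then show ?thesis using h(1) by (auto simp: component_def)
qed

section \<open>The universal cowedge\<close>

text \<open>A cowedge is determined by its component at \<open>G\<close>, and such a component is
  balanced. The universal balanced arrow therefore carries the universal cowedge.\<close>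

lemma coend_exists_of_generator:
  assumes G: "finite_generator C G"
  shows "coend_exists C D S"
proof -
  have GO: "G \<in> Obj C" using G by (simp add: finite_generator_def)
  obtain A where A: "finite A" "A \<subseteq> homs C G G" "homs C G G \<subseteq> arr_span C G G A"
    using G GO unfolding finite_generator_def by blast
  obtain K \<kappa> where \<kappa>: "\<kappa> \<in> homs D (so G G) K" and balA: "\<forall>e \<in> A. balances G \<kappa> e"
    and univ: "\<forall>K'. \<forall>\<kappa>' \<in> homs D (so G G) K'. (\<forall>e \<in> A. balances G \<kappa>' e) \<longrightarrow>
      (\<exists>!h. h \<in> homs D K K' \<and> h \<circ>\<^sub>D \<kappa> = \<kappa>')"
    using universal_balanced[OF GO A(1,2)] by (elim exE conjE) (rule that)
  have KO: "K \<in> Obj D" using \<kappa> D.homs_Obj by blast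
  \<comment> \<open>The balance condition is linear in \<open>e\<close>, so it extends from the
    spanning set to all endomorphisms of \<open>G\<close>.\<close>
  have bal: "balances G \<kappa> e" if "e \<in> homs C G G" for e
  proof -
    have "e \<in> arr_span C G G A" using that A(3) by blast
    then show ?thesis
    proof induction
      case (base e)
      then show ?case using balA by blast
    next
      case zero
      show ?case unfolding balances_def using sf_zero_left sf_zero_right GO by simp
    next
      case (add e e')
      have e: "e \<in> homs C G G" "e' \<in> homs C G G"
        using C.arr_span_homs[OF A(2) GO GO] add.hyps by blast+
      have s: "sf x (Idn C G) \<in> homs D (so G G) (so G G)" "sf (Idn C G) x \<in> homs D (so G G) (so G G)"
        if "x \<in> homs C G G" for x
        using that GO by (auto intro!: sf_hom C.Idn_hom)
      show ?case
        using add.IH unfolding balances_def S_add_left[OF e GO] S_add_right[OF e GO]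
          D.Comp_add_right[OF s(1)[OF e(1)] s(1)[OF e(2)] \<kappa>] D.Comp_add_right[OF s(2)[OF e(1)] s(2)[OF e(2)] \<kappa>]
        by simp
    next
      case (scale e c)
      have e: "e \<in> homs C G G"
        using C.arr_span_homs[OF A(2) GO GO] scale.hyps by blast
      have s: "sf e (Idn C G) \<in> homs D (so G G) (so G G)" "sf (Idn C G) e \<in> homs D (so G G) (so G G)"
        using e GO by (auto intro!: sf_hom C.Idn_hom)
      show ?case
        using scale.IH unfolding balances_def S_scale_left[OF e GO] S_scale_right[OF e GO]
          D.Comp_scale_right[OF s(1) \<kappa>] D.Comp_scale_right[OF s(2) \<kappa>]
        by simp
    qed
  qed
  \<comment> \<open>The choice is harmless: joint detection makes the component at \<open>X\<close>
    unique.\<close>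
  define \<iota> where "\<iota> X = (SOME k. component G \<kappa> K X k)" for X
  have \<iota>: "component G \<kappa> K X (\<iota> X)" if "X \<in> Obj C" for X
    unfolding \<iota>_def using component_exists[OF G \<kappa> bal that] by (rule someI_ex)
  have \<iota>h: "\<iota> X \<in> homs D (so X X) K" if "X \<in> Obj C" for X
    using \<iota>[OF that] by (simp add: component_def)
  have \<iota>_eq: "\<iota> X \<circ>\<^sub>D sf (Idn C X) a = \<kappa> \<circ>\<^sub>D sf a (Idn C G)" if "a \<in> homs C G X" for X a
    using \<iota> that C.homs_Obj[OF that] by (simp add: component_def)
  have cowedge: "is_cowedge C D S K \<iota>"
    unfolding is_cowedge_def
  proof (intro conjI ballI allI KO \<iota>h)
    fix X Y f assume f: "f \<in> homs C X Y"
    have XY: "X \<in> Obj C" "Y \<in> Obj C" using f C.homs_Obj by blast+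
    \<comment> \<open>Restricted along \<open>S(Y, a)\<close> with \<open>a\<close> from
      \<open>G\<close> to \<open>X\<close>, both sides become
      \<open>\<kappa> S(f a, G)\<close>.\<close>
    show "\<iota> X \<circ>\<^sub>D sf f (Idn C X) = \<iota> Y \<circ>\<^sub>D sf (Idn C Y) f"
    proof (rule jointly_epi[OF G XY(2,1)])
      show "\<iota> X \<circ>\<^sub>D sf f (Idn C X) \<in> homs D (so Y X) K" "\<iota> Y \<circ>\<^sub>D sf (Idn C Y) f \<in> homs D (so Y X) K"
        using \<iota>h f XY by (blast intro: D.Comp_hom sf_hom C.Idn_hom)+
      fix a assume a: "a \<in> homs C G X"
      have "(\<iota> X \<circ>\<^sub>D sf f (Idn C X)) \<circ>\<^sub>D sf (Idn C Y) a = (\<iota> X \<circ>\<^sub>D sf (Idn C X) a) \<circ>\<^sub>D sf f (Idn C G)"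
        using \<iota>h[OF XY(1)] f a by (auto simp: C.homs_iff D.homs_iff)
      also have "\<dots> = (\<kappa> \<circ>\<^sub>D sf a (Idn C G)) \<circ>\<^sub>D sf f (Idn C G)"
        using \<iota>_eq[OF a] by simp
      also have "\<dots> = \<kappa> \<circ>\<^sub>D sf (f \<circ>\<^sub>C a) (Idn C G)"
        using \<kappa> f a GO by (auto simp: C.homs_iff D.homs_iff)
      also have "\<dots> = \<iota> Y \<circ>\<^sub>D sf (Idn C Y) (f \<circ>\<^sub>C a)"
        using \<iota>_eq[OF C.Comp_hom[OF a f]] by simp
      also have "\<dots> = (\<iota> Y \<circ>\<^sub>D sf (Idn C Y) f) \<circ>\<^sub>D sf (Idn C Y) a"
        using \<iota>h[OF XY(2)] f a XY by (auto simp: C.homs_iff D.homs_iff)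
      finally show "(\<iota> X \<circ>\<^sub>D sf f (Idn C X)) \<circ>\<^sub>D sf (Idn C Y) a = (\<iota> Y \<circ>\<^sub>D sf (Idn C Y) f) \<circ>\<^sub>D sf (Idn C Y) a" .
    qed
  qed
  \<comment> \<open>The prescription at the identity of \<open>G\<close>. It ties the factorisation
    of cowedges to that of balanced arrows.\<close>
  have \<iota>G: "\<iota> G = \<kappa>"
    using \<iota>_eq[OF C.Idn_hom[OF GO]] \<iota>h[OF GO] \<kappa> GO by (simp add: D.homs_iff)
  have "\<exists>!h. h \<in> homs D K K' \<and> (\<forall>X \<in> Obj C. h \<circ>\<^sub>D \<iota> X = \<mu> X)" if w: "is_cowedge C D S K' \<mu>" for K' \<mu>
  proof -
    have wh: "\<mu> X \<in> homs D (so X X) K'" if "X \<in> Obj C" for X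
      using w that by (simp add: is_cowedge_def)
    have wd: "\<mu> X \<circ>\<^sub>D sf f (Idn C X) = \<mu> Y \<circ>\<^sub>D sf (Idn C Y) f" if "f \<in> homs C X Y" for X Y f
      using w that unfolding is_cowedge_def by blast
    \<comment> \<open>The cowedge equations of \<open>\<mu>\<close> at endomorphisms of
      \<open>G\<close> are exactly balance.\<close>
    have "\<forall>e \<in> A. balances G (\<mu> G) e"
      using wd A(2) by (auto simp: balances_def)
    then have ex: "\<exists>!h. h \<in> homs D K K' \<and> h \<circ>\<^sub>D \<kappa> = \<mu> G"
      using univ[rule_format, OF wh[OF GO]] by blast
    then obtain h where h: "h \<in> homs D K K'" "h \<circ>\<^sub>D \<kappa> = \<mu> G" by blast
    have "h \<circ>\<^sub>D \<iota> X = \<mu> X" if X: "X \<in> Obj C" for X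
    proof (rule jointly_epi[OF G X X _ wh[OF X]])
      show "h \<circ>\<^sub>D \<iota> X \<in> homs D (so X X) K'" using \<iota>h[OF X] h(1) by (rule D.Comp_hom)
      fix a assume a: "a \<in> homs C G X"
      have sa: "sf (Idn C X) a \<in> homs D (so X G) (so X X)" "sf a (Idn C G) \<in> homs D (so X G) (so G G)"
        using a X GO by (auto intro!: sf_hom C.Idn_hom)
      have "(h \<circ>\<^sub>D \<iota> X) \<circ>\<^sub>D sf (Idn C X) a = (h \<circ>\<^sub>D \<kappa>) \<circ>\<^sub>D sf a (Idn C G)"
        using D.Comp_assoc[OF sa(1) \<iota>h[OF X] h(1)] D.Comp_assoc[OF sa(2) \<kappa> h(1)] \<iota>_eq[OF a] by simp
      then show "(h \<circ>\<^sub>D \<iota> X) \<circ>\<^sub>D sf (Idn C X) a = \<mu> X \<circ>\<^sub>D sf (Idn C X) a"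
        using h(2) wd[OF a] by simp
    qed
    moreover have "h' = h" if "h' \<in> homs D K K'" "h' \<circ>\<^sub>D \<iota> G = \<mu> G" for h'
      using ex h that \<iota>G by auto
    ultimately show ?thesis using h(1) GO by blast
  qed
  then have "is_coend C D S K \<iota>"
    unfolding is_coend_def using S_functor cowedge by blast
  then show ?thesis unfolding coend_exists_def by blast
qed

end


section \<open>Adjunctions between tensoring with an object and with its dual\<close>

context monoidal_category
begin

abbreviation tobj (infixr "\<otimes>\<^sub>o" 75) where "X \<otimes>\<^sub>o Y \<equiv> tob C X Y"
abbreviation tarr (infixr "\<otimes>\<^sub>a" 75) where "f \<otimes>\<^sub>a g \<equiv> tar C f g"

lemma tob_Obj [simp]: "X \<in> Obj C \<Longrightarrow> Y \<in> Obj C \<Longrightarrow> X \<otimes>\<^sub>o Y \<in> Obj C"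
  using functor_Obj[OF Tens_functor, of "(X, Y)"] by (simp add: prod_cat_def)

lemma tar_Arr [simp]:
  assumes "f \<in> Arr C" "g \<in> Arr C"
  shows "f \<otimes>\<^sub>a g \<in> Arr C" "Dom C (f \<otimes>\<^sub>a g) = Dom C f \<otimes>\<^sub>o Dom C g" "Cod C (f \<otimes>\<^sub>a g) = Cod C f \<otimes>\<^sub>o Cod C g"
  using functor_Arr[OF Tens_functor, of "(f, g)"] assms by (simp_all add: prod_cat_def)

lemma tar_hom: "f \<in> homs C X X' \<Longrightarrow> g \<in> homs C Y Y' \<Longrightarrow> f \<otimes>\<^sub>a g \<in> homs C (X \<otimes>\<^sub>o Y) (X' \<otimes>\<^sub>o Y')"
  by (simp add: homs_iff)

lemma tar_Idn [simp]: "X \<in> Obj C \<Longrightarrow> Y \<in> Obj C \<Longrightarrow> Idn C X \<otimes>\<^sub>a Idn C Y = Idn C (X \<otimes>\<^sub>o Y)"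
  using functor_Idn[OF Tens_functor, of "(X, Y)"] by (simp add: prod_cat_def)

lemma tar_Comp:
  assumes "f \<in> Arr C" "g \<in> Arr C" "f' \<in> Arr C" "g' \<in> Arr C" "Cod C f = Dom C f'" "Cod C g = Dom C g'"
  shows "(f' \<otimes>\<^sub>a g') \<cdot> (f \<otimes>\<^sub>a g) = (f' \<cdot> f) \<otimes>\<^sub>a (g' \<cdot> g)"
  using functor_Comp[OF Tens_functor, of "(f, g)" "(f', g')"] assms by (simp add: prod_cat_def)

lemma tar_Comp_left:
  assumes "f \<in> Arr C" "f' \<in> Arr C" "Cod C f = Dom C f'" "Y \<in> Obj C"
  shows "(f' \<cdot> f) \<otimes>\<^sub>a Idn C Y = (f' \<otimes>\<^sub>a Idn C Y) \<cdot> (f \<otimes>\<^sub>a Idn C Y)"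
  using assms by (simp add: tar_Comp)

lemma tar_Comp_right:
  assumes "f \<in> Arr C" "f' \<in> Arr C" "Cod C f = Dom C f'" "Y \<in> Obj C"
  shows "Idn C Y \<otimes>\<^sub>a (f' \<cdot> f) = (Idn C Y \<otimes>\<^sub>a f') \<cdot> (Idn C Y \<otimes>\<^sub>a f)"
  using assms by (simp add: tar_Comp)

lemma tar_interchange:
  assumes "f \<in> homs C X X'" "g \<in> homs C Y Y'"
  shows "(f \<otimes>\<^sub>a Idn C Y') \<cdot> (Idn C X \<otimes>\<^sub>a g) = (Idn C X' \<otimes>\<^sub>a g) \<cdot> (f \<otimes>\<^sub>a Idn C Y)"
  using assms by (auto simp: homs_iff tar_Comp)

lemma Unit_in_Obj [simp]: "Unit C \<in> Obj C" by (rule Unit_Obj)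

lemma Assoc_Arr [simp]:
  assumes "X \<in> Obj C" "Y \<in> Obj C" "Z \<in> Obj C"
  shows "Assoc C X Y Z \<in> Arr C" "Dom C (Assoc C X Y Z) = (X \<otimes>\<^sub>o Y) \<otimes>\<^sub>o Z"
    "Cod C (Assoc C X Y Z) = X \<otimes>\<^sub>o (Y \<otimes>\<^sub>o Z)" "is_iso C (Assoc C X Y Z)"
  using Assoc_hom[OF assms] Assoc_iso[OF assms] by (auto simp: homs_iff)

lemma Lunit_Arr [simp]:
  assumes "X \<in> Obj C"
  shows "Lunit C X \<in> Arr C" "Dom C (Lunit C X) = Unit C \<otimes>\<^sub>o X" "Cod C (Lunit C X) = X" "is_iso C (Lunit C X)"
  using Lunit_hom[OF assms] Lunit_iso[OF assms] by (auto simp: homs_iff)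

lemma Runit_Arr [simp]:
  assumes "X \<in> Obj C"
  shows "Runit C X \<in> Arr C" "Dom C (Runit C X) = X \<otimes>\<^sub>o Unit C" "Cod C (Runit C X) = X" "is_iso C (Runit C X)"
  using Runit_hom[OF assms] Runit_iso[OF assms] by (auto simp: homs_iff)

lemma iso_move_left:
  assumes "is_iso C e" "is_iso C e'" "f \<in> homs C (Dom C e) (Dom C e')" "g \<in> homs C (Cod C e) (Cod C e')"
    and "e' \<cdot> f = g \<cdot> e"
  shows "f \<cdot> inv_arr C e = inv_arr C e' \<cdot> g"
proof -
  have e: "e \<in> Arr C" "e' \<in> Arr C" using assms is_iso_Arr by blast+
  have "f \<cdot> inv_arr C e = (inv_arr C e' \<cdot> e' \<cdot> f) \<cdot> inv_arr C e"
    using assms(1-4) by (simp add: homs_iff)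
  also have "\<dots> = (inv_arr C e' \<cdot> g \<cdot> e) \<cdot> inv_arr C e" using assms(5) by simp
  also have "\<dots> = inv_arr C e' \<cdot> g" using assms(1-4) e by (simp add: homs_iff)
  finally show ?thesis .
qed

lemma Assoc_inv_natural:
  assumes f: "f \<in> homs C X X'" and g: "g \<in> homs C Y Y'" and h: "h \<in> homs C Z Z'"
  shows "((f \<otimes>\<^sub>a g) \<otimes>\<^sub>a h) \<cdot> inv_arr C (Assoc C X Y Z) = inv_arr C (Assoc C X' Y' Z') \<cdot> (f \<otimes>\<^sub>a (g \<otimes>\<^sub>a h))"
  using homs_Obj[OF f] homs_Obj[OF g] homs_Obj[OF h] f g h
  by (intro iso_move_left Assoc_natural) (auto simp: homs_iff)

lemma Lunit_inv_natural:
  assumes f: "f \<in> homs C X X'"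
  shows "(Idn C (Unit C) \<otimes>\<^sub>a f) \<cdot> inv_arr C (Lunit C X) = inv_arr C (Lunit C X') \<cdot> f"
  using homs_Obj[OF f] f by (intro iso_move_left Lunit_natural) (auto simp: homs_iff)

lemma tar_is_iso:
  assumes f: "is_iso C f" and g: "is_iso C g"
  shows "is_iso C (f \<otimes>\<^sub>a g)"
proof -
  have "f \<in> Arr C" "g \<in> Arr C" using assms is_iso_Arr by blast+
  then have "inverse_arrs C (f \<otimes>\<^sub>a g) (inv_arr C f \<otimes>\<^sub>a inv_arr C g)"
    using assms by (simp add: inverse_arrs_def homs_iff tar_Comp)
  then show ?thesis unfolding is_iso_def by blast
qed

lemma Idn_is_iso [simp]: "X \<in> Obj C \<Longrightarrow> is_iso C (Idn C X)"
  by (auto simp: is_iso_def inverse_arrs_def homs_iff intro!: exI[of _ "Idn C X"])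

text \<open>The left unit constraint is a natural isomorphism from tensoring with the unit to the
  identity functor.\<close>

lemma tar_Unit_inject:
  assumes f: "f \<in> homs C X Y" and g: "g \<in> homs C X Y"
    and eq: "Idn C (Unit C) \<otimes>\<^sub>a f = Idn C (Unit C) \<otimes>\<^sub>a g"
  shows "f = g"
proof -
  have "f \<cdot> Lunit C X = g \<cdot> Lunit C X"
    using Lunit_natural[OF f] Lunit_natural[OF g] eq by simp
  then show ?thesis
    using iso_cancel_right[of "Lunit C X" f Y g] homs_Obj[OF f] f g by simp
qed

text \<open>Kelly's redundant coherence axiom: both sides become equal after tensoring with the unit
  object, by the pentagon for \<open>1, 1, X, Y\<close> and two triangles.\<close>

lemma Lunit_tensor:
  assumes X: "X \<in> Obj C" and Y: "Y \<in> Obj C"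
  shows "Lunit C (X \<otimes>\<^sub>o Y) \<cdot> Assoc C (Unit C) X Y = Lunit C X \<otimes>\<^sub>a Idn C Y"
proof (rule tar_Unit_inject)
  let ?I = "Unit C" and ?i = "Idn C (Unit C)" and ?a = "Assoc C"
  show "Lunit C (X \<otimes>\<^sub>o Y) \<cdot> ?a ?I X Y \<in> homs C ((?I \<otimes>\<^sub>o X) \<otimes>\<^sub>o Y) (X \<otimes>\<^sub>o Y)"
    "Lunit C X \<otimes>\<^sub>a Idn C Y \<in> homs C ((?I \<otimes>\<^sub>o X) \<otimes>\<^sub>o Y) (X \<otimes>\<^sub>o Y)"
    using X Y by (simp_all add: homs_iff)
  let ?e = "?a ?I (?I \<otimes>\<^sub>o X) Y \<cdot> (?a ?I ?I X \<otimes>\<^sub>a Idn C Y)"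
  have iso1: "is_iso C (?a ?I ?I X \<otimes>\<^sub>a Idn C Y)" and iso2: "is_iso C (?a ?I (?I \<otimes>\<^sub>o X) Y)"
    using X Y by (simp_all add: tar_is_iso)
  have "((?i \<otimes>\<^sub>a (Lunit C (X \<otimes>\<^sub>o Y) \<cdot> ?a ?I X Y)) \<cdot> ?a ?I (?I \<otimes>\<^sub>o X) Y) \<cdot> (?a ?I ?I X \<otimes>\<^sub>a Idn C Y)
      = (?i \<otimes>\<^sub>a Lunit C (X \<otimes>\<^sub>o Y)) \<cdot> (?i \<otimes>\<^sub>a ?a ?I X Y) \<cdot> ?e"
    using X Y by (simp add: tar_Comp_right)
  also have "\<dots> = (?i \<otimes>\<^sub>a Lunit C (X \<otimes>\<^sub>o Y)) \<cdot> ?a ?I ?I (X \<otimes>\<^sub>o Y) \<cdot> ?a (?I \<otimes>\<^sub>o ?I) X Y"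
    using pentagon[of ?I ?I X Y] X Y by simp
  also have "\<dots> = ((?i \<otimes>\<^sub>a Lunit C (X \<otimes>\<^sub>o Y)) \<cdot> ?a ?I ?I (X \<otimes>\<^sub>o Y)) \<cdot> ?a (?I \<otimes>\<^sub>o ?I) X Y"
    using X Y by simp
  also have "\<dots> = (Runit C ?I \<otimes>\<^sub>a (Idn C X \<otimes>\<^sub>a Idn C Y)) \<cdot> ?a (?I \<otimes>\<^sub>o ?I) X Y"
    using triangle[of ?I "X \<otimes>\<^sub>o Y"] X Y by (simp del: Comp_assoc_Arr)
  also have "\<dots> = ?a ?I X Y \<cdot> ((Runit C ?I \<otimes>\<^sub>a Idn C X) \<otimes>\<^sub>a Idn C Y)"
    using X Y by (intro Assoc_natural[symmetric]) (auto simp: homs_iff)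
  also have "\<dots> = ?a ?I X Y \<cdot> (((?i \<otimes>\<^sub>a Lunit C X) \<cdot> ?a ?I ?I X) \<otimes>\<^sub>a Idn C Y)"
    using triangle[of ?I X] X by simp
  also have "\<dots> = (?a ?I X Y \<cdot> ((?i \<otimes>\<^sub>a Lunit C X) \<otimes>\<^sub>a Idn C Y)) \<cdot> (?a ?I ?I X \<otimes>\<^sub>a Idn C Y)"
    using X Y by (simp add: tar_Comp_left)
  also have "?a ?I X Y \<cdot> ((?i \<otimes>\<^sub>a Lunit C X) \<otimes>\<^sub>a Idn C Y) =
      (?i \<otimes>\<^sub>a (Lunit C X \<otimes>\<^sub>a Idn C Y)) \<cdot> ?a ?I (?I \<otimes>\<^sub>o X) Y"
    using X Y by (intro Assoc_natural) (auto simp: homs_iff)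
  finally have "(?i \<otimes>\<^sub>a (Lunit C (X \<otimes>\<^sub>o Y) \<cdot> ?a ?I X Y)) \<cdot> ?a ?I (?I \<otimes>\<^sub>o X) Y =
      (?i \<otimes>\<^sub>a (Lunit C X \<otimes>\<^sub>a Idn C Y)) \<cdot> ?a ?I (?I \<otimes>\<^sub>o X) Y"
    by (rule iso_cancel_right[OF iso1, where X = "?I \<otimes>\<^sub>o X \<otimes>\<^sub>o Y", rotated 2])
      (use X Y in \<open>simp_all add: homs_iff\<close>)
  then show "?i \<otimes>\<^sub>a (Lunit C (X \<otimes>\<^sub>o Y) \<cdot> ?a ?I X Y) = ?i \<otimes>\<^sub>a (Lunit C X \<otimes>\<^sub>a Idn C Y)"
    by (rule iso_cancel_right[OF iso2, where X = "?I \<otimes>\<^sub>o X \<otimes>\<^sub>o Y", rotated 2])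
      (use X Y in \<open>simp_all add: homs_iff\<close>)
qed


text \<open>Composites are kept associated to the right, where \<open>x \<cdot> y\<close> is not a
  subterm of a longer chain. This form lets an equation for \<open>x \<cdot> y\<close> rewrite the
  front of such a chain.\<close>

lemma Comp_eq_chain:
  assumes "x \<cdot> y = z" "x \<in> Arr C" "y \<in> Arr C" "Cod C y = Dom C x" "w \<in> Arr C" "Cod C w = Dom C y"
  shows "x \<cdot> y \<cdot> w = z \<cdot> w"
  using assms Comp_assoc_Arr by metis

section \<open>Transposition along a dual pair\<close>

context
  fixes X X' e c
  assumes dual: "is_left_dual C X X' e c"
begin

lemma dual_Obj [simp]: "X \<in> Obj C" "X' \<in> Obj C"
  using dual by (auto simp: is_left_dual_def)

lemma dual_Arr [simp]:
  "e \<in> Arr C" "Dom C e = X' \<otimes>\<^sub>o X" "Cod C e = Unit C"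
  "c \<in> Arr C" "Dom C c = Unit C" "Cod C c = X \<otimes>\<^sub>o X'"
  using dual by (auto simp: is_left_dual_def homs_iff)

lemma zigzag:
  "Runit C X \<cdot> (Idn C X \<otimes>\<^sub>a e) \<cdot> Assoc C X X' X \<cdot> (c \<otimes>\<^sub>a Idn C X) \<cdot> inv_arr C (Lunit C X) = Idn C X"
  "Lunit C X' \<cdot> (e \<otimes>\<^sub>a Idn C X') \<cdot> inv_arr C (Assoc C X' X X') \<cdot> (Idn C X' \<otimes>\<^sub>a c) \<cdot> inv_arr C (Runit C X')
    = Idn C X'"
  using dual by (auto simp: is_left_dual_def)

text \<open>The transpose from \<open>Hom(X' \<otimes> A, B)\<close> to
  \<open>Hom(A, X \<otimes> B)\<close> for the adjunction whose unit is built from the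
  coevaluation.\<close>

definition hat :: "'o \<Rightarrow> 'm \<Rightarrow> 'm" where
  "hat A g = (Idn C X \<otimes>\<^sub>a g) \<cdot> Assoc C X X' A \<cdot> (c \<otimes>\<^sub>a Idn C A) \<cdot> inv_arr C (Lunit C A)"

text \<open>The transpose in the other direction, built from the evaluation.\<close>

definition unhat :: "'o \<Rightarrow> 'm \<Rightarrow> 'm" where
  "unhat B h = Lunit C B \<cdot> (e \<otimes>\<^sub>a Idn C B) \<cdot> inv_arr C (Assoc C X' X B) \<cdot> (Idn C X' \<otimes>\<^sub>a h)"

lemma hat_hom: "A \<in> Obj C \<Longrightarrow> g \<in> homs C (X' \<otimes>\<^sub>o A) B \<Longrightarrow> hat A g \<in> homs C A (X \<otimes>\<^sub>o B)"
  by (auto simp: hat_def homs_iff)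

lemma unhat_hom: "B \<in> Obj C \<Longrightarrow> h \<in> homs C A (X \<otimes>\<^sub>o B) \<Longrightarrow> unhat B h \<in> homs C (X' \<otimes>\<^sub>o A) B"
  by (auto simp: unhat_def homs_iff)

lemma hat_Comp_left:
  assumes "A \<in> Obj C" "g \<in> homs C (X' \<otimes>\<^sub>o A) B" "k \<in> homs C B B'"
  shows "hat A (k \<cdot> g) = (Idn C X \<otimes>\<^sub>a k) \<cdot> hat A g"
  using assms by (simp add: hat_def homs_iff tar_Comp_right)

text \<open>Naturality of the transpose in \<open>A\<close>: \<open>f\<close> slides past the
  associator, then past the coevaluation, which acts on other tensor factors, and finally past the
  unit constraint.\<close>

lemma hat_Comp_right:
  assumes g: "g \<in> homs C (X' \<otimes>\<^sub>o A) B" and f: "f \<in> homs C A' A"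
  shows "hat A' (g \<cdot> (Idn C X' \<otimes>\<^sub>a f)) = hat A g \<cdot> f"
proof -
  have A: "A \<in> Obj C" "A' \<in> Obj C" using f homs_Obj by blast+
  have f': "f \<in> Arr C" "Dom C f = A'" "Cod C f = A" using f by (simp_all add: homs_iff)
  have g': "g \<in> Arr C" "Dom C g = X' \<otimes>\<^sub>o A" using g by (simp_all add: homs_iff)
  have n1: "(Idn C X \<otimes>\<^sub>a (Idn C X' \<otimes>\<^sub>a f)) \<cdot> Assoc C X X' A' = Assoc C X X' A \<cdot> (Idn C (X \<otimes>\<^sub>o X') \<otimes>\<^sub>a f)"
    using Assoc_natural[OF Idn_hom Idn_hom f, of X X'] by simp
  have n2: "(Idn C (X \<otimes>\<^sub>o X') \<otimes>\<^sub>a f) \<cdot> (c \<otimes>\<^sub>a Idn C A') = (c \<otimes>\<^sub>a Idn C A) \<cdot> (Idn C (Unit C) \<otimes>\<^sub>a f)"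
    using f' A by (simp add: tar_Comp)
  have "hat A' (g \<cdot> (Idn C X' \<otimes>\<^sub>a f)) = (Idn C X \<otimes>\<^sub>a g) \<cdot> (Idn C X \<otimes>\<^sub>a (Idn C X' \<otimes>\<^sub>a f)) \<cdot>
      Assoc C X X' A' \<cdot> (c \<otimes>\<^sub>a Idn C A') \<cdot> inv_arr C (Lunit C A')"
    using A f' g' by (simp add: hat_def tar_Comp_right)
  also have "\<dots> = (Idn C X \<otimes>\<^sub>a g) \<cdot> Assoc C X X' A \<cdot> (Idn C (X \<otimes>\<^sub>o X') \<otimes>\<^sub>a f) \<cdot>
      (c \<otimes>\<^sub>a Idn C A') \<cdot> inv_arr C (Lunit C A')"
    using A f' g' by (simp add: Comp_eq_chain[OF n1])
  also have "\<dots> = (Idn C X \<otimes>\<^sub>a g) \<cdot> Assoc C X X' A \<cdot> (c \<otimes>\<^sub>a Idn C A) \<cdot>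
      (Idn C (Unit C) \<otimes>\<^sub>a f) \<cdot> inv_arr C (Lunit C A')"
    using A f' g' by (simp add: Comp_eq_chain[OF n2])
  also have "\<dots> = hat A g \<cdot> f"
    using A f' g' Lunit_inv_natural[OF f] by (simp add: hat_def)
  finally show ?thesis .
qed

lemma unhat_Comp_left:
  assumes k: "k \<in> homs C B B'" and h: "h \<in> homs C A (X \<otimes>\<^sub>o B)"
  shows "unhat B' ((Idn C X \<otimes>\<^sub>a k) \<cdot> h) = k \<cdot> unhat B h"
proof -
  have B: "B \<in> Obj C" "B' \<in> Obj C" using k homs_Obj by blast+
  have k': "k \<in> Arr C" "Dom C k = B" "Cod C k = B'" using k by (simp_all add: homs_iff)
  have h': "h \<in> Arr C" "Cod C h = X \<otimes>\<^sub>o B" using h by (simp_all add: homs_iff)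
  have n1: "inv_arr C (Assoc C X' X B') \<cdot> (Idn C X' \<otimes>\<^sub>a (Idn C X \<otimes>\<^sub>a k)) =
      (Idn C (X' \<otimes>\<^sub>o X) \<otimes>\<^sub>a k) \<cdot> inv_arr C (Assoc C X' X B)"
    using Assoc_inv_natural[OF Idn_hom Idn_hom k, of X' X] by simp
  have n2: "(e \<otimes>\<^sub>a Idn C B') \<cdot> (Idn C (X' \<otimes>\<^sub>o X) \<otimes>\<^sub>a k) = (Idn C (Unit C) \<otimes>\<^sub>a k) \<cdot> (e \<otimes>\<^sub>a Idn C B)"
    using k' B by (simp add: tar_Comp)
  have "unhat B' ((Idn C X \<otimes>\<^sub>a k) \<cdot> h) = Lunit C B' \<cdot> (e \<otimes>\<^sub>a Idn C B') \<cdot> inv_arr C (Assoc C X' X B') \<cdot>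
      (Idn C X' \<otimes>\<^sub>a (Idn C X \<otimes>\<^sub>a k)) \<cdot> (Idn C X' \<otimes>\<^sub>a h)"
    using B k' h' by (simp add: unhat_def tar_Comp_right)
  also have "\<dots> = Lunit C B' \<cdot> (e \<otimes>\<^sub>a Idn C B') \<cdot> (Idn C (X' \<otimes>\<^sub>o X) \<otimes>\<^sub>a k) \<cdot>
      inv_arr C (Assoc C X' X B) \<cdot> (Idn C X' \<otimes>\<^sub>a h)"
    using B k' h' by (simp add: Comp_eq_chain[OF n1])
  also have "\<dots> = Lunit C B' \<cdot> (Idn C (Unit C) \<otimes>\<^sub>a k) \<cdot> (e \<otimes>\<^sub>a Idn C B) \<cdot>
      inv_arr C (Assoc C X' X B) \<cdot> (Idn C X' \<otimes>\<^sub>a h)"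
    using B k' h' by (simp add: Comp_eq_chain[OF n2])
  also have "\<dots> = k \<cdot> unhat B h"
    using B k' h' by (simp add: unhat_def Comp_eq_chain[OF Lunit_natural[OF k]])
  finally show ?thesis .
qed

lemma unhat_Comp_right:
  assumes B: "B \<in> Obj C" and h: "h \<in> homs C A (X \<otimes>\<^sub>o B)" and f: "f \<in> homs C A' A"
  shows "unhat B (h \<cdot> f) = unhat B h \<cdot> (Idn C X' \<otimes>\<^sub>a f)"
  using assms by (simp add: unhat_def homs_iff tar_Comp_right)

text \<open>A triangle identity of the adjunction. The pentagon and the naturality of the associator
  collect all factors into the first zigzag identity tensored with \<open>B\<close>; the unit
  constraints are absorbed by the triangle axiom and by \<open>Lunit_tensor\<close>.\<close>

lemma hat_unhat_Idn:
  assumes B: "B \<in> Obj C"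
  shows "hat (X \<otimes>\<^sub>o B) (unhat B (Idn C (X \<otimes>\<^sub>o B))) = Idn C (X \<otimes>\<^sub>o B)"
proof -
  let ?a = "Assoc C" and ?b = "\<lambda>X Y Z. inv_arr C (Assoc C X Y Z)"
  \<comment> \<open>The pentagon for \<open>X, X', X, B\<close>, solved for the two associators met
    in the composite.\<close>
  have p: "(Idn C X \<otimes>\<^sub>a ?b X' X B) \<cdot> ?a X X' (X \<otimes>\<^sub>o B) =
      ?a X (X' \<otimes>\<^sub>o X) B \<cdot> (?a X X' X \<otimes>\<^sub>a Idn C B) \<cdot> ?b (X \<otimes>\<^sub>o X') X B"
  proof -
    have "(Idn C X \<otimes>\<^sub>a ?b X' X B) \<cdot> ?a X X' (X \<otimes>\<^sub>o B) =
        (Idn C X \<otimes>\<^sub>a ?b X' X B) \<cdot> (?a X X' (X \<otimes>\<^sub>o B) \<cdot> ?a (X \<otimes>\<^sub>o X') X B) \<cdot> ?b (X \<otimes>\<^sub>o X') X B"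
      using B by simp
    also have "\<dots> = (Idn C X \<otimes>\<^sub>a ?b X' X B) \<cdot> (Idn C X \<otimes>\<^sub>a ?a X' X B) \<cdot> ?a X (X' \<otimes>\<^sub>o X) B \<cdot>
        (?a X X' X \<otimes>\<^sub>a Idn C B) \<cdot> ?b (X \<otimes>\<^sub>o X') X B"
      using pentagon[of X X' X B, symmetric] B by simp
    also have "\<dots> = ((Idn C X \<otimes>\<^sub>a ?b X' X B) \<cdot> (Idn C X \<otimes>\<^sub>a ?a X' X B)) \<cdot> ?a X (X' \<otimes>\<^sub>o X) B \<cdot>
        (?a X X' X \<otimes>\<^sub>a Idn C B) \<cdot> ?b (X \<otimes>\<^sub>o X') X B"
      using B by simp
    also have "(Idn C X \<otimes>\<^sub>a ?b X' X B) \<cdot> (Idn C X \<otimes>\<^sub>a ?a X' X B) = Idn C (X \<otimes>\<^sub>o (X' \<otimes>\<^sub>o X) \<otimes>\<^sub>o B)"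
      using B by (simp add: tar_Comp)
    finally show ?thesis using B by simp
  qed
  have n1: "?b (X \<otimes>\<^sub>o X') X B \<cdot> (c \<otimes>\<^sub>a Idn C (X \<otimes>\<^sub>o B)) = ((c \<otimes>\<^sub>a Idn C X) \<otimes>\<^sub>a Idn C B) \<cdot> ?b (Unit C) X B"
    using Assoc_inv_natural[of c "Unit C" "X \<otimes>\<^sub>o X'" "Idn C X" X X "Idn C B" B B] B by (simp add: homs_iff)
  have n2: "?b (Unit C) X B \<cdot> inv_arr C (Lunit C (X \<otimes>\<^sub>o B)) = inv_arr C (Lunit C X) \<otimes>\<^sub>a Idn C B"
  proof -
    have "?b (Unit C) X B \<cdot> inv_arr C (Lunit C (X \<otimes>\<^sub>o B)) =
        (?b (Unit C) X B \<cdot> inv_arr C (Lunit C (X \<otimes>\<^sub>o B))) \<cdot> ((Lunit C X \<otimes>\<^sub>a Idn C B) \<cdot>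
        (inv_arr C (Lunit C X) \<otimes>\<^sub>a Idn C B))"
      using B by (simp add: tar_Comp)
    also have "\<dots> = inv_arr C (Lunit C X) \<otimes>\<^sub>a Idn C B"
      using B by (simp add: Lunit_tensor[symmetric])
    finally show ?thesis .
  qed
  have n3: "(Idn C X \<otimes>\<^sub>a (e \<otimes>\<^sub>a Idn C B)) \<cdot> ?a X (X' \<otimes>\<^sub>o X) B = ?a X (Unit C) B \<cdot> ((Idn C X \<otimes>\<^sub>a e) \<otimes>\<^sub>a Idn C B)"
    using Assoc_natural[of "Idn C X" X X e "X' \<otimes>\<^sub>o X" "Unit C" "Idn C B" B B] B by (simp add: homs_iff)
  have n4: "(Idn C X \<otimes>\<^sub>a Lunit C B) \<cdot> ?a X (Unit C) B = Runit C X \<otimes>\<^sub>a Idn C B"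
    using triangle B by simp
  have "hat (X \<otimes>\<^sub>o B) (unhat B (Idn C (X \<otimes>\<^sub>o B))) = (Idn C X \<otimes>\<^sub>a Lunit C B) \<cdot> (Idn C X \<otimes>\<^sub>a (e \<otimes>\<^sub>a Idn C B)) \<cdot>
      (Idn C X \<otimes>\<^sub>a ?b X' X B) \<cdot> ?a X X' (X \<otimes>\<^sub>o B) \<cdot> (c \<otimes>\<^sub>a Idn C (X \<otimes>\<^sub>o B)) \<cdot> inv_arr C (Lunit C (X \<otimes>\<^sub>o B))"
    using B by (simp add: hat_def unhat_def tar_Comp_right)
  also have "\<dots> = (Idn C X \<otimes>\<^sub>a Lunit C B) \<cdot> (Idn C X \<otimes>\<^sub>a (e \<otimes>\<^sub>a Idn C B)) \<cdot> ?a X (X' \<otimes>\<^sub>o X) B \<cdot>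
      (?a X X' X \<otimes>\<^sub>a Idn C B) \<cdot> ?b (X \<otimes>\<^sub>o X') X B \<cdot> (c \<otimes>\<^sub>a Idn C (X \<otimes>\<^sub>o B)) \<cdot> inv_arr C (Lunit C (X \<otimes>\<^sub>o B))"
    using B by (simp add: Comp_eq_chain[OF p])
  also have "\<dots> = (Idn C X \<otimes>\<^sub>a Lunit C B) \<cdot> (Idn C X \<otimes>\<^sub>a (e \<otimes>\<^sub>a Idn C B)) \<cdot> ?a X (X' \<otimes>\<^sub>o X) B \<cdot>
      (?a X X' X \<otimes>\<^sub>a Idn C B) \<cdot> ((c \<otimes>\<^sub>a Idn C X) \<otimes>\<^sub>a Idn C B) \<cdot> (inv_arr C (Lunit C X) \<otimes>\<^sub>a Idn C B)"
    using B by (simp add: Comp_eq_chain[OF n1] n2)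
  also have "\<dots> = (Idn C X \<otimes>\<^sub>a Lunit C B) \<cdot> ?a X (Unit C) B \<cdot> ((Idn C X \<otimes>\<^sub>a e) \<otimes>\<^sub>a Idn C B) \<cdot>
      (?a X X' X \<otimes>\<^sub>a Idn C B) \<cdot> ((c \<otimes>\<^sub>a Idn C X) \<otimes>\<^sub>a Idn C B) \<cdot> (inv_arr C (Lunit C X) \<otimes>\<^sub>a Idn C B)"
    using B by (simp add: Comp_eq_chain[OF n3])
  also have "\<dots> = (Runit C X \<otimes>\<^sub>a Idn C B) \<cdot> ((Idn C X \<otimes>\<^sub>a e) \<otimes>\<^sub>a Idn C B) \<cdot>
      (?a X X' X \<otimes>\<^sub>a Idn C B) \<cdot> ((c \<otimes>\<^sub>a Idn C X) \<otimes>\<^sub>a Idn C B) \<cdot> (inv_arr C (Lunit C X) \<otimes>\<^sub>a Idn C B)"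
    using B by (simp add: Comp_eq_chain[OF n4])
  also have "\<dots> = (Runit C X \<cdot> (Idn C X \<otimes>\<^sub>a e) \<cdot> ?a X X' X \<cdot> (c \<otimes>\<^sub>a Idn C X) \<cdot> inv_arr C (Lunit C X)) \<otimes>\<^sub>a Idn C B"
    using B by (simp add: tar_Comp_left)
  also have "\<dots> = Idn C (X \<otimes>\<^sub>o B)" using B by (simp add: zigzag)
  finally show ?thesis .
qed

text \<open>The other triangle identity, reduced in the same way to the second zigzag identity
  tensored with \<open>A\<close>.\<close>

lemma unhat_hat_Idn:
  assumes A: "A \<in> Obj C"
  shows "unhat (X' \<otimes>\<^sub>o A) (hat A (Idn C (X' \<otimes>\<^sub>o A))) = Idn C (X' \<otimes>\<^sub>o A)"
proof -
  let ?a = "Assoc C" and ?b = "\<lambda>X Y Z. inv_arr C (Assoc C X Y Z)"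
  have p: "?b X' X (X' \<otimes>\<^sub>o A) \<cdot> (Idn C X' \<otimes>\<^sub>a ?a X X' A) \<cdot> ?a X' (X \<otimes>\<^sub>o X') A =
      ?a (X' \<otimes>\<^sub>o X) X' A \<cdot> (?b X' X X' \<otimes>\<^sub>a Idn C A)"
  proof -
    have "?b X' X (X' \<otimes>\<^sub>o A) \<cdot> (Idn C X' \<otimes>\<^sub>a ?a X X' A) \<cdot> ?a X' (X \<otimes>\<^sub>o X') A =
        ?b X' X (X' \<otimes>\<^sub>o A) \<cdot> ((Idn C X' \<otimes>\<^sub>a ?a X X' A) \<cdot> ?a X' (X \<otimes>\<^sub>o X') A \<cdot> (?a X' X X' \<otimes>\<^sub>a Idn C A)) \<cdot>
        (?b X' X X' \<otimes>\<^sub>a Idn C A)"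
      using A by (simp add: tar_Comp)
    also have "\<dots> = ?a (X' \<otimes>\<^sub>o X) X' A \<cdot> (?b X' X X' \<otimes>\<^sub>a Idn C A)"
      using pentagon[of X' X X' A] A by (simp del: Comp_assoc_Arr) simp
    finally show ?thesis .
  qed
  have n1: "(Idn C X' \<otimes>\<^sub>a (c \<otimes>\<^sub>a Idn C A)) \<cdot> ?a X' (Unit C) A = ?a X' (X \<otimes>\<^sub>o X') A \<cdot> ((Idn C X' \<otimes>\<^sub>a c) \<otimes>\<^sub>a Idn C A)"
    using Assoc_natural[of "Idn C X'" X' X' c "Unit C" "X \<otimes>\<^sub>o X'" "Idn C A" A A] A by (simp add: homs_iff)
  have n2: "Idn C X' \<otimes>\<^sub>a inv_arr C (Lunit C A) = ?a X' (Unit C) A \<cdot> (inv_arr C (Runit C X') \<otimes>\<^sub>a Idn C A)"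
  proof -
    have "Idn C X' \<otimes>\<^sub>a inv_arr C (Lunit C A) = (Idn C X' \<otimes>\<^sub>a inv_arr C (Lunit C A)) \<cdot>
        (Runit C X' \<otimes>\<^sub>a Idn C A) \<cdot> (inv_arr C (Runit C X') \<otimes>\<^sub>a Idn C A)"
      using A by (simp add: tar_Comp)
    also have "\<dots> = ((Idn C X' \<otimes>\<^sub>a inv_arr C (Lunit C A)) \<cdot> (Idn C X' \<otimes>\<^sub>a Lunit C A)) \<cdot> ?a X' (Unit C) A \<cdot>
        (inv_arr C (Runit C X') \<otimes>\<^sub>a Idn C A)"
      using triangle[of X' A, symmetric] A by simp
    also have "(Idn C X' \<otimes>\<^sub>a inv_arr C (Lunit C A)) \<cdot> (Idn C X' \<otimes>\<^sub>a Lunit C A) = Idn C (X' \<otimes>\<^sub>o Unit C \<otimes>\<^sub>o A)"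
      using A by (simp add: tar_Comp)
    finally show ?thesis using A by simp
  qed
  have n3: "(e \<otimes>\<^sub>a Idn C (X' \<otimes>\<^sub>o A)) \<cdot> ?a (X' \<otimes>\<^sub>o X) X' A = ?a (Unit C) X' A \<cdot> ((e \<otimes>\<^sub>a Idn C X') \<otimes>\<^sub>a Idn C A)"
    using Assoc_natural[of e "X' \<otimes>\<^sub>o X" "Unit C" "Idn C X'" X' X' "Idn C A" A A] A by (simp add: homs_iff)
  have "unhat (X' \<otimes>\<^sub>o A) (hat A (Idn C (X' \<otimes>\<^sub>o A))) = Lunit C (X' \<otimes>\<^sub>o A) \<cdot> (e \<otimes>\<^sub>a Idn C (X' \<otimes>\<^sub>o A)) \<cdot>
      ?b X' X (X' \<otimes>\<^sub>o A) \<cdot> (Idn C X' \<otimes>\<^sub>a ?a X X' A) \<cdot> (Idn C X' \<otimes>\<^sub>a (c \<otimes>\<^sub>a Idn C A)) \<cdot>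
      (Idn C X' \<otimes>\<^sub>a inv_arr C (Lunit C A))"
    using A by (simp add: hat_def unhat_def tar_Comp_right)
  also have "\<dots> = Lunit C (X' \<otimes>\<^sub>o A) \<cdot> (e \<otimes>\<^sub>a Idn C (X' \<otimes>\<^sub>o A)) \<cdot>
      (?b X' X (X' \<otimes>\<^sub>o A) \<cdot> (Idn C X' \<otimes>\<^sub>a ?a X X' A) \<cdot> ?a X' (X \<otimes>\<^sub>o X') A) \<cdot> ((Idn C X' \<otimes>\<^sub>a c) \<otimes>\<^sub>a Idn C A) \<cdot>
      (inv_arr C (Runit C X') \<otimes>\<^sub>a Idn C A)"
    using A by (simp add: n2 Comp_eq_chain[OF n1])
  also have "\<dots> = Lunit C (X' \<otimes>\<^sub>o A) \<cdot> (e \<otimes>\<^sub>a Idn C (X' \<otimes>\<^sub>o A)) \<cdot>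
      (?a (X' \<otimes>\<^sub>o X) X' A \<cdot> (?b X' X X' \<otimes>\<^sub>a Idn C A)) \<cdot> ((Idn C X' \<otimes>\<^sub>a c) \<otimes>\<^sub>a Idn C A) \<cdot>
      (inv_arr C (Runit C X') \<otimes>\<^sub>a Idn C A)"
    by (simp only: p)
  also have "\<dots> = Lunit C (X' \<otimes>\<^sub>o A) \<cdot> ?a (Unit C) X' A \<cdot> ((e \<otimes>\<^sub>a Idn C X') \<otimes>\<^sub>a Idn C A) \<cdot>
      (?b X' X X' \<otimes>\<^sub>a Idn C A) \<cdot> ((Idn C X' \<otimes>\<^sub>a c) \<otimes>\<^sub>a Idn C A) \<cdot> (inv_arr C (Runit C X') \<otimes>\<^sub>a Idn C A)"
    using A by (simp add: Comp_eq_chain[OF n3])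
  also have "\<dots> = (Lunit C X' \<otimes>\<^sub>a Idn C A) \<cdot> ((e \<otimes>\<^sub>a Idn C X') \<otimes>\<^sub>a Idn C A) \<cdot>
      (?b X' X X' \<otimes>\<^sub>a Idn C A) \<cdot> ((Idn C X' \<otimes>\<^sub>a c) \<otimes>\<^sub>a Idn C A) \<cdot> (inv_arr C (Runit C X') \<otimes>\<^sub>a Idn C A)"
    using A by (simp add: Comp_eq_chain[OF Lunit_tensor[OF _ A]])
  also have "\<dots> = (Lunit C X' \<cdot> (e \<otimes>\<^sub>a Idn C X') \<cdot> ?b X' X X' \<cdot> (Idn C X' \<otimes>\<^sub>a c) \<cdot> inv_arr C (Runit C X')) \<otimes>\<^sub>a Idn C A"
    using A by (simp add: tar_Comp_left)
  also have "\<dots> = Idn C (X' \<otimes>\<^sub>o A)" using A by (simp add: zigzag)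
  finally show ?thesis .
qed

text \<open>Naturality reduces the claim to the identity arrow, since \<open>h\<close> is the
  identity precomposed with \<open>h\<close>.\<close>

lemma hat_unhat:
  assumes B: "B \<in> Obj C" and h: "h \<in> homs C A (X \<otimes>\<^sub>o B)"
  shows "hat A (unhat B h) = h"
proof -
  have XB: "X \<otimes>\<^sub>o B \<in> Obj C" using B by simp
  have "unhat B h = unhat B (Idn C (X \<otimes>\<^sub>o B)) \<cdot> (Idn C X' \<otimes>\<^sub>a h)"
    using unhat_Comp_right[OF B Idn_hom[OF XB] h] Idn_Comp[OF h] by simp
  then show ?thesis
    using hat_Comp_right[OF unhat_hom[OF B Idn_hom[OF XB]] h] hat_unhat_Idn[OF B] Idn_Comp[OF h] by simp
qed

lemma unhat_hat:
  assumes A: "A \<in> Obj C" and g: "g \<in> homs C (X' \<otimes>\<^sub>o A) B"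
  shows "unhat B (hat A g) = g"
proof -
  have XA: "X' \<otimes>\<^sub>o A \<in> Obj C" using A by simp
  have "hat A g = (Idn C X \<otimes>\<^sub>a g) \<cdot> hat A (Idn C (X' \<otimes>\<^sub>o A))"
    using hat_Comp_left[OF A Idn_hom[OF XA] g] Comp_Idn[OF g] by simp
  then show ?thesis
    using unhat_Comp_left[OF g hat_hom[OF A Idn_hom[OF XA]]] unhat_hat_Idn[OF A] Comp_Idn[OF g] by simp
qed

end

end


section \<open>The dual functor\<close>

locale linear_monoidal_category = linear_category C + monoidal_category C
  for C :: "('o, 'm, 'k :: field, 'z) moncat_scheme" (structure) +
  assumes Tens_bilinear: "bilinear_functor C C C (Tens C)"
begin

lemma Tens_linear_left:
  assumes "f \<in> homs C X X'" "f' \<in> homs C X X'" "Y \<in> Obj C"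
  shows "add_arr C f f' \<otimes>\<^sub>a Idn C Y = add_arr C (f \<otimes>\<^sub>a Idn C Y) (f' \<otimes>\<^sub>a Idn C Y)"
    and "scale_arr C a f \<otimes>\<^sub>a Idn C Y = scale_arr C a (f \<otimes>\<^sub>a Idn C Y)"
proof -
  have "linear_functor C C (fix_right C (Tens C) Y)"
    using Tens_bilinear assms(3) by (simp add: bilinear_functor_def)
  from linear_functor_add[OF this assms(1,2)] linear_functor_scale[OF this assms(1), of a]
  show "add_arr C f f' \<otimes>\<^sub>a Idn C Y = add_arr C (f \<otimes>\<^sub>a Idn C Y) (f' \<otimes>\<^sub>a Idn C Y)"
    "scale_arr C a f \<otimes>\<^sub>a Idn C Y = scale_arr C a (f \<otimes>\<^sub>a Idn C Y)"
    by (simp_all add: fix_right_def)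
qed

lemma Tens_linear_right:
  assumes "f \<in> homs C X X'" "f' \<in> homs C X X'" "Y \<in> Obj C"
  shows "Idn C Y \<otimes>\<^sub>a add_arr C f f' = add_arr C (Idn C Y \<otimes>\<^sub>a f) (Idn C Y \<otimes>\<^sub>a f')"
    and "Idn C Y \<otimes>\<^sub>a scale_arr C a f = scale_arr C a (Idn C Y \<otimes>\<^sub>a f)"
proof -
  have "linear_functor C C (fix_left C (Tens C) Y)"
    using Tens_bilinear assms(3) by (simp add: bilinear_functor_def)
  from linear_functor_add[OF this assms(1,2)] linear_functor_scale[OF this assms(1), of a]
  show "Idn C Y \<otimes>\<^sub>a add_arr C f f' = add_arr C (Idn C Y \<otimes>\<^sub>a f) (Idn C Y \<otimes>\<^sub>a f')"
    "Idn C Y \<otimes>\<^sub>a scale_arr C a f = scale_arr C a (Idn C Y \<otimes>\<^sub>a f)"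
    by (simp_all add: fix_left_def)
qed

lemma Tens_zero_right:
  assumes "X \<in> Obj C" "X' \<in> Obj C" "Y \<in> Obj C"
  shows "Idn C Y \<otimes>\<^sub>a zero_arr C X X' = zero_arr C (Y \<otimes>\<^sub>o X) (Y \<otimes>\<^sub>o X')"
proof -
  have z: "zero_arr C X X' \<in> homs C X X'" using assms by (simp add: zero_hom)
  have "Idn C Y \<otimes>\<^sub>a zero_arr C X X' \<in> homs C (Y \<otimes>\<^sub>o X) (Y \<otimes>\<^sub>o X')"
    using tar_hom[OF Idn_hom[OF assms(3)] z] .
  then show ?thesis
    using Tens_linear_right(2)[OF z z assms(3), of 0] scale_zero[OF z] scale_zero by metis
qed

text \<open>As \<open>X\<close> is a left dual of \<open>Y\<close>, the functor \<open>X \<otimes> -\<close> has the right adjoint \<open>Y \<otimes> -\<close>.\<close>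

lemma tensor_cokernel:
  assumes dual: "is_left_dual C Y X e c" and q: "is_cokernel C q f"
  shows "is_cokernel C (Idn C X \<otimes>\<^sub>a q) (Idn C X \<otimes>\<^sub>a f)"
proof -
  let ?hat = "hat Y X c" and ?unhat = "unhat Y X e"
  have XO: "X \<in> Obj C" "Y \<in> Obj C" using dual_Obj[OF dual] by simp_all
  define A B Z where "A = Dom C f" and "B = Cod C f" and "Z = Cod C q"
  have f: "f \<in> homs C A B" and qh: "q \<in> homs C B Z" and qf: "q \<cdot> f = zero_arr C A Z"
    and univ: "\<And>W g. g \<in> homs C B W \<Longrightarrow> g \<cdot> f = zero_arr C A W \<Longrightarrow>
      \<exists>!h. h \<in> homs C Z W \<and> h \<cdot> q = g"
    using q by (auto simp: is_cokernel_def homs_iff A_def B_def Z_def)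
  have O: "A \<in> Obj C" "B \<in> Obj C" "Z \<in> Obj C" using f qh homs_Obj by blast+
  have Xf: "Idn C X \<otimes>\<^sub>a f \<in> homs C (X \<otimes>\<^sub>o A) (X \<otimes>\<^sub>o B)" and Xq: "Idn C X \<otimes>\<^sub>a q \<in> homs C (X \<otimes>\<^sub>o B) (X \<otimes>\<^sub>o Z)"
    using tar_hom[OF Idn_hom[OF XO(1)]] f qh by blast+
  have comp0: "(Idn C X \<otimes>\<^sub>a q) \<cdot> (Idn C X \<otimes>\<^sub>a f) = zero_arr C (X \<otimes>\<^sub>o A) (X \<otimes>\<^sub>o Z)"
    using tar_Comp_right[of f q X] f qh qf XO O by (simp add: homs_iff Tens_zero_right)
  \<comment> \<open>Factorisations of \<open>g\<close> through the tensored \<open>q\<close>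
    correspond under transposition to factorisations of the transpose of \<open>g\<close> through
    \<open>q\<close>; this gives both existence and uniqueness.\<close>
  have ex: "\<exists>!h. h \<in> homs C (X \<otimes>\<^sub>o Z) W \<and> h \<cdot> (Idn C X \<otimes>\<^sub>a q) = g"
    if g: "g \<in> homs C (X \<otimes>\<^sub>o B) W" and gf: "g \<cdot> (Idn C X \<otimes>\<^sub>a f) = zero_arr C (X \<otimes>\<^sub>o A) W" for g W
  proof -
    have W: "W \<in> Obj C" using g homs_Obj by blast
    have XA: "X \<otimes>\<^sub>o A \<in> Obj C" using XO O by simp
    have z: "zero_arr C (X \<otimes>\<^sub>o A) W \<in> homs C (X \<otimes>\<^sub>o A) W" "zero_arr C W W \<in> homs C W W"
      using zero_hom XA W by blast+
    \<comment> \<open>That transposition preserves zero is drawn from naturality alone: a zero arrow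
      into \<open>W\<close> factors through the zero endomorphism of \<open>W\<close>.\<close>
    have "?hat A (zero_arr C (X \<otimes>\<^sub>o A) W) = ?hat A (zero_arr C W W \<cdot> zero_arr C (X \<otimes>\<^sub>o A) W)"
      using Comp_zero_left[OF z(1) W] by simp
    also have "\<dots> = zero_arr C (Y \<otimes>\<^sub>o W) (Y \<otimes>\<^sub>o W) \<cdot> ?hat A (zero_arr C (X \<otimes>\<^sub>o A) W)"
      using hat_Comp_left[OF dual O(1) z] Tens_zero_right[OF W W XO(2)] by simp
    also have "\<dots> = zero_arr C A (Y \<otimes>\<^sub>o W)"
      using Comp_zero_left[OF hat_hom[OF dual O(1) z(1)]] XO W by simp
    finally have hat0: "?hat A (zero_arr C (X \<otimes>\<^sub>o A) W) = zero_arr C A (Y \<otimes>\<^sub>o W)" .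
    have "?hat B g \<cdot> f = zero_arr C A (Y \<otimes>\<^sub>o W)"
      using hat_Comp_right[OF dual g f] gf hat0 by simp
    then obtain h where h: "h \<in> homs C Z (Y \<otimes>\<^sub>o W)" "h \<cdot> q = ?hat B g"
      and h_unique: "\<And>h'. h' \<in> homs C Z (Y \<otimes>\<^sub>o W) \<Longrightarrow> h' \<cdot> q = ?hat B g \<Longrightarrow> h' = h"
      using univ[OF hat_hom[OF dual O(2) g]] by blast
    show ?thesis
    proof (intro ex1I[of _ "?unhat W h"] conjI)
      show "?unhat W h \<in> homs C (X \<otimes>\<^sub>o Z) W" using unhat_hom[OF dual W h(1)] .
      show "?unhat W h \<cdot> (Idn C X \<otimes>\<^sub>a q) = g"
        using unhat_Comp_right[OF dual W h(1) qh] h(2) unhat_hat[OF dual O(2) g] by simp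
    next
      fix m assume m: "m \<in> homs C (X \<otimes>\<^sub>o Z) W \<and> m \<cdot> (Idn C X \<otimes>\<^sub>a q) = g"
      then have "?hat Z m \<cdot> q = ?hat B g"
        using hat_Comp_right[OF dual _ qh, of m W] by simp
      then have "?hat Z m = h" using h_unique hat_hom[OF dual O(3)] m by blast
      then show "m = ?unhat W h" using unhat_hat[OF dual O(3)] m by metis
    qed
  qed
  show ?thesis
    unfolding is_cokernel_def
    using f[unfolded homs_iff] qh[unfolded homs_iff] XO O comp0 by (simp add: ex)
qed

lemma tensor_right_exact:
  assumes "rigid C" and X: "X \<in> Obj C"
  shows "right_exact C C (fix_left C (Tens C) X)"
proof -
  obtain Y e c where "is_left_dual C Y X e c" using assms unfolding rigid_def by blast
  then show ?thesis
    using tensor_cokernel Tens_bilinear X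
    by (auto simp: right_exact_def bilinear_functor_def fix_left_def)
qed

section \<open>Functoriality and linearity of duality\<close>

context
  fixes \<delta> :: "('o, 'm) duality"
  assumes duality: "left_duality C \<delta>"
begin

lemma dual: "X \<in> Obj C \<Longrightarrow> is_left_dual C X (Dual \<delta> X) (Ev \<delta> X) (Coev \<delta> X)"
  using duality by (simp add: left_duality_def)

lemma Dual_Obj [simp]: "X \<in> Obj C \<Longrightarrow> Dual \<delta> X \<in> Obj C"
  using dual_Obj(2)[OF dual] .

lemma Coev_hom: "X \<in> Obj C \<Longrightarrow> Coev \<delta> X \<in> homs C (Unit C) (X \<otimes>\<^sub>o Dual \<delta> X)"
  using dual_Arr[OF dual] by (simp add: homs_iff)

text \<open>The second zigzag identity says that the inverse transpose of the coevaluation is the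
  right unit constraint. Transposing back identifies the coevaluation as the unit of the adjunction
  at the unit object.\<close>

lemma hat_Runit:
  assumes X: "X \<in> Obj C"
  shows "hat X (Dual \<delta> X) (Coev \<delta> X) (Unit C) (Runit C (Dual \<delta> X)) = Coev \<delta> X"
proof -
  let ?c = "Coev \<delta> X" and ?X' = "Dual \<delta> X"
  let ?u = "unhat X ?X' (Ev \<delta> X) ?X' ?c"
  have u: "?u \<in> homs C (?X' \<otimes>\<^sub>o Unit C) ?X'" using unhat_hom[OF dual[OF X] _ Coev_hom[OF X]] X by simp
  have "?u \<cdot> inv_arr C (Runit C ?X') = Idn C ?X'"
    using zigzag(2)[OF dual[OF X]] X dual_Arr[OF dual[OF X]] by (simp add: unhat_def[OF dual[OF X]])
  then have "(?u \<cdot> inv_arr C (Runit C ?X')) \<cdot> Runit C ?X' = Runit C ?X'" using X by simp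
  then have "?u = Runit C ?X'" using u X by (simp add: homs_iff)
  then show ?thesis using hat_unhat[OF dual[OF X] _ Coev_hom[OF X]] X by simp
qed

text \<open>Up to the right unit constraint, sending \<open>k\<close> to its composite with the
  coevaluation is transposition, hence injective. Identities between dual arrows are all reduced to
  this.\<close>

lemma Coev_cancel:
  assumes k: "k \<in> homs C (Dual \<delta> X) W" "l \<in> homs C (Dual \<delta> X) W" and X: "X \<in> Obj C"
    and eq: "(Idn C X \<otimes>\<^sub>a k) \<cdot> Coev \<delta> X = (Idn C X \<otimes>\<^sub>a l) \<cdot> Coev \<delta> X"
  shows "k = l"
proof -
  let ?r = "Runit C (Dual \<delta> X)"
  have r: "?r \<in> homs C (Dual \<delta> X \<otimes>\<^sub>o Unit C) (Dual \<delta> X)" using X by (simp add: Runit_hom)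
  have "hat X (Dual \<delta> X) (Coev \<delta> X) (Unit C) (k \<cdot> ?r) = hat X (Dual \<delta> X) (Coev \<delta> X) (Unit C) (l \<cdot> ?r)"
    using hat_Comp_left[OF dual[OF X] Unit_Obj r k(1)] hat_Comp_left[OF dual[OF X] Unit_Obj r k(2)]
      hat_Runit[OF X] eq by simp
  then have "k \<cdot> ?r = l \<cdot> ?r"
    using unhat_hat[OF dual[OF X] Unit_Obj] Comp_hom[OF r] k by metis
  then show ?thesis
    using iso_cancel_right[of ?r k W l] k X by simp
qed

lemma dual_arr_hom:
  assumes f: "f \<in> homs C X Y"
  shows "dual_arr C \<delta> f \<in> homs C (Dual \<delta> Y) (Dual \<delta> X)"
proof -
  have XY: "X \<in> Obj C" "Y \<in> Obj C" using f homs_Obj by blast+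
  show ?thesis
    using f XY dual_Arr[OF dual[OF XY(1)]] dual_Arr[OF dual[OF XY(2)]]
    by (simp add: dual_arr_def Let_def homs_iff)
qed

text \<open>Together with \<open>Coev_cancel\<close> this characterises the dual of
  \<open>f\<close>, so that its defining composite need not be unfolded again in the algebraic laws
  below.\<close>

lemma dual_arr_Coev:
  assumes f: "f \<in> homs C X Y"
  shows "(Idn C Y \<otimes>\<^sub>a dual_arr C \<delta> f) \<cdot> Coev \<delta> Y = (f \<otimes>\<^sub>a Idn C (Dual \<delta> X)) \<cdot> Coev \<delta> X"
proof -
  have XY: "X \<in> Obj C" "Y \<in> Obj C" using f homs_Obj by blast+
  have f': "f \<in> Arr C" "Dom C f = X" "Cod C f = Y" using f by (simp_all add: homs_iff)
  let ?r = "Runit C (Dual \<delta> Y)" and ?h = "(f \<otimes>\<^sub>a Idn C (Dual \<delta> X)) \<cdot> Coev \<delta> X"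
  have r: "?r \<in> homs C (Dual \<delta> Y \<otimes>\<^sub>o Unit C) (Dual \<delta> Y)" using XY by (simp add: Runit_hom)
  have h: "?h \<in> homs C (Unit C) (Y \<otimes>\<^sub>o Dual \<delta> X)"
    using Comp_hom[OF Coev_hom[OF XY(1)] tar_hom[OF f Idn_hom]] XY by simp
  \<comment> \<open>Cancelling the inverse of \<open>?r\<close> at the end of the defining composite
    exhibits what remains as an inverse transpose.\<close>
  have "dual_arr C \<delta> f \<cdot> ?r = unhat Y (Dual \<delta> Y) (Ev \<delta> Y) (Dual \<delta> X) ?h"
    using f' XY dual_Arr[OF dual[OF XY(1)]] dual_Arr[OF dual[OF XY(2)]]
    by (simp add: dual_arr_def Let_def unhat_def[OF dual[OF XY(2)]] tar_Comp_right)
  then have "hat Y (Dual \<delta> Y) (Coev \<delta> Y) (Unit C) (dual_arr C \<delta> f \<cdot> ?r) = ?h"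
    using hat_unhat[OF dual[OF XY(2)] Dual_Obj[OF XY(1)] h] by simp
  then show ?thesis
    using hat_Comp_left[OF dual[OF XY(2)] Unit_Obj r dual_arr_hom[OF f]] hat_Runit[OF XY(2)] by simp
qed

lemma dual_arr_Idn:
  assumes X: "X \<in> Obj C"
  shows "dual_arr C \<delta> (Idn C X) = Idn C (Dual \<delta> X)"
proof (rule Coev_cancel[OF dual_arr_hom[OF Idn_hom[OF X]] Idn_hom X])
  show "(Idn C X \<otimes>\<^sub>a dual_arr C \<delta> (Idn C X)) \<cdot> Coev \<delta> X = (Idn C X \<otimes>\<^sub>a Idn C (Dual \<delta> X)) \<cdot> Coev \<delta> X"
    using dual_arr_Coev[OF Idn_hom[OF X]] .
qed (use X in simp)

text \<open>The dual of \<open>g\<close> is traded for \<open>g\<close> at the coevaluation of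
  \<open>Z\<close>. Interchange then brings the dual of \<open>f\<close> to the coevaluation of
  \<open>Y\<close>, where it is traded for \<open>f\<close>.\<close>

lemma dual_arr_Comp:
  assumes f: "f \<in> homs C X Y" and g: "g \<in> homs C Y Z"
  shows "dual_arr C \<delta> (g \<cdot> f) = dual_arr C \<delta> f \<cdot> dual_arr C \<delta> g"
proof (rule Coev_cancel)
  have O: "X \<in> Obj C" "Y \<in> Obj C" "Z \<in> Obj C" using f g homs_Obj by blast+
  show "Z \<in> Obj C" by fact
  show "dual_arr C \<delta> (g \<cdot> f) \<in> homs C (Dual \<delta> Z) (Dual \<delta> X)"
    using dual_arr_hom[OF Comp_hom[OF f g]] .
  show "dual_arr C \<delta> f \<cdot> dual_arr C \<delta> g \<in> homs C (Dual \<delta> Z) (Dual \<delta> X)"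
    using Comp_hom[OF dual_arr_hom[OF g] dual_arr_hom[OF f]] .
  note typing = f[unfolded homs_iff] g[unfolded homs_iff] dual_arr_hom[OF f, unfolded homs_iff]
    dual_arr_hom[OF g, unfolded homs_iff] Coev_hom[OF O(1), unfolded homs_iff]
    Coev_hom[OF O(2), unfolded homs_iff] Coev_hom[OF O(3), unfolded homs_iff]
  have "(Idn C Z \<otimes>\<^sub>a (dual_arr C \<delta> f \<cdot> dual_arr C \<delta> g)) \<cdot> Coev \<delta> Z =
      (Idn C Z \<otimes>\<^sub>a dual_arr C \<delta> f) \<cdot> (Idn C Z \<otimes>\<^sub>a dual_arr C \<delta> g) \<cdot> Coev \<delta> Z"
    using typing O by (simp add: tar_Comp_right)
  also have "\<dots> = (Idn C Z \<otimes>\<^sub>a dual_arr C \<delta> f) \<cdot> (g \<otimes>\<^sub>a Idn C (Dual \<delta> Y)) \<cdot> Coev \<delta> Y"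
    using dual_arr_Coev[OF g] by simp
  also have "\<dots> = ((Idn C Z \<otimes>\<^sub>a dual_arr C \<delta> f) \<cdot> (g \<otimes>\<^sub>a Idn C (Dual \<delta> Y))) \<cdot> Coev \<delta> Y"
    using typing O by simp
  also have "\<dots> = ((g \<otimes>\<^sub>a Idn C (Dual \<delta> X)) \<cdot> (Idn C Y \<otimes>\<^sub>a dual_arr C \<delta> f)) \<cdot> Coev \<delta> Y"
    using tar_interchange[OF g dual_arr_hom[OF f]] by simp
  also have "\<dots> = (g \<otimes>\<^sub>a Idn C (Dual \<delta> X)) \<cdot> (f \<otimes>\<^sub>a Idn C (Dual \<delta> X)) \<cdot> Coev \<delta> X"
    using typing O dual_arr_Coev[OF f] by simp
  also have "\<dots> = ((g \<cdot> f) \<otimes>\<^sub>a Idn C (Dual \<delta> X)) \<cdot> Coev \<delta> X"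
    using typing O by (simp add: tar_Comp_left)
  finally show "(Idn C Z \<otimes>\<^sub>a dual_arr C \<delta> (g \<cdot> f)) \<cdot> Coev \<delta> Z =
      (Idn C Z \<otimes>\<^sub>a (dual_arr C \<delta> f \<cdot> dual_arr C \<delta> g)) \<cdot> Coev \<delta> Z"
    using dual_arr_Coev[OF Comp_hom[OF f g]] by simp
qed

text \<open>The characterising equation is additive both in the arrow and in its dual.\<close>

lemma dual_arr_add:
  assumes f: "f \<in> homs C X Y" and g: "g \<in> homs C X Y"
  shows "dual_arr C \<delta> (add_arr C f g) = add_arr C (dual_arr C \<delta> f) (dual_arr C \<delta> g)"
proof (rule Coev_cancel)
  have O: "X \<in> Obj C" "Y \<in> Obj C" using f homs_Obj by blast+
  show "Y \<in> Obj C" by fact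
  show "dual_arr C \<delta> (add_arr C f g) \<in> homs C (Dual \<delta> Y) (Dual \<delta> X)"
    using dual_arr_hom[OF add_hom[OF f g]] .
  show "add_arr C (dual_arr C \<delta> f) (dual_arr C \<delta> g) \<in> homs C (Dual \<delta> Y) (Dual \<delta> X)"
    using add_hom[OF dual_arr_hom[OF f] dual_arr_hom[OF g]] .
  note t = tar_hom[OF Idn_hom[OF O(2)] dual_arr_hom[OF f]] tar_hom[OF Idn_hom[OF O(2)] dual_arr_hom[OF g]]
    tar_hom[OF f Idn_hom[OF Dual_Obj[OF O(1)]]] tar_hom[OF g Idn_hom[OF Dual_Obj[OF O(1)]]]
  show "(Idn C Y \<otimes>\<^sub>a dual_arr C \<delta> (add_arr C f g)) \<cdot> Coev \<delta> Y =
      (Idn C Y \<otimes>\<^sub>a add_arr C (dual_arr C \<delta> f) (dual_arr C \<delta> g)) \<cdot> Coev \<delta> Y"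
    unfolding dual_arr_Coev[OF add_hom[OF f g]]
    by (simp only: Tens_linear_left(1)[OF f g Dual_Obj[OF O(1)]]
        Tens_linear_right(1)[OF dual_arr_hom[OF f] dual_arr_hom[OF g] O(2)]
        Comp_add_left[OF Coev_hom[OF O(1)] t(3,4)] Comp_add_left[OF Coev_hom[OF O(2)] t(1,2)]
        dual_arr_Coev[OF f] dual_arr_Coev[OF g])
qed

lemma dual_arr_scale:
  assumes f: "f \<in> homs C X Y"
  shows "dual_arr C \<delta> (scale_arr C a f) = scale_arr C a (dual_arr C \<delta> f)"
proof (rule Coev_cancel)
  have O: "X \<in> Obj C" "Y \<in> Obj C" using f homs_Obj by blast+
  show "Y \<in> Obj C" by fact
  show "dual_arr C \<delta> (scale_arr C a f) \<in> homs C (Dual \<delta> Y) (Dual \<delta> X)"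
    using dual_arr_hom[OF scale_hom[OF f]] .
  show "scale_arr C a (dual_arr C \<delta> f) \<in> homs C (Dual \<delta> Y) (Dual \<delta> X)"
    using scale_hom[OF dual_arr_hom[OF f]] .
  note t = tar_hom[OF Idn_hom[OF O(2)] dual_arr_hom[OF f]] tar_hom[OF f Idn_hom[OF Dual_Obj[OF O(1)]]]
  show "(Idn C Y \<otimes>\<^sub>a dual_arr C \<delta> (scale_arr C a f)) \<cdot> Coev \<delta> Y =
      (Idn C Y \<otimes>\<^sub>a scale_arr C a (dual_arr C \<delta> f)) \<cdot> Coev \<delta> Y"
    unfolding dual_arr_Coev[OF scale_hom[OF f]]
    by (simp only: Tens_linear_left(2)[OF f f Dual_Obj[OF O(1)]]
        Tens_linear_right(2)[OF dual_arr_hom[OF f] dual_arr_hom[OF f] O(2)]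
        Comp_scale_left[OF Coev_hom[OF O(1)] t(2)] Comp_scale_left[OF Coev_hom[OF O(2)] t(1)]
        dual_arr_Coev[OF f])
qed

lemma dual_twist_functor:
  assumes F: "is_functor C C F" and B: "is_functor (prod_cat C C) D B"
  shows "is_functor (prod_cat (op_cat C) C) D (dual_twist C \<delta> F B)"
proof -
  have F': "far F (dual_arr C \<delta> f) \<in> homs C (fob F (Dual \<delta> Y)) (fob F (Dual \<delta> X))" if "f \<in> homs C X Y" for f X Y
    using functor_hom[OF F dual_arr_hom[OF that]] .
  have homs_prod: "p \<in> homs (prod_cat C C) P Q \<longleftrightarrow>
      fst p \<in> homs C (fst P) (fst Q) \<and> snd p \<in> homs C (snd P) (snd Q)" for p P Q
    by (cases p; cases P; cases Q) (auto simp: homs_iff homs_def prod_cat_def)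
  have homs_op: "p \<in> homs (prod_cat (op_cat C) C) P Q \<longleftrightarrow>
      fst p \<in> homs C (fst Q) (fst P) \<and> snd p \<in> homs C (snd P) (snd Q)" for p P Q
    by (cases p; cases P; cases Q) (auto simp: homs_iff homs_def prod_cat_def op_cat_def)
  show ?thesis
    unfolding is_functor_def
  proof (intro conjI ballI allI)
    fix P assume "P \<in> Obj (prod_cat (op_cat C) C)"
    then have P: "fst P \<in> Obj C" "snd P \<in> Obj C" by (auto simp: prod_cat_def op_cat_def)
    then have FP: "fob F (Dual \<delta> (fst P)) \<in> Obj C" using functor_Obj[OF F] by simp
    show "fob (dual_twist C \<delta> F B) P \<in> Obj D"
      using functor_Obj[OF B, of "(fob F (Dual \<delta> (fst P)), snd P)"] P FP
      by (simp add: dual_twist_def prod_cat_def split_beta)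
    show "far (dual_twist C \<delta> F B) (Idn (prod_cat (op_cat C) C) P) = Idn D (fob (dual_twist C \<delta> F B) P)"
      using functor_Idn[OF B, of "(fob F (Dual \<delta> (fst P)), snd P)"] P FP functor_Idn[OF F, of "Dual \<delta> (fst P)"]
      by (simp add: dual_twist_def prod_cat_def op_cat_def split_beta dual_arr_Idn)
  next
    fix P Q p assume "p \<in> homs (prod_cat (op_cat C) C) P Q"
    then have p: "fst p \<in> homs C (fst Q) (fst P)" "snd p \<in> homs C (snd P) (snd Q)" by (simp_all add: homs_op)
    show "far (dual_twist C \<delta> F B) p \<in> homs D (fob (dual_twist C \<delta> F B) P) (fob (dual_twist C \<delta> F B) Q)"
      using functor_hom[OF B, of "(far F (dual_arr C \<delta> (fst p)), snd p)"
          "(fob F (Dual \<delta> (fst P)), snd P)" "(fob F (Dual \<delta> (fst Q)), snd Q)"] F'[OF p(1)] p(2)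
      by (simp add: dual_twist_def split_beta homs_prod)
  next
    fix P Q R p q
    assume "p \<in> homs (prod_cat (op_cat C) C) P Q" "q \<in> homs (prod_cat (op_cat C) C) Q R"
    then have p: "fst p \<in> homs C (fst Q) (fst P)" "snd p \<in> homs C (snd P) (snd Q)"
      and q: "fst q \<in> homs C (fst R) (fst Q)" "snd q \<in> homs C (snd Q) (snd R)" by (simp_all add: homs_op)
    \<comment> \<open>Composition in \<open>op_cat C\<close> is reversed, and duality reverses it
      back, so \<open>F\<close> is applied covariantly.\<close>
    have "far F (dual_arr C \<delta> (fst p \<cdot> fst q)) = far F (dual_arr C \<delta> (fst q)) \<cdot> far F (dual_arr C \<delta> (fst p))"
      using functor_Comp[OF F, of "dual_arr C \<delta> (fst p)" "dual_arr C \<delta> (fst q)"]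
        dual_arr_hom[OF p(1)] dual_arr_hom[OF q(1)] dual_arr_Comp[OF q(1) p(1)] by (simp add: homs_iff)
    then show "far (dual_twist C \<delta> F B) (q \<cdot>\<^bsub>prod_cat (op_cat C) C\<^esub> p) =
        far (dual_twist C \<delta> F B) q \<cdot>\<^bsub>D\<^esub> far (dual_twist C \<delta> F B) p"
      using functor_Comp[OF B, of "(far F (dual_arr C \<delta> (fst p)), snd p)" "(far F (dual_arr C \<delta> (fst q)), snd q)"]
        F'[OF p(1)] F'[OF q(1)] p(2) q(2)
      by (simp add: dual_twist_def split_beta prod_cat_def op_cat_def homs_iff)
  qed
qed

end

end

section \<open>Application to the two integrands\<close>

text \<open>Stated for a general \<open>B\<close> so that the Deligne product and the tensor product
  are both instances. The first argument of \<open>B\<close> is the image under \<open>F\<close> of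
  a dual, so exactness is supplied at every object.\<close>

lemma dual_twist_coend_exists:
  fixes C :: "('o, 'm, 'k :: field, 'y) moncat_scheme" and D :: "('p, 'n, 'k, 'z) lincat_scheme"
  assumes C: "finite_tensor_category C" and \<delta>: "left_duality C \<delta>" and F: "linear_functor C C F"
    and D: "abelian_category D" and B: "bilinear_functor C C D B"
    and exact: "\<And>X. X \<in> Obj C \<Longrightarrow> right_exact C D (fix_left C B X)"
  shows "coend_exists C D (dual_twist C \<delta> F B)"
proof -
  interpret C: abelian_category C
    using C by (simp add: finite_tensor_category_def finite_abelian_category_def)
  interpret D: abelian_category D by fact
  interpret C: linear_monoidal_category C
    using C by (simp add: finite_tensor_category_def linear_monoidal_category_def
        linear_monoidal_category_axioms_def C.linear_category_axioms)
  have FF: "is_functor C C F" using F by (simp add: linear_functor_def)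
  have BF: "is_functor (prod_cat C C) D B" using B by (simp add: bilinear_functor_def)
  have FD: "fob F (Dual \<delta> X) \<in> Obj C" if "X \<in> Obj C" for X
    using functor_Obj[OF FF C.Dual_Obj[OF \<delta> that]] .
  have right: "linear_functor C D (fix_right C B Y)" if "Y \<in> Obj C" for Y
    using B that by (simp add: bilinear_functor_def)
  have left: "linear_functor C D (fix_left C B (fob F (Dual \<delta> Y)))" if "Y \<in> Obj C" for Y
    using B FD[OF that] by (simp add: bilinear_functor_def)
  \<comment> \<open>Duality and \<open>F\<close> preserve identities, so fixing the first variable
    of the twist amounts to fixing that of \<open>B\<close>.\<close>
  have S_left: "far (dual_twist C \<delta> F B) (Idn C Y, g) = far (fix_left C B (fob F (Dual \<delta> Y))) g"
    if "Y \<in> Obj C" for Y g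
    using that C.dual_arr_Idn[OF \<delta> that] functor_Idn[OF FF C.Dual_Obj[OF \<delta> that]]
    by (simp add: dual_twist_def fix_left_def)
  have S_right: "far (dual_twist C \<delta> F B) (f, Idn C Y) = far (fix_right C B Y) (far F (dual_arr C \<delta> f))" for f Y
    by (simp add: dual_twist_def fix_right_def)
  interpret linear_profunctor C D "dual_twist C \<delta> F B"
  proof
    show "is_functor (prod_cat (op_cat C) C) D (dual_twist C \<delta> F B)"
      by (rule C.dual_twist_functor[OF \<delta> FF BF])
  next
    fix f f' X X' Y
    assume f: "f \<in> homs C X X'" "f' \<in> homs C X X'" and Y: "Y \<in> Obj C"
    note d = C.dual_arr_hom[OF \<delta> f(1)] C.dual_arr_hom[OF \<delta> f(2)]
    show "far (dual_twist C \<delta> F B) (add_arr C f f', Idn C Y) =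
        add_arr D (far (dual_twist C \<delta> F B) (f, Idn C Y)) (far (dual_twist C \<delta> F B) (f', Idn C Y))"
      unfolding S_right C.dual_arr_add[OF \<delta> f] linear_functor_add[OF F d]
      by (rule linear_functor_add[OF right[OF Y] functor_hom[OF FF d(1)] functor_hom[OF FF d(2)]])
    show "far (dual_twist C \<delta> F B) (Idn C Y, add_arr C f f') =
        add_arr D (far (dual_twist C \<delta> F B) (Idn C Y, f)) (far (dual_twist C \<delta> F B) (Idn C Y, f'))"
      unfolding S_left[OF Y] by (rule linear_functor_add[OF left[OF Y] f])
  next
    fix f X X' Y c
    assume f: "f \<in> homs C X X'" and Y: "Y \<in> Obj C"
    note d = C.dual_arr_hom[OF \<delta> f]
    show "far (dual_twist C \<delta> F B) (scale_arr C c f, Idn C Y) = scale_arr D c (far (dual_twist C \<delta> F B) (f, Idn C Y))"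
      unfolding S_right C.dual_arr_scale[OF \<delta> f] linear_functor_scale[OF F d]
      by (rule linear_functor_scale[OF right[OF Y] functor_hom[OF FF d]])
    show "far (dual_twist C \<delta> F B) (Idn C Y, scale_arr C c f) = scale_arr D c (far (dual_twist C \<delta> F B) (Idn C Y, f))"
      unfolding S_left[OF Y] by (rule linear_functor_scale[OF left[OF Y] f])
  next
    fix q g Y assume q: "is_cokernel C q g" and Y: "Y \<in> Obj C"
    show "is_cokernel D (far (dual_twist C \<delta> F B) (Idn C Y, q)) (far (dual_twist C \<delta> F B) (Idn C Y, g))"
      unfolding S_left[OF Y] using exact[OF FD[OF Y]] q by (simp add: right_exact_def)
  qed
  have "finite_abelian_category C" using C by (simp add: finite_tensor_category_def)
  from finite_abelian_generator[OF this] show ?thesis using coend_exists_of_generator by blast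
qed

theorem theorem3p6:
  fixes C :: "('o, 'm, 'k :: field) moncat"
    and \<delta> :: "('o, 'm) duality"
    and F :: "('o, 'm, 'o, 'm) fctr"
  assumes "finite_tensor_category C"
    and "left_duality C \<delta>"
    and "left_exact C C F"
  shows "(\<forall>(P :: ('p, 'n, 'k) lincat) box. deligne_product C C P box \<longrightarrow>
            coend_exists C P (dual_twist C \<delta> F box)) \<and>
         coend_exists C C (dual_twist C \<delta> F (Tens C))"
proof (intro conjI allI impI)
  have F: "linear_functor C C F" using assms(3) by (simp add: left_exact_def)
  show "coend_exists C P (dual_twist C \<delta> F box)"
    if "deligne_product C C P box" for P :: "('p, 'n, 'k) lincat" and box
    \<comment> \<open>Right exactness in the second variable and abelianness of the target are parts
      of being a Deligne product.\<close>
    using that by (intro dual_twist_coend_exists[OF assms(1,2) F])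
      (auto simp: deligne_product_def right_exact_bifunctor_def)
  have C: "abelian_category C" and bi: "bilinear_functor C C C (Tens C)" and rig: "rigid C"
    using assms(1) by (auto simp: finite_tensor_category_def finite_abelian_category_def)
  interpret linear_monoidal_category C
    using assms(1) C by (simp add: finite_tensor_category_def linear_monoidal_category_def
        linear_monoidal_category_axioms_def abelian_category_def)
  \<comment> \<open>Here right exactness comes from rigidity instead.\<close>
  show "coend_exists C C (dual_twist C \<delta> F (Tens C))"
    by (rule dual_twist_coend_exists[OF assms(1,2) F C bi tensor_right_exact[OF rig]])
qed

end
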